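(* Let $n,d$ be integers with $1\le d\le n$ and let $T=\{t_0<t_1<\cdots<t_n\}\subset\mathbb{Z}$. Let $C_d(T)=\operatorname{conv}\{(t,t^2,\ldots,t^d):t\in T\}\subset\mathbb{R}^d$. For $1\le i\le n$ put $g_i=t_i-t_{i-1}$ and $I_i=\{t_{i-1},t_{i-1}+1,\ldots,t_i-1\}$, and let $\mathcal{S}=\prod_{i=1}^n I_i$ and $G=|\mathcal{S}|=\prod_{i=1}^n g_i$. For $\mathbf{s}=(s_1,\ldots,s_n)\in\mathcal{S}$ let $Z_d(\mathbf{s})=\sum_{i=1}^n[0,g_i u_d(s_i)]\subset\mathbb{R}^d$ (Minkowski sum of segments), where $u_d(s)=(1,s,\ldots,s^{d-1})$. Then, as polynomials in $m$, $$E_{C_d(T)}(m)=\frac{1}{G}\sum_{\mathbf{s}\in\mathcal{S}}E_{Z_d(\mathbf{s})}(m).$$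
   Context: For a $d$-dimensional lattice polytope $P\subset\mathbb{R}^d$ (convex hull of finitely many points of $\mathbb{Z}^d$), the Ehrhart polynomial $E_P$ is the polynomial characterized by $E_P(m)=|mP\cap\mathbb{Z}^d|$ for all integers $m>0$. For $a\in\mathbb{R}^d$, $[0,a]=\{\lambda a:0\le\lambda\le1\}$ denotes the line segment from the origin to $a$. The polytopes $C_d(T)$ and $Z_d(\mathbf{s})$ are $d$-dimensional lattice polytopes in $\mathbb{R}^d$. *)

theory Defs
  imports "HOL-Analysis.Analysis" "HOL-Computational_Algebra.Polynomial"
begin

text \<open>
  Euclidean \<open>d\<close>-space is \<open>real ^ 'd\<close>. The index type \<open>'d\<close> carries no order, so the numbering of the
  coordinates is passed explicitly as \<open>idx :: 'd \<Rightarrow> nat\<close>, meant to be a bijection from \<open>UNIV\<close>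
  onto \<open>{1..d}\<close>.
\<close>

definition lattice_points :: "(real ^ 'd) set" where
  "lattice_points = {x. \<forall>i. x $ i \<in> \<int>}"

definition dilate_count :: "(real ^ 'd) set \<Rightarrow> nat \<Rightarrow> nat" where
  "dilate_count P m = card ((\<lambda>x. real m *\<^sub>R x) ` P \<inter> lattice_points)"

definition ehrhart_poly :: "(real ^ 'd) set \<Rightarrow> real poly" where
  "ehrhart_poly P = (THE p. \<forall>m>0. poly p (real m) = real (dilate_count P m))"

lemma ehrhart_poly_eqI:
  assumes "\<And>m. m > 0 \<Longrightarrow> poly p (real m) = real (dilate_count P m)"
  shows "ehrhart_poly P = p"
  unfolding ehrhart_poly_def
proof (rule the_equality)
  show "\<forall>m>0. poly p (real m) = real (dilate_count P m)"
    using assms by blast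
next
  fix q :: "real poly"
  assume q: "\<forall>m>0. poly q (real m) = real (dilate_count P m)"
  have "infinite (real ` {0<..})"
    by (simp add: finite_image_iff inj_on_def infinite_Ioi)
  moreover have "real ` {0<..} \<subseteq> {x. poly (q - p) x = 0}"
    using q assms by auto
  ultimately have "infinite {x. poly (q - p) x = 0}"
    using finite_subset by blast
  then show "q = p"
    using poly_roots_finite[of "q - p"] by auto
qed

definition cyclic_polytope :: "('d \<Rightarrow> nat) \<Rightarrow> int set \<Rightarrow> (real ^ 'd) set" where
  "cyclic_polytope idx T = convex hull ((\<lambda>t. \<chi> j. of_int t ^ idx j) ` T)"

text \<open>The vector \<open>(1, s, \<dots>, s ^ (d - 1))\<close>; the truncated subtraction is harmless as \<open>idx j \<ge> 1\<close>.\<close>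

definition moment_vec :: "('d \<Rightarrow> nat) \<Rightarrow> int \<Rightarrow> real ^ 'd" where
  "moment_vec idx s = (\<chi> j. of_int s ^ (idx j - 1))"

definition gap :: "(nat \<Rightarrow> int) \<Rightarrow> nat \<Rightarrow> int" where
  "gap t i = t i - t (i - 1)"

definition gap_box :: "(nat \<Rightarrow> int) \<Rightarrow> nat \<Rightarrow> (nat \<Rightarrow> int) set" where
  "gap_box t n = (\<Pi>\<^sub>E i\<in>{1..n}. {t (i - 1)..t i - 1})"

lemma card_gap_box:
  assumes "strict_mono_on {0..n} t"
  shows "int (card (gap_box t n)) = (\<Prod>i=1..n. gap t i)"
proof -
  have "int (nat (t i - t (i - 1))) = t i - t (i - 1)" if "i \<in> {1..n}" for i
    using strict_mono_onD[OF assms, of "i - 1" i] that by auto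
  then show ?thesis
    by (simp add: gap_box_def gap_def card_PiE)
qed

text \<open>The sum of sets is the Minkowski sum of \<^theory>\<open>HOL-Library.Set_Algebras\<close>.\<close>

definition moment_zonotope ::
    "('d \<Rightarrow> nat) \<Rightarrow> (nat \<Rightarrow> int) \<Rightarrow> nat \<Rightarrow> (nat \<Rightarrow> int) \<Rightarrow> (real ^ 'd) set" where
  "moment_zonotope idx t n s =
     (\<Sum>i=1..n. closed_segment 0 (of_int (gap t i) *\<^sub>R moment_vec idx (s i)))"

end

theory Submission
  imports Defs
begin

text \<open>
  Both Ehrhart polynomials are computed exactly, without volumes or determinants.

  The lattice points of a zonotope are counted by adding one segment at a time. If the new generator is
  \<open>a u(s)\<close> with \<open>a\<close> a natural number, then every lattice line in direction \<open>u(s)\<close> that meets the old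
  zonotope acquires exactly \<open>a\<close> new lattice points, and the projection along \<open>u(s)\<close> is a zonotope of the
  same kind in one dimension less, with generators \<open>a\<^sub>i (s - s\<^sub>i) u(s\<^sub>i)\<close>.

  For the cyclic polytope a point is identified with a linear functional \<open>y\<close> on polynomials,
  \<open>x\<^sup>j \<mapsto> y\<^sub>j\<close>. The lower boundary of the cyclic polytope has integer height above every lattice point,
  since the facet through nodes \<open>K\<close> is the zero set of the monic integer polynomial \<open>\<Prod>\<^sub>k (x - k)\<close>. So the points of
  dimension \<open>d\<close> are those of dimension \<open>d - 1\<close> together with those in a disjoint union of half-open simplices
  \<open>J\<close>. Summing out the last coordinates one by one shows that such a simplex contains \<open>m\<^sup>d V(J) / d!\<close> points,
  where \<open>V\<close> is the Vandermonde product: each count is a spline with integer knots, for which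
  sums over the integers equal integrals. Finally \<open>V(J) / d!\<close> is the sum of \<open>V(s)\<close> over all integer
  \<open>s\<close> interlacing \<open>J\<close>, and the simplices \<open>J\<close> sort the sequences \<open>s\<close> taken from distinct intervals \<open>I\<^sub>i\<close>.
\<close>

section \<open>Node polynomials and moment functionals\<close>

text \<open>Boundaries are the obstacle: neighbouring simplices share faces, and a signed sum over
  faces needs general position. A single displacement along - (1, N, N^2, ...) settles both. It
  changes the functional of a monic \<open>node_poly F\<close> by a multiple of the value of that
  polynomial at \<open>N\<close>, which is positive for every \<open>F\<close> because
  \<open>N\<close> lies beyond all nodes. Integral values thus all move down by a small amount, and
  every sign question becomes the strict inequality \<open>mom y (node_poly F) > 0\<close>. Both
  Ehrhart polynomials are brought to one normal form, \<open>gap_poly\<close>: the coefficient of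
  m^k sums Vandermonde products over k integers taken from k distinct intervals. The recursions
  carry a weight \<open>w\<close>, since removing the largest integer x from a Vandermonde product
  leaves a factor x - s for every smaller s. On the zonotope side the same factor x - s is what the
  projection along u(x) puts on the length of the generator at s.\<close>

definition node_poly :: "int set \<Rightarrow> real poly" where
  "node_poly B = (\<Prod>b\<in>B. [:- of_int b, 1:])"

lemma poly_node_poly: "poly (node_poly B) x = (\<Prod>b\<in>B. x - of_int b)"
  by (simp add: node_poly_def poly_prod)

lemma node_poly_insert: "finite B \<Longrightarrow> b \<notin> B \<Longrightarrow> node_poly (insert b B) = [:- of_int b, 1:] * node_poly B"
  by (simp add: node_poly_def)

lemma monic_prod_linear:
  "finite I \<Longrightarrow> degree (\<Prod>i\<in>I. [:- a i, 1 :: real:]) = card I \<and> coeff (\<Prod>i\<in>I. [:- a i, 1 :: real:]) (card I) = 1"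
proof (induction rule: finite_induct)
  case (insert b B)
  have nz: "(\<Prod>i\<in>B. [:- a i, 1 :: real:]) \<noteq> 0" using insert by (metis coeff_0 zero_neq_one)
  have "degree (\<Prod>i\<in>insert b B. [:- a i, 1 :: real:]) = Suc (card B)"
    using insert nz by (simp add: degree_mult_eq del: mult_pCons_left)
  moreover have "coeff (\<Prod>i\<in>insert b B. [:- a i, 1 :: real:]) (Suc (card B)) = 1"
    using insert by (simp add: coeff_pCons coeff_eq_0)
  ultimately show ?case using insert by simp
qed simp

lemma monic_node_poly: "finite B \<Longrightarrow> degree (node_poly B) = card B \<and> coeff (node_poly B) (card B) = 1"
  unfolding node_poly_def by (rule monic_prod_linear)

lemmas degree_node_poly = monic_node_poly[THEN conjunct1]
  and coeff_node_poly = monic_node_poly[THEN conjunct2]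

lemma poly_eq_0_nodes:
  fixes p :: "real poly"
  assumes "finite K" and "p = 0 \<or> degree p < card K" and "\<And>i. i \<in> K \<Longrightarrow> poly p (of_int i) = 0"
  shows "p = 0"
proof (rule ccontr)
  assume p: "p \<noteq> 0"
  have "card K = card (real_of_int ` K)" by (simp add: card_image inj_on_def)
  also have "\<dots> \<le> card {x. poly p x = 0}"
    using assms(3) by (intro card_mono poly_roots_finite p) auto
  also have "\<dots> \<le> degree p" using p by (rule card_poly_roots_bound)
  finally show False using assms(2) p by auto
qed

lemma poly_eq_smult_node_poly:
  fixes p :: "real poly"
  assumes "finite K" and "degree p \<le> card K" and "\<And>i. i \<in> K \<Longrightarrow> poly p (of_int i) = 0"
  shows "p = smult (coeff p (card K)) (node_poly K)"
proof -
  define q where "q = p - smult (coeff p (card K)) (node_poly K)"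
  have dq: "degree q \<le> card K"
    unfolding q_def by (rule degree_diff_le) (use assms degree_node_poly[of K] in \<open>auto simp: degree_smult_eq\<close>)
  have "coeff q (card K) = 0" by (simp add: q_def coeff_node_poly assms(1))
  then have "q = 0 \<or> degree q < card K"
    using dq by (metis le_neq_implies_less leading_coeff_0_iff)
  moreover have "poly q (of_int i) = 0" if "i \<in> K" for i
    using assms(1,3) that by (auto simp: q_def poly_node_poly prod_zero_iff)
  ultimately have "q = 0" using poly_eq_0_nodes assms(1) by blast
  then show ?thesis by (simp add: q_def)
qed

text \<open>For \<open>i\<close> in \<open>K\<close> this is the derivative of
  \<open>node_poly K\<close> at \<open>i\<close>, the denominator of Lagrange interpolation and of
  divided differences.\<close>

definition node_deriv :: "int set \<Rightarrow> int \<Rightarrow> real" where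
  "node_deriv K i = (\<Prod>l\<in>K - {i}. of_int i - of_int l)"

lemma node_deriv_nz: "finite K \<Longrightarrow> node_deriv K i \<noteq> 0"
  by (auto simp: node_deriv_def prod_zero_iff)

lemma lagrange:
  fixes p :: "real poly"
  assumes "finite K" and "degree p < card K"
  shows "p = (\<Sum>i\<in>K. smult (poly p (of_int i) / node_deriv K i) (node_poly (K - {i})))"
proof -
  define q where "q = (\<Sum>i\<in>K. smult (poly p (of_int i) / node_deriv K i) (node_poly (K - {i})))"
  have dq: "degree q \<le> card K - 1"
    unfolding q_def
  proof (rule degree_sum_le)
    fix i assume "i \<in> K"
    then show "degree (smult (poly p (of_int i) / node_deriv K i) (node_poly (K - {i}))) \<le> card K - 1"
      using assms(1) degree_node_poly[of "K - {i}"] by (auto simp: degree_smult_eq)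
  qed (rule assms(1))
  have pq: "poly q (of_int j) = poly p (of_int j)" if j: "j \<in> K" for j
  proof -
    have "poly q (of_int j) = (\<Sum>i\<in>K. poly p (of_int i) / node_deriv K i * (\<Prod>b\<in>K - {i}. of_int j - of_int b))"
      by (simp add: q_def poly_sum poly_node_poly)
    also have "\<dots> = (\<Sum>i\<in>K. if i = j then poly p (of_int j) else 0)"
    proof (rule sum.cong)
      fix i assume "i \<in> K"
      show "poly p (of_int i) / node_deriv K i * (\<Prod>b\<in>K - {i}. of_int j - of_int b)
        = (if i = j then poly p (of_int j) else 0)"
      proof (cases "i = j")
        case True
        then show ?thesis using node_deriv_nz[OF assms(1), of j] by (simp add: node_deriv_def)
      next
        case False
        then have "(\<Prod>b\<in>K - {i}. real_of_int j - of_int b) = 0"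
          using j assms(1) by (auto simp: prod_zero_iff)
        then show ?thesis using False by simp
      qed
    qed simp
    also have "\<dots> = poly p (of_int j)" using j assms(1) by simp
    finally show ?thesis .
  qed
  have "p - q = 0"
  proof (rule poly_eq_0_nodes[OF assms(1)])
    have "degree (p - q) \<le> card K - 1" using dq assms(2) by (intro degree_diff_le) auto
    then show "p - q = 0 \<or> degree (p - q) < card K" using assms(2) by auto
  qed (simp add: pq)
  then show ?thesis by (simp add: q_def)
qed

text \<open>Compare the coefficients of the highest power in Lagrange's formula: all basis
  polynomials are monic of degree \<open>card K - 1\<close>.\<close>

lemma divided_difference:
  fixes p :: "real poly"
  assumes "finite K" and "degree p < card K"
  shows "(\<Sum>i\<in>K. poly p (of_int i) / node_deriv K i) = coeff p (card K - 1)"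
proof -
  have "coeff p (card K - 1) =
      (\<Sum>i\<in>K. poly p (of_int i) / node_deriv K i * coeff (node_poly (K - {i})) (card K - 1))"
    by (subst lagrange[OF assms]) (simp add: coeff_sum)
  also have "\<dots> = (\<Sum>i\<in>K. poly p (of_int i) / node_deriv K i)"
  proof (rule sum.cong)
    fix i assume "i \<in> K"
    then show "poly p (of_int i) / node_deriv K i * coeff (node_poly (K - {i})) (card K - 1)
        = poly p (of_int i) / node_deriv K i"
      using assms(1) coeff_node_poly[of "K - {i}"] by auto
  qed simp
  finally show ?thesis by simp
qed

text \<open>Coordinate \<open>y 0\<close> is the homogenizing one: it is the total mass of a measure
  with moments \<open>y\<close>, and it equals \<open>m\<close> for points of the dilate by
  \<open>m\<close>.\<close>

definition mom :: "(nat \<Rightarrow> real) \<Rightarrow> real poly \<Rightarrow> real" where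
  "mom y p = (\<Sum>i\<le>degree p. coeff p i * y i)"

lemma mom_altdef: "degree p \<le> N \<Longrightarrow> mom y p = (\<Sum>i\<le>N. coeff p i * y i)"
  unfolding mom_def by (rule sum.mono_neutral_left) (auto simp: coeff_eq_0)

lemma mom_add: "mom y (p + q) = mom y p + mom y q"
  using mom_altdef[of "p + q" "max (degree p) (degree q)" y] degree_add_le[of p _ q]
  by (simp add: mom_altdef[of p "max (degree p) (degree q)"]
      mom_altdef[of q "max (degree p) (degree q)"] algebra_simps sum.distrib)

lemma mom_smult: "mom y (smult c p) = c * mom y p"
  by (cases "c = 0") (auto simp: mom_def sum_distrib_left algebra_simps)

lemma mom_0: "mom y 0 = 0"
  by (simp add: mom_def)

lemma mom_sum: "mom y (\<Sum>i\<in>I. f i) = (\<Sum>i\<in>I. mom y (f i))"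
  by (induction I rule: infinite_finite_induct) (auto simp: mom_0 mom_add)

lemma mom_diff: "mom y (p - q) = mom y p - mom y q"
  using mom_add[of y p "smult (-1) q"] mom_smult[of y "-1" q] by simp

lemma mom_pCons: "mom y (pCons a p) = a * y 0 + mom (\<lambda>j. y (Suc j)) p"
proof -
  have "mom y (pCons a p) = (\<Sum>i\<le>Suc (degree p). coeff (pCons a p) i * y i)"
    by (rule mom_altdef) (rule degree_pCons_le)
  also have "\<dots> = a * y 0 + (\<Sum>i\<le>degree p. coeff p i * y (Suc i))"
    by (subst sum.atMost_Suc_shift) simp
  finally show ?thesis by (simp add: mom_def)
qed

lemma mom_cong: "(\<And>i. i \<le> degree p \<Longrightarrow> y i = z i) \<Longrightarrow> mom y p = mom z p"
  by (simp add: mom_def)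

lemma mom_of_measure:
  assumes "\<And>j. j \<le> degree p \<Longrightarrow> y j = (\<Sum>t\<in>T. c t * of_int t ^ j)"
  shows "mom y p = (\<Sum>t\<in>T. c t * poly p (of_int t))"
proof -
  have "mom y p = (\<Sum>i\<le>degree p. \<Sum>t\<in>T. c t * (coeff p i * of_int t ^ i))"
    by (simp add: mom_def assms sum_distrib_left algebra_simps)
  also have "\<dots> = (\<Sum>t\<in>T. c t * poly p (of_int t))"
    by (subst sum.swap) (simp add: poly_altdef sum_distrib_left)
  finally show ?thesis .
qed

lemma mom_sub_power:
  "mom (\<lambda>j. y j - e * x ^ j) p = mom y p - e * poly p x"
  by (simp add: mom_def poly_altdef algebra_simps sum_subtractf sum_distrib_left)

text \<open>A monic polynomial sees the last moment with coefficient one. With the lower moments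
  fixed, its functional is therefore the height above the hyperplane through the nodes
  \<open>K\<close>.\<close>

lemma mom_upd_top:
  assumes "finite K" and "card K = k"
  shows "mom (y(k := z)) (node_poly K) = mom y (node_poly K) + z - y k"
proof -
  have d: "degree (node_poly K) = k" "coeff (node_poly K) k = 1"
    using assms degree_node_poly coeff_node_poly by auto
  have "mom w (node_poly K) = (\<Sum>i<k. coeff (node_poly K) i * w i) + w k" for w
    unfolding mom_def d(1) by (simp add: lessThan_Suc_atMost[symmetric] d(2))
  from this[of "y(k := z)"] this[of y] show ?thesis by simp
qed

lemma coeff_node_poly_Ints: "finite B \<Longrightarrow> coeff (node_poly B) i \<in> \<int>"
proof (induction B arbitrary: i rule: finite_induct)
  case empty
  then show ?case by (auto simp: node_poly_def coeff_1 simp flip: one_pCons)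
next
  case (insert b B)
  then show ?case by (cases i) (auto simp: node_poly_insert coeff_pCons)
qed

lemma mom_node_poly_Ints:
  assumes "finite B" and "\<And>j. y j \<in> \<int>"
  shows "mom y (node_poly B) \<in> \<int>"
  unfolding mom_def using assms by (intro Ints_sum Ints_mult coeff_node_poly_Ints) auto

text \<open>The two polynomials share all linear factors but one. In \<open>half_open_fibre\<close>
  this turns the sign conditions of the simplex \<open>K - {j}\<close> into comparisons between the
  values belonging to \<open>i\<close> and \<open>j\<close>.\<close>

lemma node_poly_diff:
  assumes "finite K" and "i \<in> K" and "j \<in> K" and "i \<noteq> j"
  shows "(of_int i - of_int j) * mom y (node_poly (K - {j} - {i}))
    = mom y (node_poly (K - {i})) - mom y (node_poly (K - {j}))"
proof -
  have "K - {i} = insert j (K - {j} - {i})" "K - {j} = insert i (K - {j} - {i})"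
    using assms by auto
  then have "node_poly (K - {i}) - node_poly (K - {j})
      = [:- of_int j, 1:] * node_poly (K - {j} - {i}) - [:- of_int i, 1:] * node_poly (K - {j} - {i})"
    using assms node_poly_insert[of "K - {j} - {i}" j] node_poly_insert[of "K - {j} - {i}" i]
    by (metis Diff_iff finite_Diff insertCI)
  also have "\<dots> = smult (of_int i - of_int j) (node_poly (K - {j} - {i}))"
    by (simp add: smult_diff_left)
  finally show ?thesis by (metis mom_diff mom_smult)
qed

lemma sgn_prod_real: "sgn (\<Prod>x\<in>A. f x) = (\<Prod>x\<in>A. sgn (f x :: real))"
  by (induction A rule: infinite_finite_induct) (auto simp: sgn_mult)

lemma sgn_node_deriv:
  assumes "finite K"
  shows "sgn (node_deriv K i) = (-1) ^ card {j \<in> K. j > i}"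
proof -
  have "sgn (node_deriv K i) = (\<Prod>l\<in>K - {i}. if l > i then -1 else 1)"
    unfolding node_deriv_def sgn_prod_real by (rule prod.cong) (auto simp: sgn_if)
  also have "\<dots> = (-1) ^ card {l \<in> K - {i}. l > i}"
    using assms by (simp add: prod.If_cases Int_def conj_commute)
  also have "{l \<in> K - {i}. l > i} = {l \<in> K. l > i}" by auto
  finally show ?thesis .
qed

section \<open>Half-open simplices\<close>

text \<open>Let \<open>p\<close> minimize \<open>v\<close> on \<open>P\<close> and \<open>q\<close>
  maximize it on \<open>M\<close>. One summand of each sum survives: the first is the indicator of
  \<open>v q < v p\<close> and \<open>v p > 0\<close>, the second that of \<open>v q < v p\<close>
  and \<open>v q > 0\<close>. Their difference is the indicator of
  \<open>v q < 0 < v p\<close>.\<close>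

lemma min_max_split:
  fixes v :: "'a \<Rightarrow> real"
  assumes fin: "finite P" "finite M" and ne: "P \<noteq> {}" "M \<noteq> {}" and disj: "P \<inter> M = {}"
    and inj: "inj_on v (P \<union> M)" and nz: "\<And>i. i \<in> P \<union> M \<Longrightarrow> v i \<noteq> 0"
  shows "(of_bool ((\<forall>i\<in>P. v i > 0) \<and> (\<forall>i\<in>M. v i < 0)) :: real) =
      (\<Sum>j\<in>P. of_bool ((\<forall>i\<in>P - {j}. v i > v j) \<and> (\<forall>i\<in>M. v i < v j) \<and> v j > 0))
    - (\<Sum>j\<in>M. of_bool ((\<forall>i\<in>P. v i > v j) \<and> (\<forall>i\<in>M - {j}. v i < v j) \<and> v j > 0))"
proof -
  obtain p where p: "p \<in> P" "\<And>i. i \<in> P \<Longrightarrow> v p \<le> v i"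
    using fin ne by (metis (full_types) arg_min_if_finite(1) arg_min_if_finite(2) linorder_not_less)
  obtain q where q: "q \<in> M" "\<And>i. i \<in> M \<Longrightarrow> v i \<le> v q"
  proof -
    have "Max (v ` M) \<in> v ` M" using fin ne by (intro Max_in) auto
    then obtain q where "q \<in> M" "v q = Max (v ` M)" by auto
    then show ?thesis using that fin by (metis Max_ge finite_imageI imageI)
  qed
  have pq: "v p \<noteq> v q" "v p \<noteq> 0" "v q \<noteq> 0"
    using p q inj disj nz by (auto dest: inj_onD)
  have ps: "v p < v i" if "i \<in> P" "i \<noteq> p" for i
    using p inj that by (metis UnCI inj_onD order_le_less)
  have qs: "v i < v q" if "i \<in> M" "i \<noteq> q" for i
    using q inj that by (metis UnCI inj_onD order_le_less)
  have "(\<Sum>j\<in>P. of_bool ((\<forall>i\<in>P - {j}. v i > v j) \<and> (\<forall>i\<in>M. v i < v j) \<and> v j > 0))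
      = (\<Sum>j\<in>P. if j = p then of_bool (v q < v p \<and> v p > 0) else 0 :: real)"
  proof (rule sum.cong)
    fix j assume "j \<in> P"
    show "of_bool ((\<forall>i\<in>P - {j}. v i > v j) \<and> (\<forall>i\<in>M. v i < v j) \<and> v j > 0)
      = (if j = p then of_bool (v q < v p \<and> v p > 0) else 0 :: real)"
    proof (cases "j = p")
      case True
      have "((\<forall>i\<in>P - {p}. v i > v p) \<and> (\<forall>i\<in>M. v i < v p) \<and> v p > 0) = (v q < v p \<and> v p > 0)"
        using ps q by fastforce
      then show ?thesis using True by simp
    next
      case False
      then have "\<not> (\<forall>i\<in>P - {j}. v i > v j)" using p(1) ps[OF \<open>j \<in> P\<close>] by (metis Diff_iff less_asym singletonD)
      then show ?thesis using False by simp
    qed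
  qed simp
  then have 1: "(\<Sum>j\<in>P. of_bool ((\<forall>i\<in>P - {j}. v i > v j) \<and> (\<forall>i\<in>M. v i < v j) \<and> v j > 0))
      = (of_bool (v q < v p \<and> v p > 0) :: real)"
    using p(1) fin by simp
  have "(\<Sum>j\<in>M. of_bool ((\<forall>i\<in>P. v i > v j) \<and> (\<forall>i\<in>M - {j}. v i < v j) \<and> v j > 0))
      = (\<Sum>j\<in>M. if j = q then of_bool (v q < v p \<and> v q > 0) else 0 :: real)"
  proof (rule sum.cong)
    fix j assume "j \<in> M"
    show "of_bool ((\<forall>i\<in>P. v i > v j) \<and> (\<forall>i\<in>M - {j}. v i < v j) \<and> v j > 0)
      = (if j = q then of_bool (v q < v p \<and> v q > 0) else 0 :: real)"
    proof (cases "j = q")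
      case True
      have "((\<forall>i\<in>P. v i > v q) \<and> (\<forall>i\<in>M - {q}. v i < v q) \<and> v q > 0) = (v q < v p \<and> v q > 0)"
        using qs p by fastforce
      then show ?thesis using True by simp
    next
      case False
      then have "\<not> (\<forall>i\<in>M - {j}. v i < v j)" using q(1) qs[OF \<open>j \<in> M\<close>] by (metis Diff_iff less_asym singletonD)
      then show ?thesis using False by simp
    qed
  qed simp
  then have 2: "(\<Sum>j\<in>M. of_bool ((\<forall>i\<in>P. v i > v j) \<and> (\<forall>i\<in>M - {j}. v i < v j) \<and> v j > 0))
      = (of_bool (v q < v p \<and> v q > 0) :: real)"
    using q(1) fin by simp
  have 3: "((\<forall>i\<in>P. v i > 0) \<and> (\<forall>i\<in>M. v i < 0)) = (v p > 0 \<and> v q < 0)"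
    using p q by fastforce
  show ?thesis unfolding 1 2 3 using pq by auto
qed

text \<open>For integral \<open>y\<close> this says that \<open>y\<close>, displaced by \<open>- \<epsilon> (1, N, N\<^sup>2, \<dots>)\<close> with \<open>N\<close> above all nodes, lies in
  the interior of the cone over the simplex with nodes \<open>K\<close>: the sign of a coefficient is that of an integer
  shifted down by a small amount.\<close>

definition half_open :: "int set \<Rightarrow> (nat \<Rightarrow> real) \<Rightarrow> bool" where
  "half_open K y \<longleftrightarrow>
    (\<forall>i\<in>K. mom y (node_poly (K - {i})) > 0 \<longleftrightarrow> even (card {j \<in> K. j > i}))"

text \<open>A line in the direction of the last coordinate meets the simplex in an interval, so
  \<open>y\<close> is inside iff it lies above the facet where the line enters and not above the one
  where it leaves. The line meets the facet opposite to \<open>j\<close> iff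
  \<open>half_open (K - {j}) y\<close>, and the sign of \<open>node_deriv K j\<close> tells lower
  from upper facets.\<close>

lemma half_open_fibre:
  assumes fin: "finite K" and card: "card K \<ge> 2" and int: "\<And>j. y j \<in> \<int>"
  shows "(of_bool (half_open K y) :: real) =
    (\<Sum>j\<in>K. sgn (node_deriv K j) *
      of_bool (half_open (K - {j}) y \<and> mom y (node_poly (K - {j})) > 0))"
proof -
  define f where "f i = mom y (node_poly (K - {i}))" for i
  define par where "par i = even (card {j \<in> K. j > i})" for i
  \<comment> \<open>The displacement lowers \<open>f i\<close> by a multiple of 1 / (N - i), which
    increases with \<open>i\<close>. Only this monotonicity and smallness matter, so the linear
    function i + S + 1 takes its place; \<open>S\<close> and \<open>e\<close> keep the amount
    strictly between 0 and 1.\<close>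
  define S where "S = (\<Sum>i\<in>K. \<bar>real_of_int i\<bar>)"
  define e where "e = 1 / (2 * (S + 2))"
  define v where "v i = f i - e * (of_int i + S + 1)" for i
  have s0: "S \<ge> 0" unfolding S_def by (rule sum_nonneg) auto
  have si: "\<bar>real_of_int i\<bar> \<le> S" if "i \<in> K" for i
    unfolding S_def using fin that by (intro member_le_sum) auto
  have e0: "e > 0" using s0 by (simp add: e_def)
  have d0: "e * (of_int i + S + 1) > 0" if "i \<in> K" for i
    using e0 si[OF that] by (intro mult_pos_pos) linarith+
  have d1: "e * (of_int i + S + 1) < 1" if "i \<in> K" for i
    using si[OF that] s0 unfolding e_def by (simp add: divide_simps)
  have fint: "f i \<in> \<int>" for i unfolding f_def using fin int by (intro mom_node_poly_Ints) auto
  have less1: "f i < f j \<longleftrightarrow> f i + 1 \<le> f j" for i j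
    using fint[of i] fint[of j] by (auto elim!: Ints_cases)
  have pos1: "f i > 0 \<longleftrightarrow> f i \<ge> 1" for i
    using fint[of i] by (auto elim!: Ints_cases)
  have vpos: "v i > 0 \<longleftrightarrow> f i > 0" "v i \<noteq> 0" if "i \<in> K" for i
    using pos1[of i] d0[OF that] d1[OF that] by (auto simp: v_def)
  have vless: "v i < v j \<longleftrightarrow> (f i < f j \<or> (f i = f j \<and> j < i))" if "i \<in> K" "j \<in> K" for i j
  proof (cases "f i = f j")
    case True
    then show ?thesis using e0 by (simp add: v_def)
  next
    case False
    then show ?thesis using less1[of i j] less1[of j i] d0[OF that(1)] d1[OF that(1)] d0[OF that(2)] d1[OF that(2)]
      unfolding v_def by linarith
  qed
  have inj: "inj_on v K"
  proof (rule inj_onI)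
    fix i j assume "i \<in> K" "j \<in> K" "v i = v j"
    then show "i = j" using vless[of i j] vless[of j i] by force
  qed
  define P where "P = {i \<in> K. par i}"
  define M where "M = {i \<in> K. \<not> par i}"
  \<comment> \<open>The largest node has no node above it and lies in \<open>P\<close>; the second
    largest has exactly one and lies in \<open>M\<close>.\<close>
  have ne: "P \<noteq> {}" "M \<noteq> {}"
  proof -
    have K0: "K \<noteq> {}" using card by auto
    have a: "Max K \<in> K" "{j \<in> K. j > Max K} = {}"
      using Max_in[OF fin K0] fin by (auto simp: not_less)
    then have "Max K \<in> P" unfolding P_def par_def mem_Collect_eq a(2) by simp
    then show "P \<noteq> {}" by blast
    define K1 where "K1 = K - {Max K}"
    have K1: "finite K1" "K1 \<noteq> {}"
      using card fin a(1) card_gt_0_iff[of K1] by (auto simp: K1_def)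
    have b: "Max K1 \<in> K1" using K1 by simp
    have "{j \<in> K. j > Max K1} = {Max K}"
    proof (intro equalityI subsetI)
      fix j assume j: "j \<in> {j \<in> K. j > Max K1}"
      then have "j \<notin> K1" using K1(1) by (metis (mono_tags, lifting) Max_ge mem_Collect_eq not_less)
      then show "j \<in> {Max K}" using j by (auto simp: K1_def)
    next
      fix j assume "j \<in> {Max K}"
      then show "j \<in> {j \<in> K. j > Max K1}"
        using a(1) b Max_ge[OF fin, of "Max K1"] by (auto simp: K1_def order_less_le)
    qed
    then have c: "card {j \<in> K. j > Max K1} = 1" by simp
    have "Max K1 \<in> M" unfolding M_def par_def mem_Collect_eq c using b by (simp add: K1_def)
    then show "M \<noteq> {}" by blast
  qed
  have PM: "finite P" "finite M" "P \<inter> M = {}" "P \<union> M = K"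
    using fin by (auto simp: P_def M_def)
  have all: "half_open K y \<longleftrightarrow> (\<forall>i\<in>P. v i > 0) \<and> (\<forall>i\<in>M. v i < 0)"
  proof -
    have "half_open K y \<longleftrightarrow> (\<forall>i\<in>K. v i > 0 \<longleftrightarrow> par i)"
      unfolding half_open_def using vpos by (auto simp: f_def par_def)
    also have "\<dots> \<longleftrightarrow> (\<forall>i\<in>P. v i > 0) \<and> (\<forall>i\<in>M. v i < 0)"
    proof -
      have "(v i > 0 \<longleftrightarrow> par i) \<longleftrightarrow> (par i \<longrightarrow> v i > 0) \<and> (\<not> par i \<longrightarrow> v i < 0)" if "i \<in> K" for i
        using vpos(2)[OF that] by linarith
      then show ?thesis unfolding P_def M_def by blast
    qed
    finally show ?thesis .
  qed
  \<comment> \<open>By \<open>node_poly_diff\<close> the sign at \<open>i\<close> is that of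
    \<open>v i - v j\<close>, up to the sign of \<open>i - j\<close>. For \<open>i < j\<close> the
    deleted node lay above \<open>i\<close>, so the parity flips too and the two changes
    cancel.\<close>
  have one: "half_open (K - {j}) y \<longleftrightarrow> (\<forall>i\<in>P - {j}. v i > v j) \<and> (\<forall>i\<in>M - {j}. v i < v j)"
    if j: "j \<in> K" for j
  proof -
    have "(mom y (node_poly (K - {j} - {i})) > 0 \<longleftrightarrow> even (card {l \<in> K - {j}. l > i})) \<longleftrightarrow> (v i > v j \<longleftrightarrow> par i)"
      if i: "i \<in> K" "i \<noteq> j" for i
    proof (cases "i > j")
      case True
      have "{l \<in> K - {j}. l > i} = {l \<in> K. l > i}" using True by auto
      moreover have "mom y (node_poly (K - {j} - {i})) > 0 \<longleftrightarrow> f i > f j"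
      proof -
        have "real_of_int i - of_int j > 0" using True by simp
        then have "mom y (node_poly (K - {j} - {i})) > 0 \<longleftrightarrow>
            (of_int i - of_int j) * mom y (node_poly (K - {j} - {i})) > 0"
          by (simp add: zero_less_mult_iff)
        then show ?thesis using node_poly_diff[OF fin i(1) j i(2), of y] by (simp add: f_def)
      qed
      ultimately show ?thesis using vless[OF j i(1)] True by (simp add: par_def)
    next
      case False
      then have ij: "i < j" using i by simp
      have "{l \<in> K. l > i} = insert j {l \<in> K - {j}. l > i}" using ij j by auto
      then have "card {l \<in> K. l > i} = Suc (card {l \<in> K - {j}. l > i})"
        using fin by simp
      moreover have "mom y (node_poly (K - {j} - {i})) > 0 \<longleftrightarrow> f i < f j"
      proof -
        have "real_of_int i - of_int j < 0" using ij by simp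
        then have "mom y (node_poly (K - {j} - {i})) > 0 \<longleftrightarrow>
            (of_int i - of_int j) * mom y (node_poly (K - {j} - {i})) < 0"
          by (simp add: mult_less_0_iff)
        then show ?thesis using node_poly_diff[OF fin i(1) j i(2), of y] by (simp add: f_def)
      qed
      ultimately show ?thesis using vless[OF j i(1)] ij by (auto simp: par_def)
    qed
    then have "half_open (K - {j}) y \<longleftrightarrow> (\<forall>i\<in>K - {j}. v i > v j \<longleftrightarrow> par i)"
      unfolding half_open_def by auto
    also have "\<dots> \<longleftrightarrow> (\<forall>i\<in>P - {j}. v i > v j) \<and> (\<forall>i\<in>M - {j}. v i < v j)"
    proof -
      have "(v i > v j \<longleftrightarrow> par i) \<longleftrightarrow> (par i \<longrightarrow> v i > v j) \<and> (\<not> par i \<longrightarrow> v i < v j)"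
        if "i \<in> K - {j}" for i
      proof -
        have "v i \<noteq> v j" using inj j that by (auto dest: inj_onD)
        then show ?thesis by linarith
      qed
      then show ?thesis unfolding P_def M_def by blast
    qed
    finally show ?thesis .
  qed
  have "(\<Sum>j\<in>K. sgn (node_deriv K j) *
      of_bool (half_open (K - {j}) y \<and> mom y (node_poly (K - {j})) > 0))
    = (\<Sum>j\<in>P \<union> M. (if par j then 1 else -1 :: real) * of_bool (half_open (K - {j}) y \<and> v j > 0))"
    unfolding PM(4) by (rule sum.cong) (auto simp: sgn_node_deriv[OF fin] par_def vpos f_def)
  also have "\<dots> = (\<Sum>j\<in>P. of_bool (half_open (K - {j}) y \<and> v j > 0))
     - (\<Sum>j\<in>M. of_bool (half_open (K - {j}) y \<and> v j > 0))"
  proof -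
    have "(\<Sum>j\<in>P. (if par j then 1 else -1 :: real) * of_bool (half_open (K - {j}) y \<and> v j > 0))
      = (\<Sum>j\<in>P. of_bool (half_open (K - {j}) y \<and> v j > 0))"
      by (rule sum.cong) (auto simp: P_def)
    moreover have "(\<Sum>j\<in>M. (if par j then 1 else -1 :: real) * of_bool (half_open (K - {j}) y \<and> v j > 0))
      = (\<Sum>j\<in>M. - of_bool (half_open (K - {j}) y \<and> v j > 0))"
      by (rule sum.cong) (auto simp: M_def)
    ultimately show ?thesis
      unfolding sum.union_disjoint[OF PM(1-3)] by (simp only: sum_negf)
  qed
  also have "(\<Sum>j\<in>P. of_bool (half_open (K - {j}) y \<and> v j > 0)) =
     (\<Sum>j\<in>P. of_bool ((\<forall>i\<in>P - {j}. v i > v j) \<and> (\<forall>i\<in>M. v i < v j) \<and> v j > 0) :: real)"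
    using PM(3) by (intro sum.cong refl) (auto simp: one P_def M_def)
  also have "(\<Sum>j\<in>M. of_bool (half_open (K - {j}) y \<and> v j > 0)) =
     (\<Sum>j\<in>M. of_bool ((\<forall>i\<in>P. v i > v j) \<and> (\<forall>i\<in>M - {j}. v i < v j) \<and> v j > 0) :: real)"
    using PM(3) by (intro sum.cong refl) (auto simp: one P_def M_def)
  also have "(\<Sum>j\<in>P. of_bool ((\<forall>i\<in>P - {j}. v i > v j) \<and> (\<forall>i\<in>M. v i < v j) \<and> v j > 0))
    - (\<Sum>j\<in>M. of_bool ((\<forall>i\<in>P. v i > v j) \<and> (\<forall>i\<in>M - {j}. v i < v j) \<and> v j > 0))
    = (of_bool ((\<forall>i\<in>P. v i > 0) \<and> (\<forall>i\<in>M. v i < 0)) :: real)"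
    by (rule min_max_split[symmetric]) (use PM ne inj vpos in auto)
  finally show ?thesis by (simp add: all)
qed

text \<open>The quotients are the masses of the signed measure on \<open>K\<close> that represents
  \<open>y\<close>, in other words the barycentric coordinates of \<open>y\<close> in the simplex
  with nodes \<open>K\<close>.\<close>

lemma moments_lagrange:
  assumes "finite K" and "degree p < card K"
  shows "mom y p = (\<Sum>i\<in>K. mom y (node_poly (K - {i})) / node_deriv K i * poly p (of_int i))"
  by (subst lagrange[OF assms]) (simp add: mom_sum mom_smult mult.commute)

text \<open>The parities in \<open>half_open\<close> are the signs of \<open>node_deriv\<close>, so
  a half-open simplex is contained in the closed one.\<close>

lemma half_open_coeff_nonneg:
  assumes "finite K" and "half_open K y" and "i \<in> K"
  shows "mom y (node_poly (K - {i})) / node_deriv K i \<ge> 0"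
proof -
  have "even (card {j \<in> K. j > i}) \<longleftrightarrow> node_deriv K i > 0"
    using sgn_node_deriv[OF assms(1), of i] by (cases "even (card {j \<in> K. j > i})") (auto simp: sgn_if split: if_splits)
  then show ?thesis using assms(2,3) unfolding half_open_def
    by (metis divide_nonneg_pos divide_nonpos_nonpos leI less_eq_real_def)
qed

lemma mom_monom: "mom y (monom 1 j) = y j"
proof -
  have "mom y (monom 1 j) = (\<Sum>i\<le>j. if i = j then y i else 0)"
    unfolding mom_def degree_monom_eq[OF one_neq_zero] by (intro sum.cong) auto
  then show ?thesis by simp
qed

lemma half_open_measure:
  assumes "finite K" and "half_open K y"
  obtains c where "\<And>i. i \<in> K \<Longrightarrow> c i \<ge> 0"
    and "\<And>j. j < card K \<Longrightarrow> y j = (\<Sum>i\<in>K. c i * of_int i ^ j)"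
proof
  define c where "c i = mom y (node_poly (K - {i})) / node_deriv K i" for i
  show "c i \<ge> 0" if "i \<in> K" for i using half_open_coeff_nonneg[OF assms that] by (simp add: c_def)
  show "y j = (\<Sum>i\<in>K. c i * of_int i ^ j)" if "j < card K" for j
    using moments_lagrange[OF assms(1), of "monom 1 j" y] that
    by (simp add: mom_monom degree_monom_eq poly_monom c_def)
qed

lemma measure_bound:
  assumes c: "\<And>i. i \<in> K \<Longrightarrow> c i \<ge> 0" and M: "\<And>i. i \<in> K \<Longrightarrow> \<bar>of_int i\<bar> \<le> (M::real)"
  shows "\<bar>\<Sum>i\<in>K. c i * of_int i ^ j\<bar> \<le> (\<Sum>i\<in>K. c i) * M ^ j"
proof -
  have "\<bar>\<Sum>i\<in>K. c i * of_int i ^ j\<bar> \<le> (\<Sum>i\<in>K. \<bar>c i * of_int i ^ j\<bar>)"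
    by (rule sum_abs)
  also have "\<dots> \<le> (\<Sum>i\<in>K. c i * M ^ j)"
    using c M by (intro sum_mono) (auto simp: abs_mult power_abs intro!: mult_left_mono power_mono)
  finally show ?thesis by (simp add: sum_distrib_right)
qed

lemma half_open_bound:
  assumes "finite K" and "half_open K y" and "j < card K" and M: "\<And>i. i \<in> K \<Longrightarrow> \<bar>of_int i\<bar> \<le> (M::real)"
  shows "\<bar>y j\<bar> \<le> y 0 * M ^ j"
proof -
  obtain c where "\<And>i. i \<in> K \<Longrightarrow> c i \<ge> 0" "\<And>j. j < card K \<Longrightarrow> y j = (\<Sum>i\<in>K. c i * of_int i ^ j)"
    using half_open_measure[OF assms(1,2)] by blast
  then show ?thesis using measure_bound[of K c M j] M assms(3) by simp
qed

text \<open>The difference is the moment of order \<open>card K\<close> of the measure on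
  \<open>K\<close> that represents \<open>y\<close>, since \<open>node_poly K\<close> vanishes on
  its nodes. It will be a knot of the spline in \<open>box_count_formula\<close>, so the bound
  confines the knots.\<close>

lemma half_open_next_moment_bound:
  assumes fin: "finite K" and ho: "half_open K y" and "K \<noteq> {}" and M: "\<And>i. i \<in> K \<Longrightarrow> \<bar>of_int i\<bar> \<le> (M::real)"
  shows "\<bar>y (card K) - mom y (node_poly K)\<bar> \<le> y 0 * M ^ card K"
proof -
  obtain c where c: "\<And>i. i \<in> K \<Longrightarrow> c i \<ge> 0" "\<And>j. j < card K \<Longrightarrow> y j = (\<Sum>i\<in>K. c i * of_int i ^ j)"
    using half_open_measure[OF fin ho] by blast
  define u where "u = (\<Sum>i\<in>K. c i * of_int i ^ card K)"
  have "mom (y(card K := u)) (node_poly K) = (\<Sum>t\<in>K. c t * poly (node_poly K) (of_int t))"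
    using c(2) degree_node_poly[OF fin] by (intro mom_of_measure) (auto simp: u_def)
  also have "\<dots> = 0" using fin by (auto simp: poly_node_poly prod_zero_iff intro!: sum.neutral)
  finally have "u = y (card K) - mom y (node_poly K)" by (simp add: mom_upd_top[OF fin refl])
  moreover have "card K > 0" using assms by (simp add: card_gt_0_iff)
  ultimately show ?thesis using measure_bound[of K c M "card K"] c M by (simp add: u_def)
qed

lemma half_open_cong:
  assumes "finite K" and "\<And>j. j < card K \<Longrightarrow> y j = z j"
  shows "half_open K y \<longleftrightarrow> half_open K z"
proof -
  have "mom y (node_poly (K - {i})) = mom z (node_poly (K - {i}))" if "i \<in> K" for i
  proof (rule mom_cong)
    fix j assume "j \<le> degree (node_poly (K - {i}))"
    moreover have "card K > 0" using that assms by (auto simp: card_gt_0_iff)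
    ultimately show "y j = z j" using assms that degree_node_poly[of "K - {i}"] by simp
  qed
  then show ?thesis by (simp add: half_open_def)
qed

section \<open>Discrete antiderivatives and summation of splines\<close>

lemma poly_eqI_pointwise: "(\<And>x. poly p x = poly q x) \<Longrightarrow> p = (q :: real poly)"
  by (metis poly_eq_poly_eq_iff ext)

text \<open>A multiple of (x + 1)^(k+1) - x^(k+1) cancels the leading term of \<open>p\<close>; the
  rest has smaller degree.\<close>

lemma antidifference:
  fixes p :: "real poly"
  shows "\<exists>q. degree q \<le> Suc (degree p) \<and> coeff q (Suc (degree p)) = lead_coeff p / real (Suc (degree p))
    \<and> (\<forall>x. poly q (x + 1) - poly q x = poly p x)"
proof (induction "degree p" arbitrary: p rule: less_induct)
  case less
  define k where "k = degree p"
  define c where "c = lead_coeff p / real (Suc k)"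
  define s where "s = smult c (pcompose (monom 1 (Suc k)) [:1, 1:] - monom 1 (Suc k))"
  have cs: "coeff ([:1, 1:] ^ Suc k :: real poly) j = of_nat (Suc k choose j)" if "j \<le> Suc k" for j
    using that by (simp add: coeff_linear_poly_power del: power_Suc)
  have pc: "pcompose (monom 1 (Suc k)) [:1, 1:] = ([:1, 1:] ^ Suc k :: real poly)"
    by (rule poly_eqI_pointwise) (simp add: poly_pcompose poly_monom poly_power add.commute del: power_Suc)
  have ds: "degree s \<le> k"
  proof (rule degree_le, intro allI impI)
    fix i assume "k < i"
    then consider "i = Suc k" | "i > Suc k" by linarith
    then show "coeff s i = 0"
    proof cases
      case 1
      then show ?thesis unfolding s_def pc by (simp add: cs del: power_Suc)
    next
      case 2
      have "degree ([:1, 1:] ^ Suc k :: real poly) \<le> Suc k"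
        using degree_power_le[of "[:1, 1::real:]" "Suc k"] by simp
      then show ?thesis using 2 unfolding s_def pc by (simp add: coeff_eq_0 del: power_Suc)
    qed
  qed
  have sk: "coeff s k = lead_coeff p"
    unfolding s_def pc c_def by (simp add: cs del: power_Suc)
  define r where "r = p - s"
  have "r = 0 \<or> degree r < k"
  proof -
    have "degree r \<le> k" unfolding r_def using ds by (intro degree_diff_le) (auto simp: k_def)
    moreover have "coeff r k = 0" using sk by (simp add: r_def k_def[symmetric])
    ultimately show ?thesis by (metis le_neq_implies_less leading_coeff_0_iff)
  qed
  then obtain q where q: "degree q \<le> k" "\<And>x. poly q (x + 1) - poly q x = poly r x"
  proof
    assume "r = 0"
    then show ?thesis using that[of 0] by simp
  next
    assume "degree r < k"
    then show ?thesis using less[of r] that k_def by (metis Suc_leI order_trans)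
  qed
  have "degree (monom c (Suc k) + q) \<le> Suc k"
    using q(1) by (intro degree_add_le) (auto simp: degree_monom_le)
  moreover have "coeff (monom c (Suc k) + q) (Suc k) = lead_coeff p / real (Suc k)"
    using q(1) by (simp add: coeff_eq_0 c_def)
  moreover have "poly (monom c (Suc k) + q) (x + 1) - poly (monom c (Suc k) + q) x = poly p x" for x
  proof -
    have "poly p x = poly r x + poly s x" by (simp add: r_def)
    moreover have "poly s x = c * ((x + 1) ^ Suc k - x ^ Suc k)"
      by (simp add: s_def poly_pcompose poly_monom add.commute del: power_Suc)
    ultimately show ?thesis using q(2)[of x] by (simp add: poly_monom algebra_simps)
  qed
  ultimately show ?case unfolding k_def by blast
qed

lemma antidifference_degree:
  fixes p :: "real poly"
  assumes "degree p \<le> k"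
  obtains q where "degree q \<le> Suc k" and "coeff q (Suc k) = coeff p k / real (Suc k)"
    and "\<And>x. poly q (x + 1) - poly q x = poly p x"
proof -
  obtain q where q: "degree q \<le> Suc (degree p)" "coeff q (Suc (degree p)) = lead_coeff p / real (Suc (degree p))"
    "\<And>x. poly q (x + 1) - poly q x = poly p x" using antidifference[of p] by blast
  have "degree q \<le> Suc k" using q(1) assms by simp
  moreover have "coeff q (Suc k) = coeff p k / real (Suc k)"
    using q(1,2) assms by (cases "degree p = k") (auto simp: coeff_eq_0)
  ultimately show ?thesis using that q(3) by blast
qed

lemma sum_telescope_int:
  fixes a b :: int and f :: "int \<Rightarrow> real"
  assumes "a \<le> b"
  shows "(\<Sum>x\<in>{a..<b}. f (x + 1) - f x) = f b - f a"
  using assms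
proof (induction rule: int_ge_induct)
  case (step b)
  have "{a..<b + 1} = insert b {a..<b}" using step.hyps by auto
  then show ?case using step by simp
qed simp

text \<open>The right-hand side, which does not depend on \<open>x\<close>, is the integral of the spline.\<close>

lemma spline_sum:
  fixes c :: "'a \<Rightarrow> real" and u :: "'a \<Rightarrow> int"
  assumes fin: "finite I" and r: "\<And>z::int. z > B \<Longrightarrow> (\<Sum>i\<in>I. c i * (of_int z - of_int (u i)) ^ r) = 0"
    and bd: "\<And>i. i \<in> I \<Longrightarrow> c i \<noteq> 0 \<Longrightarrow> - B \<le> u i \<and> u i \<le> B"
  shows "(\<Sum>z\<in>{-B..B}. \<Sum>i\<in>I. c i * (of_bool (z > u i) * (of_int z - of_int (u i)) ^ r))
     = (\<Sum>i\<in>I. c i * (x - of_int (u i)) ^ Suc r / real (Suc r))"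
proof -
  define w :: "real poly" where "w = (\<Sum>i\<in>I. smult (c i) ([:- of_int (u i), 1:] ^ r))"
  \<comment> \<open>Beyond the last knot all truncations are inactive, so the polynomial piece
    \<open>w\<close> has infinitely many zeros.\<close>
  have "w = 0"
  proof (rule ccontr)
    assume "w \<noteq> 0"
    then have "finite {x. poly w x = 0}" by (rule poly_roots_finite)
    moreover have "real_of_int ` {B<..} \<subseteq> {x. poly w x = 0}"
      using r by (auto simp: w_def poly_sum algebra_simps)
    ultimately have "finite (real_of_int ` {B<..})" using finite_subset by blast
    then have "finite {B<..}" by (rule finite_imageD) (auto simp: inj_on_def)
    then show False using infinite_Ioi by blast
  qed
  \<comment> \<open>The coefficients of \<open>w\<close> are nonzero multiples of the power sums of
    the knots weighted by \<open>c\<close>.\<close>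
  have m0: "(\<Sum>i\<in>I. c i * of_int (u i) ^ j) = 0" if j: "j \<le> r" for j
  proof -
    have "0 = coeff w (r - j)" using \<open>w = 0\<close> by simp
    also have "\<dots> = (\<Sum>i\<in>I. of_nat (r choose (r - j)) * ((-1) ^ j * (c i * of_int (u i) ^ j)))"
      using j unfolding w_def coeff_sum
      by (intro sum.cong refl) (simp add: coeff_linear_poly_power power_minus[of "of_int _"] algebra_simps)
    also have "\<dots> = of_nat (r choose (r - j)) * (-1) ^ j * (\<Sum>i\<in>I. c i * of_int (u i) ^ j)"
      by (simp add: sum_distrib_left mult.assoc)
    finally show ?thesis using j by auto
  qed
  have p0: "(\<Sum>i\<in>I. c i * poly p (of_int (u i))) = 0" if "degree p \<le> r" for p
  proof -
    have "(\<Sum>i\<in>I. c i * poly p (of_int (u i))) = (\<Sum>i\<in>I. \<Sum>j\<le>degree p. coeff p j * (c i * of_int (u i) ^ j))"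
      by (simp add: poly_altdef sum_distrib_left algebra_simps)
    also have "\<dots> = (\<Sum>j\<le>degree p. coeff p j * (\<Sum>i\<in>I. c i * of_int (u i) ^ j))"
      by (subst sum.swap) (simp add: sum_distrib_left)
    also have "\<dots> = 0" using m0 that by simp
    finally show ?thesis .
  qed
  obtain q where q: "degree q \<le> Suc r" "coeff q (Suc r) = 1 / real (Suc r)"
    "\<And>x. poly q (x + 1) - poly q x = poly (monom 1 r) x"
    using antidifference_degree[of "monom 1 r" r] by (auto simp: degree_monom_eq)
  have inner: "(\<Sum>z\<in>{-B..B}. of_bool (z > v) * (of_int z - of_int v) ^ r) = poly q (of_int (B + 1 - v)) - poly q 1"
    if "- B \<le> v" "v \<le> B" for v
  proof -
    have "(\<Sum>z\<in>{-B..B}. of_bool (z > v) * (of_int z - of_int v) ^ r)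
        = (\<Sum>z\<in>{v+1..<B+1}. (of_int z - of_int v :: real) ^ r)"
      using that by (intro sum.mono_neutral_cong_right) auto
    also have "\<dots> = (\<Sum>z\<in>{v+1..<B+1}. poly q (of_int ((z + 1) - v)) - poly q (of_int (z - v)))"
      using q(3) by (intro sum.cong refl) (simp add: poly_monom algebra_simps, metis add.commute add_diff_eq)
    also have "\<dots> = poly q (of_int (B + 1 - v)) - poly q (of_int (v + 1 - v))"
      using sum_telescope_int[of "v + 1" "B + 1" "\<lambda>z. poly q (of_int (z - v))"] that by simp
    finally show ?thesis by simp
  qed
  \<comment> \<open>As polynomials in the knot, \<open>poly q (B + 1 - v) - poly q 1\<close> and
    \<open>(x - v) ^ Suc r / Suc r\<close> have the same leading term. Their difference
    \<open>g\<close> has degree at most \<open>r\<close> and is annihilated by \<open>p0\<close>, so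
    the sum may be replaced by the integral.\<close>
  define g where "g = pcompose q [:of_int (B + 1), -1:] - [:poly q 1:] - smult (1 / real (Suc r)) ([:x, -1:] ^ Suc r)"
  have "degree g \<le> r"
  proof -
    have "degree g \<le> Suc r"
      unfolding g_def using q(1) degree_power_le[of "[:x, -1:]" "Suc r"]
      by (intro degree_diff_le) (auto simp: degree_pcompose simp del: power_Suc)
    moreover have "coeff g (Suc r) = 0"
    proof -
      have 1: "coeff (pcompose q [:of_int (B + 1), -1:]) (Suc r) = (-1) ^ Suc r / real (Suc r)"
      proof -
        have "coeff q (Suc r) \<noteq> 0" using q(2) by simp
        then have dq: "degree q = Suc r" using q(1) le_degree le_antisym by blast
        have "lead_coeff (pcompose q [:of_int (B + 1), -1:]) = lead_coeff q * (-1) ^ degree q"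
          by (subst lead_coeff_comp) auto
        moreover have "degree (pcompose q [:of_int (B + 1), -1:]) = Suc r"
          by (simp add: degree_pcompose dq)
        ultimately have "coeff (pcompose q [:of_int (B + 1), -1:]) (Suc r) = coeff q (Suc r) * (-1) ^ Suc r"
          by (simp only: dq)
        then show ?thesis by (simp only: q(2)) (simp del: power_Suc)
      qed
      have 2: "coeff ([:x, -1:] ^ Suc r) (Suc r) = (-1) ^ Suc r"
        using lead_coeff_power[of "[:x, -1:]" "Suc r"] by (simp add: degree_power_eq del: power_Suc)
      show ?thesis unfolding g_def by (simp only: coeff_diff coeff_smult 1 2) (simp del: power_Suc)
    qed
    ultimately show ?thesis
      by (metis degree_0 le_SucE leading_coeff_0_iff le0)
  qed
  have "(\<Sum>z\<in>{-B..B}. \<Sum>i\<in>I. c i * (of_bool (z > u i) * (of_int z - of_int (u i)) ^ r))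
     = (\<Sum>i\<in>I. c i * (\<Sum>z\<in>{-B..B}. of_bool (z > u i) * (of_int z - of_int (u i)) ^ r))"
    by (subst sum.swap) (simp only: sum_distrib_left)
  also have "\<dots> = (\<Sum>i\<in>I. c i * (poly g (of_int (u i)) + (x - of_int (u i)) ^ Suc r / real (Suc r)))"
  proof (intro sum.cong refl)
    fix i assume "i \<in> I"
    show "c i * (\<Sum>z\<in>{-B..B}. of_bool (z > u i) * (of_int z - of_int (u i)) ^ r)
        = c i * (poly g (of_int (u i)) + (x - of_int (u i)) ^ Suc r / real (Suc r))"
    proof (cases "c i = 0")
      case False
      then have "- B \<le> u i" "u i \<le> B" using bd \<open>i \<in> I\<close> by auto
      then show ?thesis
        by (subst inner) (auto simp: g_def poly_pcompose poly_power algebra_simps simp del: power_Suc)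
    qed simp
  qed
  also have "\<dots> = (\<Sum>i\<in>I. c i * (x - of_int (u i)) ^ Suc r / real (Suc r))"
    using p0[OF \<open>degree g \<le> r\<close>] by (simp add: distrib_left sum.distrib del: power_Suc)
  finally show ?thesis .
qed

section \<open>Lattice points in a half-open simplex\<close>

definition vandermonde :: "int set \<Rightarrow> real" where
  "vandermonde K = (\<Prod>i\<in>K. \<Prod>l\<in>{l \<in> K. l < i}. of_int i - of_int l)"

lemma vandermonde_insert:
  assumes fin: "finite K" and j: "j \<notin> K"
  shows "vandermonde (insert j K) = vandermonde K * \<bar>\<Prod>l\<in>K. of_int j - of_int l\<bar>"
proof -
  have "(\<Prod>l\<in>{l \<in> insert j K. l < i}. real_of_int i - of_int l)
      = (if j < i then of_int i - of_int j else 1) * (\<Prod>l\<in>{l \<in> K. l < i}. of_int i - of_int l)" for i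
  proof (cases "j < i")
    case True
    then have "{l \<in> insert j K. l < i} = insert j {l \<in> K. l < i}" by auto
    then show ?thesis using True fin j by simp
  next
    case False
    then have "{l \<in> insert j K. l < i} = {l \<in> K. l < i}" by auto
    then show ?thesis using False by simp
  qed
  then have "vandermonde (insert j K) = (\<Prod>l\<in>{l \<in> K. l < j}. of_int j - of_int l)
      * ((\<Prod>i\<in>K. if j < i then of_int i - of_int j else 1) * vandermonde K)"
    using fin j by (simp add: vandermonde_def prod.distrib)
  moreover have "(\<Prod>l\<in>{l \<in> K. l < j}. real_of_int j - of_int l) = (\<Prod>l\<in>K. if l < j then of_int j - of_int l else 1)"
    using fin by (simp add: prod.inter_filter)
  moreover have "(\<Prod>l\<in>K. if l < j then of_int j - of_int l else 1) * (\<Prod>i\<in>K. if j < i then real_of_int i - of_int j else 1)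
      = \<bar>\<Prod>l\<in>K. real_of_int j - of_int l\<bar>"
    unfolding abs_prod prod.distrib[symmetric] using j by (intro prod.cong) auto
  ultimately show ?thesis by (simp add: mult.commute mult.left_commute)
qed

lemma vandermonde_pos: "finite K \<Longrightarrow> vandermonde K > 0"
  unfolding vandermonde_def by (intro prod_pos) auto

text \<open>For \<open>F\<close> inside a finite \<open>K\<close> this is, up to sign,
  \<open>vandermonde (K - F) / vandermonde K\<close>. The cross factors keep their signs, which
  makes \<open>face_weight_insert\<close> hold with the orientation sign of a facet.\<close>

definition face_weight :: "int set \<Rightarrow> int set \<Rightarrow> real" where
  "face_weight K F = 1 / (vandermonde F * (\<Prod>i\<in>K - F. \<Prod>l\<in>F. of_int i - of_int l))"

text \<open>As \<open>j\<close> runs through \<open>K - F\<close>, the right-hand side is a constant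
  times the weight 1 / \<open>node_deriv\<close> of a divided difference. This is what collapses the
  sum over \<open>j\<close> in \<open>facet_expansion\<close>.\<close>

lemma face_weight_insert:
  assumes fin: "finite K" and F: "F \<subseteq> K" and j: "j \<in> K - F"
  shows "sgn (node_deriv (insert j F) j) * face_weight K (insert j F)
    = face_weight K F * (-1) ^ (card (K - F) - 1) / node_deriv (K - F) j"
proof -
  define D where "D = (\<Prod>l\<in>F. real_of_int j - of_int l)"
  define R where "R = (\<Prod>i\<in>K - F - {j}. \<Prod>l\<in>F. real_of_int i - of_int l)"
  have finF: "finite F" using fin F finite_subset by blast
  have D0: "D \<noteq> 0" using j finF by (auto simp: D_def)
  have "insert j F - {j} = F" using j by auto
  then have nd: "node_deriv (insert j F) j = D" by (simp add: node_deriv_def D_def)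
  have v: "vandermonde (insert j F) = vandermonde F * \<bar>D\<bar>"
    using vandermonde_insert[OF finF, of j] j by (simp add: D_def)
  have KF: "K - insert j F = K - F - {j}" by auto
  have "(\<Prod>i\<in>K - F - {j}. \<Prod>l\<in>insert j F. real_of_int i - of_int l)
      = (\<Prod>i\<in>K - F - {j}. (real_of_int i - of_int j) * (\<Prod>l\<in>F. of_int i - of_int l))"
    using finF j by simp
  also have "\<dots> = (\<Prod>i\<in>K - F - {j}. (-1) * (real_of_int j - of_int i)) * R"
    by (simp add: prod.distrib R_def)
  also have "(\<Prod>i\<in>K - F - {j}. (-1) * (real_of_int j - of_int i)) = (-1) ^ (card (K - F) - 1) * node_deriv (K - F) j"
    unfolding prod.distrib node_deriv_def using j fin by simp
  finally have p1: "(\<Prod>i\<in>K - insert j F. \<Prod>l\<in>insert j F. real_of_int i - of_int l)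
      = (-1) ^ (card (K - F) - 1) * node_deriv (K - F) j * R" by (simp add: KF)
  have p2: "(\<Prod>i\<in>K - F. \<Prod>l\<in>F. real_of_int i - of_int l) = D * R"
    using j fin by (subst prod.remove[of _ j]) (auto simp: D_def R_def)
  have sg: "sgn D * (1 / \<bar>D\<bar>) = 1 / D" using D0 by (simp add: sgn_if)
  have m1: "1 / ((-1 :: real) ^ k) = (-1) ^ k" for k by (cases "even k") auto
  have "sgn (node_deriv (insert j F) j) * face_weight K (insert j F)
     = (sgn D * (1 / \<bar>D\<bar>)) * (1 / (vandermonde F * R)) * (1 / (-1) ^ (card (K - F) - 1)) / node_deriv (K - F) j"
    unfolding face_weight_def nd v p1 by simp
  also have "\<dots> = face_weight K F * (-1) ^ (card (K - F) - 1) / node_deriv (K - F) j"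
    unfolding sg m1 face_weight_def p2 by simp
  finally show ?thesis .
qed

lemma divided_difference_linear_power:
  assumes "finite S" and "card S = Suc r"
  shows "(\<Sum>j\<in>S. (a - of_int j * b) ^ r / node_deriv S j) = (- b) ^ r"
proof -
  have "degree ([:a, - b:] ^ r) \<le> r"
    using degree_power_le[of "[:a, - b:]" r] degree_pCons_le[of a "[:- b:]"]
    by (metis degree_pCons_0 le_trans mult.commute mult_le_mono2 nat_mult_1_right One_nat_def)
  then have "(\<Sum>j\<in>S. poly ([:a, - b:] ^ r) (of_int j) / node_deriv S j) = coeff ([:a, - b:] ^ r) r"
    using divided_difference[OF assms(1), of "[:a, - b:] ^ r"] assms(2) by simp
  moreover have "coeff ([:a, - b:] ^ r) r = (- b) ^ r"
    by (simp add: coeff_linear_poly_power)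
  ultimately show ?thesis by (simp add: poly_power)
qed

text \<open>Expand every \<open>half_open F y\<close> over its facets and collect the terms of each
  facet. For a fixed facet the power attached to the extra node \<open>j\<close> has the form (a - j
  b)^r, and \<open>j\<close> ranges over r + 1 nodes, so a divided difference of order r leaves only
  b^r.\<close>

lemma facet_expansion:
  assumes fin: "finite K" and card: "card K = c + r + 1" and c: "c \<ge> 1" and int: "\<And>j. y j \<in> \<int>"
  shows "(\<Sum>F\<in>{F. F \<subseteq> K \<and> card F = Suc c}.
        face_weight K F * of_bool (half_open F y) * mom y (node_poly F) ^ r)
    = (\<Sum>F\<in>{F. F \<subseteq> K \<and> card F = c}.
        face_weight K F * of_bool (half_open F y) *
          (of_bool (mom y (node_poly F) > 0) * mom y (node_poly F) ^ r))"
proof -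
  define h where "h F j = sgn (node_deriv (insert j F) j) * face_weight K (insert j F) *
    of_bool (half_open F y \<and> mom y (node_poly F) > 0) * mom y (node_poly (insert j F)) ^ r" for F j
  have finF: "finite F" if "F \<subseteq> K" for F using that fin finite_subset by blast
  have finP: "finite {F. F \<subseteq> K \<and> card F = k}" for k using fin by simp
  have "(\<Sum>F\<in>{F. F \<subseteq> K \<and> card F = Suc c}.
        face_weight K F * of_bool (half_open F y) * mom y (node_poly F) ^ r)
     = (\<Sum>F\<in>{F. F \<subseteq> K \<and> card F = Suc c}. \<Sum>j\<in>F. h (F - {j}) j)"
  proof (intro sum.cong refl)
    fix F assume F: "F \<in> {F. F \<subseteq> K \<and> card F = Suc c}"
    have "of_bool (half_open F y) = (\<Sum>j\<in>F. sgn (node_deriv F j) *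
      of_bool (half_open (F - {j}) y \<and> mom y (node_poly (F - {j})) > 0))"
      using F c finF int by (intro half_open_fibre) auto
    then show "face_weight K F * of_bool (half_open F y) * mom y (node_poly F) ^ r = (\<Sum>j\<in>F. h (F - {j}) j)"
      by (simp add: h_def sum_distrib_left sum_distrib_right insert_absorb mult.assoc mult.left_commute del: of_bool_conj)
  qed
  also have "\<dots> = (\<Sum>(F, j)\<in>Sigma {F. F \<subseteq> K \<and> card F = Suc c} (\<lambda>F. F). h (F - {j}) j)"
    using finP finF by (intro sum.Sigma) auto
  also have "\<dots> = (\<Sum>(F, j)\<in>Sigma {F. F \<subseteq> K \<and> card F = c} (\<lambda>F. K - F). h F j)"
    by (rule sum.reindex_bij_witness[of _ "\<lambda>(F, j). (insert j F, j)" "\<lambda>(F, j). (F - {j}, j)"])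
      (auto simp: insert_absorb finF card_insert_disjoint)
  also have "\<dots> = (\<Sum>F\<in>{F. F \<subseteq> K \<and> card F = c}. \<Sum>j\<in>K - F. h F j)"
    using finP fin by (intro sum.Sigma[symmetric]) auto
  also have "\<dots> = (\<Sum>F\<in>{F. F \<subseteq> K \<and> card F = c}.
        face_weight K F * of_bool (half_open F y) *
          (of_bool (mom y (node_poly F) > 0) * mom y (node_poly F) ^ r))"
  proof (intro sum.cong refl)
    fix F assume "F \<in> {F. F \<subseteq> K \<and> card F = c}"
    then have F: "F \<subseteq> K" "card F = c" "finite F" using finF by auto
    define a where "a = mom y (pCons 0 (node_poly F))"
    define b where "b = mom y (node_poly F)"
    have S: "finite (K - F)" "card (K - F) = Suc r" using F fin card by (auto simp: card_Diff_subset)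
    have ab: "mom y (node_poly (insert j F)) = a - of_int j * b" if "j \<in> K - F" for j
    proof -
      have "node_poly (insert j F) = smult (- of_int j) (node_poly F) + pCons 0 (node_poly F)"
        using that F by (simp add: node_poly_insert)
      then show ?thesis by (simp only: mom_add mom_smult a_def b_def)
    qed
    have "(\<Sum>j\<in>K - F. h F j) = (\<Sum>j\<in>K - F. face_weight K F * (-1) ^ r * of_bool (half_open F y \<and> b > 0)
        * ((a - of_int j * b) ^ r / node_deriv (K - F) j))"
    proof (intro sum.cong refl)
      fix j assume j: "j \<in> K - F"
      show "h F j = face_weight K F * (-1) ^ r * of_bool (half_open F y \<and> b > 0)
        * ((a - of_int j * b) ^ r / node_deriv (K - F) j)"
        unfolding h_def face_weight_insert[OF fin F(1) j] ab[OF j] S(2) by (simp add: b_def)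
    qed
    also have "\<dots> = face_weight K F * (-1) ^ r * of_bool (half_open F y \<and> b > 0) * (- b) ^ r"
      by (simp only: sum_distrib_left[symmetric] divided_difference_linear_power[OF S])
    also have "\<dots> = face_weight K F * of_bool (half_open F y) * (of_bool (b > 0) * b ^ r)"
    proof -
      have *: "(-1) ^ r * (- b) ^ r = b ^ r" by (simp flip: power_mult_distrib)
      then show ?thesis by (simp only: of_bool_conj *[symmetric] mult.assoc mult.left_commute)
    qed
    finally show "(\<Sum>j\<in>K - F. h F j) = face_weight K F * of_bool (half_open F y) *
          (of_bool (mom y (node_poly F) > 0) * mom y (node_poly F) ^ r)"
      by (simp add: b_def)
  qed
  finally show ?thesis .
qed

text \<open>The last \<open>r\<close> coordinates \<open>d - r + 1, \<dots>, d\<close> of \<open>y\<close> are overwritten and summed out.\<close>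

fun box_count :: "int set \<Rightarrow> nat \<Rightarrow> int \<Rightarrow> nat \<Rightarrow> (nat \<Rightarrow> real) \<Rightarrow> real" where
  "box_count K d B 0 y = of_bool (half_open K y)"
| "box_count K d B (Suc r) y = (\<Sum>z\<in>{-B..B}. box_count K d B r (y(d - r := of_int z)))"

text \<open>Coordinates up to \<open>d - r\<close> are not overwritten any more, so a violated
  moment bound survives to the innermost indicator.\<close>

lemma box_count_eq_0:
  assumes "finite K" and "card K = Suc d" and M: "\<And>i. i \<in> K \<Longrightarrow> \<bar>of_int i\<bar> \<le> (M::real)"
    and "r \<le> d" and "j \<le> d - r" and "\<bar>y j\<bar> > y 0 * M ^ j"
  shows "box_count K d B r y = 0"
  using assms(4-6)
proof (induction r arbitrary: y)
  case 0
  then show ?case using half_open_bound[OF assms(1) _ _ M, of y j] assms(2) by force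
next
  case (Suc r)
  have "box_count K d B r (y(d - r := of_int z)) = 0" for z
    using Suc.prems by (intro Suc.IH) auto
  then show ?case by simp
qed

text \<open>The right-hand side does not depend on coordinate \<open>d - r + 1\<close> of \<open>y\<close>, although \<open>mom y (node_poly F)\<close> does.\<close>

lemma box_count_formula:
  assumes fin: "finite K" and card: "card K = Suc d" and M: "\<And>i. i \<in> K \<Longrightarrow> \<bar>of_int i\<bar> \<le> (M::real)" "M \<ge> 1"
    and B: "of_int B \<ge> y 0 * M ^ d" and int: "\<And>j. y j \<in> \<int>" and y0: "y 0 \<ge> 0" and "r \<le> d"
  shows "box_count K d B r y = vandermonde K * (\<Sum>F\<in>{F. F \<subseteq> K \<and> card F = Suc d - r}.
      face_weight K F * of_bool (half_open F y) * mom y (node_poly F) ^ r) / fact r"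
  using \<open>r \<le> d\<close> B int y0
proof (induction r arbitrary: y)
  case 0
  have "F = K" if "F \<subseteq> K" "card F = Suc d" for F
    using card_subset_eq[OF fin that(1)] that(2) card by simp
  then have "{F. F \<subseteq> K \<and> card F = Suc d} = {K}"
    using card by auto
  then show ?case using fin vandermonde_pos[OF fin] by (simp add: face_weight_def)
next
  case (Suc r)
  define c where "c = d - r"
  have c: "c \<ge> 1" "Suc d - Suc r = c" "Suc d - r = Suc c" "card K = c + r + 1"
    using Suc.prems(1) card by (auto simp: c_def)
  define I where "I = {F. F \<subseteq> K \<and> card F = c}"
  have finI: "finite I" using fin by (simp add: I_def)
  have IF: "finite F" "card F = c" "F \<subseteq> K" "F \<noteq> {}" if "F \<in> I" for F
    using that fin c(1) by (auto simp: I_def intro: finite_subset)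
  \<comment> \<open>\<open>u F\<close> is the value of coordinate \<open>c\<close> at which the
    point meets the hyperplane through \<open>F\<close>. It is an integer, so the floor only changes
    the type.\<close>
  define u where "u F = \<lfloor>y c - mom y (node_poly F)\<rfloor>" for F
  have u: "of_int (u F) = y c - mom y (node_poly F)" if "F \<in> I" for F
    unfolding u_def using IF(1)[OF that] Suc.prems(3) mom_node_poly_Ints
    by (intro of_int_floor) (auto intro!: Ints_diff simp: )
  define w where "w F = face_weight K F * of_bool (half_open F y)" for F
  have Mc: "y 0 * M ^ c \<le> of_int B"
  proof -
    have "M ^ c \<le> M ^ d" using M(2) by (intro power_increasing) (auto simp: c_def)
    then show ?thesis using Suc.prems(2,4) mult_left_mono by fastforce
  qed
  have ub: "- B \<le> u F \<and> u F \<le> B" if "F \<in> I" "w F \<noteq> 0" for F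
  proof -
    have "half_open F y" using that(2) by (auto simp: w_def)
    then have "\<bar>y (card F) - mom y (node_poly F)\<bar> \<le> y 0 * M ^ card F"
      using IF[OF that(1)] M by (intro half_open_next_moment_bound) auto
    then have "\<bar>real_of_int (u F)\<bar> \<le> of_int B" using u[OF that(1)] IF[OF that(1)] Mc by simp
    then show ?thesis by linarith
  qed
  have layer: "box_count K d B r (y(c := of_int z)) = vandermonde K / fact r *
      (\<Sum>F\<in>I. w F * (of_bool (z > u F) * (of_int z - of_int (u F)) ^ r))" for z
  proof -
    define y' where "y' = y(c := of_int z)"
    have int': "\<And>j. y' j \<in> \<int>" using Suc.prems(3) by (auto simp: y'_def)
    have "box_count K d B r y' = vandermonde K * (\<Sum>F\<in>{F. F \<subseteq> K \<and> card F = Suc c}.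
      face_weight K F * of_bool (half_open F y') * mom y' (node_poly F) ^ r) / fact r"
      unfolding c(3)[symmetric] using Suc.prems c(1) int' by (intro Suc.IH) (auto simp: y'_def)
    also have "\<dots> = vandermonde K / fact r * (\<Sum>F\<in>I. face_weight K F * of_bool (half_open F y') *
          (of_bool (mom y' (node_poly F) > 0) * mom y' (node_poly F) ^ r))"
      unfolding I_def by (subst facet_expansion[OF fin c(4,1) int']) simp
    also have "\<dots> = vandermonde K / fact r *
        (\<Sum>F\<in>I. w F * (of_bool (z > u F) * (of_int z - of_int (u F)) ^ r))"
    proof (rule arg_cong2[of _ _ _ _ "(*)", OF refl], intro sum.cong refl)
      fix F assume F: "F \<in> I"
      have 1: "half_open F y' = half_open F y"
        using IF[OF F] by (intro half_open_cong) (auto simp: y'_def)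
      have 2: "mom y' (node_poly F) = of_int z - of_int (u F)"
        using mom_upd_top[OF IF(1,2)[OF F], of y "of_int z"] u[OF F] by (simp add: y'_def)
      have 3: "(of_int z - of_int (u F) > (0::real)) = (z > u F)" by simp
      show "face_weight K F * of_bool (half_open F y') *
          (of_bool (mom y' (node_poly F) > 0) * mom y' (node_poly F) ^ r)
        = w F * (of_bool (z > u F) * (of_int z - of_int (u F)) ^ r)"
        by (simp only: w_def 1 2 3)
    qed
    finally show ?thesis by (simp add: y'_def)
  qed
  \<comment> \<open>Beyond \<open>B\<close> the layer is empty while all truncated powers are
    active; this is the vanishing that \<open>spline_sum\<close> asks for.\<close>
  have far: "(\<Sum>F\<in>I. w F * (of_int z - of_int (u F)) ^ r) = 0" if z: "z > B" for z
  proof -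
    have zB: "\<bar>real_of_int z\<bar> > y 0 * M ^ c" using z Mc by linarith
    have "box_count K d B r (y(c := of_int z)) = 0"
      using Suc.prems(1) zB c(1) by (intro box_count_eq_0[OF fin card M(1), where j = c]) (auto simp: c_def)
    then have "(\<Sum>F\<in>I. w F * (of_bool (z > u F) * (of_int z - of_int (u F)) ^ r)) = 0"
      unfolding layer using vandermonde_pos[OF fin] by simp
    also have "(\<Sum>F\<in>I. w F * (of_bool (z > u F) * (of_int z - of_int (u F)) ^ r))
        = (\<Sum>F\<in>I. w F * (of_int z - of_int (u F)) ^ r)"
      using ub z by (intro sum.cong) force+
    finally show ?thesis .
  qed
  have "box_count K d B (Suc r) y = vandermonde K / fact r *
      (\<Sum>z\<in>{-B..B}. \<Sum>F\<in>I. w F * (of_bool (z > u F) * (of_int z - of_int (u F)) ^ r))"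
    using layer by (simp add: c_def sum_distrib_left)
  \<comment> \<open>The integral is independent of the auxiliary point. Choosing \<open>y c\<close>
    makes its distance to the knot \<open>u F\<close> equal to
    \<open>mom y (node_poly F)\<close>.\<close>
  also have "\<dots> = vandermonde K / fact r * (\<Sum>F\<in>I. w F * (y c - of_int (u F)) ^ Suc r / real (Suc r))"
    by (subst spline_sum[OF finI, of B w u r "y c"]) (use far ub in auto)
  also have "\<dots> = vandermonde K / fact r * (\<Sum>F\<in>I. w F * mom y (node_poly F) ^ Suc r / real (Suc r))"
    using u by simp
  also have "\<dots> = vandermonde K * (\<Sum>F\<in>I. w F * mom y (node_poly F) ^ Suc r) / fact (Suc r)"
    by (simp add: sum_divide_distrib[symmetric] del: power_Suc of_nat_Suc) 
  finally show ?case unfolding c(2) I_def w_def .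
qed

text \<open>For \<open>r = d\<close> the faces are single nodes, all of them half-open because the
  mass \<open>y 0\<close> is positive, and one more divided difference evaluates the sum.\<close>

lemma box_count_full:
  assumes fin: "finite K" and card: "card K = Suc d" and M: "\<And>i. i \<in> K \<Longrightarrow> \<bar>of_int i\<bar> \<le> (M::real)" "M \<ge> 1"
    and B: "of_int B \<ge> y 0 * M ^ d" and int: "\<And>j. y j \<in> \<int>" and y0: "y 0 > 0"
  shows "box_count K d B d y = vandermonde K * y 0 ^ d / fact d"
proof -
  have "(\<Sum>F\<in>{F. F \<subseteq> K \<and> card F = Suc d - d}. face_weight K F * of_bool (half_open F y) * mom y (node_poly F) ^ d)
     = (\<Sum>i\<in>K. face_weight K {i} * of_bool (half_open {i} y) * mom y (node_poly {i}) ^ d)"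
  proof -
    have "{F. F \<subseteq> K \<and> card F = Suc d - d} = (\<lambda>i. {i}) ` K"
      by (auto simp: card_1_singleton_iff)
    then show ?thesis by (simp add: sum.reindex)
  qed
  also have "\<dots> = (\<Sum>i\<in>K. (-1) ^ d * ((y 1 - of_int i * y 0) ^ d / node_deriv K i))"
  proof (intro sum.cong refl)
    fix i assume i: "i \<in> K"
    have np0: "node_poly {} = 1" by (simp add: node_poly_def)
    have emp: "{j \<in> {i}. j > i} = {}" by auto
    have ho: "half_open {i} y \<longleftrightarrow>
        (mom y (node_poly ({i} - {i})) > 0 \<longleftrightarrow> even (card {j \<in> {i}. j > i}))"
      unfolding half_open_def by blast
    have 1: "half_open {i} y" unfolding ho emp using y0 np0 by (simp add: mom_def)
    have 2: "mom y (node_poly {i}) = y 1 - of_int i * y 0"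
      by (simp add: node_poly_def mom_pCons mom_0 algebra_simps)
    have "(\<Prod>l\<in>K - {i}. real_of_int l - of_int i) = (\<Prod>l\<in>K - {i}. (-1) * (of_int i - of_int l))"
      by (intro prod.cong) auto
    also have "\<dots> = (-1) ^ d * node_deriv K i"
      unfolding prod.distrib node_deriv_def using i fin card by simp
    finally have *: "(\<Prod>l\<in>K - {i}. real_of_int l - of_int i) = (-1) ^ d * node_deriv K i" .
    have "vandermonde {i} = 1" using vandermonde_insert[of "{}" i] by (simp add: vandermonde_def)
    with * have 3: "face_weight K {i} = (-1) ^ d / node_deriv K i"
      by (cases "even d") (simp_all add: face_weight_def)
    show "face_weight K {i} * of_bool (half_open {i} y) * mom y (node_poly {i}) ^ d
        = (-1) ^ d * ((y 1 - of_int i * y 0) ^ d / node_deriv K i)"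
      unfolding 2 3 using 1 by simp
  qed
  also have "\<dots> = (-1) ^ d * (- y 0) ^ d"
    by (simp only: sum_distrib_left[symmetric] divided_difference_linear_power[OF fin card])
  also have "\<dots> = y 0 ^ d" by (simp flip: power_mult_distrib)
  finally have *: "(\<Sum>F\<in>{F. F \<subseteq> K \<and> card F = Suc d - d}.
      face_weight K F * of_bool (half_open F y) * mom y (node_poly F) ^ d) = y 0 ^ d" .
  show ?thesis unfolding *[symmetric] by (rule box_count_formula[where M = M]) (use assms in auto)
qed

section \<open>Lower facets\<close>

lemma node_deriv_pos_iff:
  assumes "finite R"
  shows "node_deriv R i > 0 \<longleftrightarrow> even (card {j \<in> R. j > i})"
    and "node_deriv R i < 0 \<longleftrightarrow> odd (card {j \<in> R. j > i})"
  using sgn_node_deriv[OF assms, of i] node_deriv_nz[OF assms, of i]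
  by (cases "even (card {j \<in> R. j > i})"; auto simp: sgn_if split: if_splits)+

text \<open>With \<open>c\<close> nodes these are the lower facets of the cyclic polytope of dimension \<open>c\<close>; their projections
  triangulate the one of dimension \<open>c - 1\<close>.\<close>

definition low :: "int set \<Rightarrow> nat \<Rightarrow> int set set" where
  "low T c = {K. K \<subseteq> T \<and> card K = c \<and> (\<forall>t\<in>T. poly (node_poly K) (of_int t) \<ge> 0)}"

lemma finite_low: "finite T \<Longrightarrow> finite (low T c)"
  by (rule finite_subset[of _ "Pow T"]) (auto simp: low_def)

lemma poly_node_poly_pos: "(\<And>k. k \<in> K \<Longrightarrow> of_int k < x) \<Longrightarrow> poly (node_poly K) x > 0"
  by (auto simp: poly_node_poly intro!: prod_pos)

lemma poly_node_poly_eq_0_iff: "finite K \<Longrightarrow> poly (node_poly K) (of_int t) = 0 \<longleftrightarrow> t \<in> K"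
  by (auto simp: poly_node_poly)

text \<open>A node polynomial is positive to the right of its nodes, so a new largest point imposes
  no condition on the facets that avoid it.\<close>

lemma low_insert_notin:
  assumes "finite T" and b: "\<And>x. x \<in> T \<Longrightarrow> x < b"
  shows "{K \<in> low (insert b T) c. b \<notin> K} = low T c"
proof (intro equalityI subsetI)
  fix K assume "K \<in> low T c"
  moreover from this have "poly (node_poly K) (of_int b) > 0"
    using b by (intro poly_node_poly_pos) (auto simp: low_def)
  ultimately show "K \<in> {K \<in> low (insert b T) c. b \<notin> K}" using b by (auto simp: low_def)
qed (auto simp: low_def)

text \<open>The factor (x - a)(x - b) is positive to the left of \<open>a\<close>. This is Gale's
  evenness condition, written as a recursion.\<close>

lemma low_insert_pair:
  assumes fin: "finite T" and a: "\<And>x. x \<in> T \<Longrightarrow> x < a" and ab: "a < b"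
  shows "K \<in> low T c \<longleftrightarrow> K \<subseteq> T \<and> insert b (insert a K) \<in> low (insert b (insert a T)) (Suc (Suc c))"
proof (cases "K \<subseteq> T")
  case True
  then have K: "finite K" "a \<notin> K" "b \<notin> K" "b \<noteq> a" using fin a ab finite_subset by fastforce+
  have p: "poly (node_poly (insert b (insert a K))) x = (x - of_int b) * (x - of_int a) * poly (node_poly K) x" for x
    using K by (simp add: poly_node_poly algebra_simps)
  have "(poly (node_poly (insert b (insert a K))) (of_int t) \<ge> 0) \<longleftrightarrow> (poly (node_poly K) (of_int t) \<ge> 0)" if "t \<in> T" for t
  proof -
    have "(real_of_int t - of_int b) * (real_of_int t - of_int a) > 0"
      using a[OF that] ab by (intro mult_neg_neg) auto
    then show ?thesis unfolding p using zero_le_mult_iff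
      by (metis less_le_not_le)
  qed
  moreover have "poly (node_poly (insert b (insert a K))) (of_int t) \<ge> 0" if "t \<in> {a, b}" for t
    using that by (auto simp: p)
  ultimately show ?thesis using True K by (auto simp: low_def)
qed (auto simp: low_def)

text \<open>With \<open>b\<close> but not \<open>a\<close> as a node the polynomial would be
  negative at \<open>a\<close>, because \<open>b\<close> would be the only node to the right of
  \<open>a\<close>.\<close>

lemma low_top_pair:
  assumes fin: "finite T" and a: "\<And>x. x \<in> T \<Longrightarrow> x < a" and ab: "a < b"
    and K: "K \<in> low (insert b (insert a T)) c" "b \<in> K"
  shows "a \<in> K"
proof (rule ccontr)
  assume na: "a \<notin> K"
  define L where "L = K - {b}"
  have L: "K = insert b L" "b \<notin> L" "finite L" "L \<subseteq> T"
    using K fin na finite_subset[of K "insert b (insert a T)"] by (auto simp: L_def low_def)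
  have "poly (node_poly L) (of_int a) > 0" using L a by (intro poly_node_poly_pos) auto
  then have "poly (node_poly K) (of_int a) < 0"
    using L ab by (simp add: node_poly_insert mult_neg_pos del: mult_pCons_left)
  then show False using K by (auto simp: low_def)
qed

lemma low_insert_insert:
  assumes fin: "finite T" and a: "\<And>x. x \<in> T \<Longrightarrow> x < a" and ab: "a < b"
  shows "low (insert b (insert a T)) (Suc (Suc c)) =
    low (insert a T) (Suc (Suc c)) \<union> (\<lambda>K. insert b (insert a K)) ` low T c"
proof -
  have "{K \<in> low (insert b (insert a T)) (Suc (Suc c)). b \<notin> K} = low (insert a T) (Suc (Suc c))"
    using fin a ab by (intro low_insert_notin) force+
  moreover have "{K \<in> low (insert b (insert a T)) (Suc (Suc c)). b \<in> K} = (\<lambda>K. insert b (insert a K)) ` low T c"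
  proof (intro equalityI subsetI)
    fix K assume "K \<in> {K \<in> low (insert b (insert a T)) (Suc (Suc c)). b \<in> K}"
    then have K: "K \<in> low (insert b (insert a T)) (Suc (Suc c))" "b \<in> K" by auto
    define L where "L = K - {a, b}"
    have "K = insert b (insert a L)" "L \<subseteq> T"
      using low_top_pair[OF fin a ab K] K by (auto simp: L_def low_def)
    then show "K \<in> (\<lambda>K. insert b (insert a K)) ` low T c"
      using low_insert_pair[OF fin a ab, of L c] K by auto
  next
    fix K assume "K \<in> (\<lambda>K. insert b (insert a K)) ` low T c"
    then show "K \<in> {K \<in> low (insert b (insert a T)) (Suc (Suc c)). b \<in> K}"
      using low_insert_pair[OF fin a ab, of _ c] by auto
  qed
  ultimately show ?thesis by blast
qed

text \<open>In the first case the moment of order \<open>c\<close> of a positive measure with support \<open>S\<close> can be lowered without changing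
  the moments of smaller order; in the second case it is minimal.\<close>

lemma support_alternative:
  assumes "finite T" and "S \<subseteq> T" and "c \<le> card T"
  shows "(\<exists>R\<subseteq>T. card R = Suc c \<and> {i \<in> R. even (card {j \<in> R. j > i})} \<subseteq> S) \<or> (\<exists>K\<in>low T c. S \<subseteq> K)"
  using assms
proof (induction "card T" arbitrary: T S c rule: less_induct)
  case less
  note fin = less.prems(1)
  consider "c = card T" | "c = 0" | "c < card T" "c > 0" using less.prems(3) by linarith
  then show ?case
  proof cases
    case 1
    have "T \<in> low T c" using 1 fin poly_node_poly_eq_0_iff[OF fin] by (auto simp: low_def intro: eq_refl)
    then show ?thesis using less.prems(2) by blast
  next
    case 2
    show ?thesis
    proof (cases "S = {}")
      case True
      have "{} \<in> low T c" using 2 by (auto simp: low_def node_poly_def)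
      then show ?thesis using True by blast
    next
      case False
      then obtain s where "s \<in> S" by blast
      then have "{s} \<subseteq> T" "card {s} = Suc c" "{i \<in> {s}. even (card {j \<in> {s}. j > i})} \<subseteq> S"
        using less.prems(2) 2 by auto
      then show ?thesis by blast
    qed
  next
    case 3
    have ne: "T \<noteq> {}" using 3 by auto
    define b where "b = Max T"
    define T1 where "T1 = T - {b}"
    have b: "b \<in> T" "\<And>x. x \<in> T1 \<Longrightarrow> x < b" "T = insert b T1" "b \<notin> T1"
      using Max_in[OF fin ne] Max_ge[OF fin] by (auto simp: b_def T1_def order_less_le)
    have T1: "finite T1" "card T = Suc (card T1)" using card_Suc_Diff1[OF fin b(1)] fin by (simp_all add: T1_def)
    show ?thesis
    proof (cases "b \<in> S")
      case False
      have "(\<exists>R\<subseteq>T1. card R = Suc c \<and> {i \<in> R. even (card {j \<in> R. j > i})} \<subseteq> S) \<or> (\<exists>K\<in>low T1 c. S \<subseteq> K)"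
        using less.prems False 3 T1 b by (intro less.hyps) auto
      then show ?thesis
      proof
        assume "\<exists>R\<subseteq>T1. card R = Suc c \<and> {i \<in> R. even (card {j \<in> R. j > i})} \<subseteq> S"
        then show ?thesis using b(3) by blast
      next
        assume "\<exists>K\<in>low T1 c. S \<subseteq> K"
        then show ?thesis using low_insert_notin[OF T1(1) b(2)] b(3) by blast
      qed
    next
      case bS: True
      have ne1: "T1 \<noteq> {}" using 3 T1 by auto
      define a where "a = Max T1"
      define T2 where "T2 = T1 - {a}"
      have a: "a \<in> T1" "\<And>x. x \<in> T2 \<Longrightarrow> x < a" "T1 = insert a T2" "a \<notin> T2"
        using Max_in[OF T1(1) ne1] Max_ge[OF T1(1)] by (auto simp: a_def T2_def order_less_le)
      have T2: "finite T2" "card T1 = Suc (card T2)" using card_Suc_Diff1[OF T1(1) a(1)] T1 by (simp_all add: T2_def)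
      have ab: "a < b" using a b by blast
      have top: "{j \<in> insert b (insert a R). j > b} = {}" "{j \<in> insert b (insert a R). j > a} = {b}"
        if "R \<subseteq> T2" for R
        using that a(2) ab by force+
      show ?thesis
      proof (cases "c = 1")
        case True
        \<comment> \<open>For \<open>c = 1\<close> the top pair itself serves: only \<open>b\<close>
          has an even number of larger elements.\<close>
        define R where "R = insert b (insert a {})"
        have "card {j \<in> R. j > a} = 1" unfolding R_def by (subst top(2)) auto
        then have "{i \<in> R. even (card {j \<in> R. j > i})} \<subseteq> S" using bS by (auto simp: R_def)
        moreover have "R \<subseteq> T" "card R = Suc c" using True a(1) b(1,3) less_imp_neq[OF ab] by (auto simp: R_def)
        ultimately show ?thesis by blast
      next
        case False
        then obtain c' where c': "c = Suc (Suc c')" using 3 by (metis One_nat_def gr0_implies_Suc not0_implies_Suc)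
        \<comment> \<open>With mass at \<open>b\<close>, remove the two largest points. Putting the
          pair on top of a set preserves all its parities and adds \<open>a\<close>, with one larger
          element, and \<open>b\<close> in \<open>S\<close>, with none; it also takes lower facets
          to lower facets.\<close>
        have "(\<exists>R\<subseteq>T2. card R = Suc c' \<and> {i \<in> R. even (card {j \<in> R. j > i})} \<subseteq> S \<inter> T2)
            \<or> (\<exists>K\<in>low T2 c'. S \<inter> T2 \<subseteq> K)"
          using 3 T1 T2 c' by (intro less.hyps) auto
        then show ?thesis
        proof
          assume "\<exists>R\<subseteq>T2. card R = Suc c' \<and> {i \<in> R. even (card {j \<in> R. j > i})} \<subseteq> S \<inter> T2"
          then obtain R where R: "R \<subseteq> T2" "card R = Suc c'" "{i \<in> R. even (card {j \<in> R. j > i})} \<subseteq> S \<inter> T2"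
            by blast
          define Q where "Q = insert b (insert a R)"
          have finR: "finite R" using R T2 finite_subset by blast
          have nin: "a \<notin> R" "b \<notin> insert a R" using R a b ab by auto
          have "i \<in> S" if i: "i \<in> Q" "even (card {j \<in> Q. j > i})" for i
          proof -
            consider "i = b" | "i = a" | "i \<in> R" using i by (auto simp: Q_def)
            then show ?thesis
            proof cases
              case 2
              then show ?thesis using i top(2)[OF R(1)] by (simp add: Q_def)
            next
              case i': 3
              have "{j \<in> Q. j > i} = insert b (insert a {j \<in> R. j > i})"
                using i' R a(2) ab by (force simp: Q_def)
              then have "card {j \<in> Q. j > i} = Suc (Suc (card {j \<in> R. j > i}))" using finR nin by simp
              then show ?thesis using i i' R(3) by auto
            qed (use bS in simp)
          qed
          then have "{i \<in> Q. even (card {j \<in> Q. j > i})} \<subseteq> S" by blast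
          moreover have "card Q = Suc c" using finR nin R c' by (simp add: Q_def)
          moreover have "Q \<subseteq> T" using R a b by (auto simp: Q_def)
          ultimately show ?thesis by blast
        next
          assume "\<exists>K\<in>low T2 c'. S \<inter> T2 \<subseteq> K"
          then obtain K where K: "K \<in> low T2 c'" "S \<inter> T2 \<subseteq> K" by blast
          have "insert b (insert a K) \<in> low T c"
            using low_insert_pair[OF T2(1) a(2) ab, of K c'] K c' a(3) b(3) by auto
          moreover have "S \<subseteq> insert b (insert a K)" using less.prems(2) K a(3) b(3) by auto
          ultimately show ?thesis by blast
        qed
      qed
    qed
  qed
qed

section \<open>Reduction of nonnegative measures to lower facets\<close>

definition in_cone :: "int set \<Rightarrow> nat \<Rightarrow> (nat \<Rightarrow> real) \<Rightarrow> bool" where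
  "in_cone T c y \<longleftrightarrow> (\<exists>a. (\<forall>t\<in>T. a t \<ge> 0) \<and> (\<forall>j<c. y j = (\<Sum>t\<in>T. a t * of_int t ^ j)))"

text \<open>Masses 1 / \<open>node_deriv R\<close> form the divided difference of order
  \<open>c\<close>: it kills the moments below \<open>c\<close> and has moment one at
  \<open>c\<close>. Subtracting a multiple therefore lowers the moment of order \<open>c\<close>
  alone.\<close>

lemma moments_shift:
  assumes fin: "finite T" and R: "R \<subseteq> T" "card R = Suc c" and j: "j \<le> c"
  shows "(\<Sum>t\<in>T. (a t - e * (if t \<in> R then 1 / node_deriv R t else 0)) * of_int t ^ j)
    = (\<Sum>t\<in>T. a t * of_int t ^ j) - (if j = c then e else 0)"
proof -
  have finR: "finite R" using fin R finite_subset by blast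
  have "(\<Sum>t\<in>R. of_int t ^ j / node_deriv R t) = (if j = c then 1 else 0)"
    using divided_difference[OF finR, of "monom 1 j"] R j by (simp add: degree_monom_eq poly_monom)
  then have "(\<Sum>t\<in>R. 1 / node_deriv R t * of_int t ^ j) = (if j = c then 1 else 0)" by simp
  then have "(\<Sum>t\<in>R. e * (1 / node_deriv R t) * of_int t ^ j) = (if j = c then e else 0)"
    by (simp only: sum_distrib_left[symmetric] mult.assoc) simp
  moreover have "(\<Sum>t\<in>T. e * (if t \<in> R then 1 / node_deriv R t else 0) * of_int t ^ j)
      = (\<Sum>t\<in>R. e * (1 / node_deriv R t) * of_int t ^ j)"
    using fin R by (intro sum.mono_neutral_cong_right) auto
  ultimately show ?thesis by (simp add: left_diff_distrib sum_subtractf)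
qed

text \<open>Subtract the largest multiple of a divided difference on \<open>c + 1\<close> nodes that
  keeps all masses nonnegative. One node loses its mass, and the moment of order \<open>c\<close>
  does not grow.\<close>

lemma caratheodory_moments:
  assumes "finite T" and "c \<le> card T" and "\<And>t. t \<in> T \<Longrightarrow> a t \<ge> (0::real)"
  shows "\<exists>K\<subseteq>T. \<exists>b. card K = c \<and> (\<forall>t\<in>K. b t \<ge> 0) \<and>
    (\<forall>j<c. (\<Sum>t\<in>K. b t * of_int t ^ j) = (\<Sum>t\<in>T. a t * of_int t ^ j)) \<and>
    (\<Sum>t\<in>K. b t * of_int t ^ c) \<le> (\<Sum>t\<in>T. a t * of_int t ^ c)"
  using assms
proof (induction "card T" arbitrary: T a rule: less_induct)
  case less
  note fin = less.prems(1)
  show ?case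
  proof (cases "c = card T")
    case True
    then show ?thesis using less.prems(3) by (intro exI[of _ T] conjI exI[of _ a]) auto
  next
    case False
    then obtain R where R: "R \<subseteq> T" "card R = Suc c"
      using less.prems(2) by (metis Suc_leI le_neq_implies_less obtain_subset_with_card_n)
    have finR: "finite R" and neR: "R \<noteq> {}" using fin R finite_subset by auto
    define P where "P = {i \<in> R. node_deriv R i > 0}"
    \<comment> \<open>The largest node has a positive weight, so the ratio test that defines
      \<open>e\<close> ranges over a nonempty set.\<close>
    have "{j \<in> R. j > Max R} = {}" using finR by (auto simp: not_less)
    then have "node_deriv R (Max R) > 0" unfolding node_deriv_pos_iff(1)[OF finR] by (simp only: card.empty even_zero)
    then have "Max R \<in> P" using finR neR by (simp add: P_def)
    then have P: "finite P" "P \<noteq> {}" using finR by (auto simp: P_def)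
    define e where "e = Min ((\<lambda>i. a i * node_deriv R i) ` P)"
    have "e \<in> (\<lambda>i. a i * node_deriv R i) ` P" unfolding e_def using P by (intro Min_in) auto
    then obtain i0 where i0: "i0 \<in> P" "e = a i0 * node_deriv R i0" by blast
    have emin: "e \<le> a i * node_deriv R i" if "i \<in> P" for i
      unfolding e_def using P that by (intro Min_le) auto
    have i0T: "i0 \<in> T" "i0 \<in> R" "node_deriv R i0 > 0" using i0 R by (auto simp: P_def)
    have e0: "e \<ge> 0" using i0 i0T less.prems(3) by simp
    define b where "b t = a t - e * (if t \<in> R then 1 / node_deriv R t else 0)" for t
    have b0: "b t \<ge> 0" if t: "t \<in> T" for t
    proof (cases "t \<in> R")
      case tR: True
      show ?thesis
      proof (cases "node_deriv R t > 0")
        case True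
        then show ?thesis using emin[of t] tR by (simp add: b_def P_def divide_le_eq)
      next
        case False
        then have "e * (1 / node_deriv R t) \<le> 0" using e0 by (simp add: divide_nonneg_nonpos)
        then show ?thesis using less.prems(3)[OF t] tR by (simp add: b_def)
      qed
    qed (use less.prems(3)[OF t] in \<open>simp add: b_def\<close>)
    have bi0: "b i0 = 0" using i0 i0T by (simp add: b_def)
    have sums: "(\<Sum>t\<in>T - {i0}. b t * of_int t ^ j) = (\<Sum>t\<in>T. a t * of_int t ^ j) - (if j = c then e else 0)"
      if "j \<le> c" for j
    proof -
      have "(\<Sum>t\<in>T - {i0}. b t * of_int t ^ j) = (\<Sum>t\<in>T. b t * of_int t ^ j)"
        using fin bi0 by (intro sum.mono_neutral_left) auto
      then show ?thesis using moments_shift[OF fin R that, of a e] by (simp only: b_def)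
    qed
    have "\<exists>K\<subseteq>T - {i0}. \<exists>b'. card K = c \<and> (\<forall>t\<in>K. b' t \<ge> 0) \<and>
      (\<forall>j<c. (\<Sum>t\<in>K. b' t * of_int t ^ j) = (\<Sum>t\<in>T - {i0}. b t * of_int t ^ j)) \<and>
      (\<Sum>t\<in>K. b' t * of_int t ^ c) \<le> (\<Sum>t\<in>T - {i0}. b t * of_int t ^ c)"
      using fin i0T False less.prems(2) b0
      by (intro less.hyps) (auto simp: card_gt_0_iff intro!: diff_less)
    then obtain K b' where K: "K \<subseteq> T - {i0}" "card K = c" "\<forall>t\<in>K. b' t \<ge> 0"
      "\<forall>j<c. (\<Sum>t\<in>K. b' t * of_int t ^ j) = (\<Sum>t\<in>T - {i0}. b t * of_int t ^ j)"
      "(\<Sum>t\<in>K. b' t * of_int t ^ c) \<le> (\<Sum>t\<in>T - {i0}. b t * of_int t ^ c)" by blast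
    have "\<forall>j<c. (\<Sum>t\<in>K. b' t * of_int t ^ j) = (\<Sum>t\<in>T. a t * of_int t ^ j)"
      using K(4) sums by simp
    moreover have "(\<Sum>t\<in>K. b' t * of_int t ^ c) \<le> (\<Sum>t\<in>T. a t * of_int t ^ c)"
      using K(5) sums[of c] e0 by simp
    ultimately show ?thesis using K(1-3) by blast
  qed
qed

lemma mom_node_poly_measure_eq_0:
  assumes "finite K" and "card K = c" and "\<And>j. j < c \<Longrightarrow> y j = (\<Sum>t\<in>K. b t * of_int t ^ j)"
  shows "(\<Sum>t\<in>K. b t * of_int t ^ c) = y c - mom y (node_poly K)"
proof -
  define s where "s = (\<Sum>t\<in>K. b t * of_int t ^ c)"
  have "mom (y(c := s)) (node_poly K) = (\<Sum>t\<in>K. b t * poly (node_poly K) (of_int t))"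
    using assms degree_node_poly[OF assms(1)] by (intro mom_of_measure) (auto simp: s_def)
  also have "\<dots> = 0" using poly_node_poly_eq_0_iff[OF assms(1)] by (intro sum.neutral) auto
  finally show ?thesis using mom_upd_top[OF assms(1,2), of y s] by (simp add: s_def)
qed

text \<open>Only finitely many sets of \<open>c\<close> nodes represent \<open>y\<close>; take one
  with the smallest moment of order \<open>c\<close>. If its support lies in no lower facet,
  \<open>support_alternative\<close> supplies a divided difference that can still be subtracted, and
  Caratheodory's reduction yields a smaller moment.\<close>

lemma in_cone_low:
  assumes fin: "finite T" and c: "c \<le> card T" and y: "in_cone T c y"
  shows "\<exists>K\<in>low T c. in_cone K c y"
proof -
  define KK where "KK = {K. K \<subseteq> T \<and> card K = c \<and> in_cone K c y}"
  define z where "z K = y c - mom y (node_poly K)" for K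
  have finK: "finite K" if "K \<subseteq> T" for K using that fin finite_subset by blast
  have car: "\<exists>K\<in>KK. z K \<le> (\<Sum>t\<in>T. a t * of_int t ^ c)"
    if a0: "\<And>t. t \<in> T \<Longrightarrow> a t \<ge> 0"
      and ya: "\<And>j. j < c \<Longrightarrow> y j = (\<Sum>t\<in>T. a t * of_int t ^ j)" for a
  proof -
    obtain K b where K: "K \<subseteq> T" "card K = c" "\<forall>t\<in>K. b t \<ge> 0"
      "\<forall>j<c. (\<Sum>t\<in>K. b t * of_int t ^ j) = (\<Sum>t\<in>T. a t * of_int t ^ j)"
      "(\<Sum>t\<in>K. b t * of_int t ^ c) \<le> (\<Sum>t\<in>T. a t * of_int t ^ c)"
      using caratheodory_moments[OF fin c, of a] a0 by blast
    have yb: "\<And>j. j < c \<Longrightarrow> y j = (\<Sum>t\<in>K. b t * of_int t ^ j)" using K(4) ya by simp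
    then have "K \<in> KK" using K by (auto simp: KK_def in_cone_def)
    moreover have "z K = (\<Sum>t\<in>K. b t * of_int t ^ c)"
      using mom_node_poly_measure_eq_0[OF finK[OF K(1)] K(2) yb] by (simp add: z_def)
    ultimately show ?thesis using K(5) by (intro bexI[of _ K]) simp
  qed
  have finKK: "finite KK" using fin by (auto simp: KK_def)
  have "KK \<noteq> {}" using y car unfolding in_cone_def by blast
  then obtain K where K: "K \<in> KK" "\<And>K'. K' \<in> KK \<Longrightarrow> z K \<le> z K'"
    using arg_min_if_finite[OF finKK, of z] by (metis not_le)
  then obtain b where b: "\<And>t. t \<in> K \<Longrightarrow> b t \<ge> 0" "\<And>j. j < c \<Longrightarrow> y j = (\<Sum>t\<in>K. b t * of_int t ^ j)"
    by (auto simp: KK_def in_cone_def)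
  have KT: "K \<subseteq> T" "card K = c" using K by (auto simp: KK_def)
  define S where "S = {t \<in> K. b t > 0}"
  have "(\<exists>R\<subseteq>T. card R = Suc c \<and> {i \<in> R. even (card {j \<in> R. j > i})} \<subseteq> S) \<or> (\<exists>K\<in>low T c. S \<subseteq> K)"
    using fin c KT by (intro support_alternative) (auto simp: S_def)
  then show ?thesis
  proof
    assume "\<exists>K\<in>low T c. S \<subseteq> K"
    then obtain K' where K': "K' \<in> low T c" "S \<subseteq> K'" by blast
    define b' where "b' t = (if t \<in> S then b t else 0)" for t
    have finK': "finite K'" using K' finK by (auto simp: low_def)
    have "(\<Sum>t\<in>K'. b' t * of_int t ^ j) = (\<Sum>t\<in>K. b t * of_int t ^ j)" for j
    proof -
      have "(\<Sum>t\<in>K'. b' t * of_int t ^ j) = (\<Sum>t\<in>S. b t * of_int t ^ j)"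
        using K'(2) finK' by (intro sum.mono_neutral_cong_right) (auto simp: b'_def)
      also have "\<dots> = (\<Sum>t\<in>K. b t * of_int t ^ j)"
      proof (rule sum.mono_neutral_left)
        show "\<forall>t\<in>K - S. b t * of_int t ^ j = 0"
        proof
          fix t assume "t \<in> K - S"
          then have "b t = 0" using b(1)[of t] by (simp add: S_def)
          then show "b t * of_int t ^ j = 0" by simp
        qed
      qed (use finK[OF KT(1)] in \<open>auto simp: S_def\<close>)
      finally show ?thesis .
    qed
    moreover have "\<forall>t\<in>K'. b' t \<ge> 0" by (auto simp: b'_def S_def)
    ultimately have "in_cone K' c y" unfolding in_cone_def using b(2) by (intro exI[of _ b']) auto
    then show ?thesis using K' by blast
  next
    assume "\<exists>R\<subseteq>T. card R = Suc c \<and> {i \<in> R. even (card {j \<in> R. j > i})} \<subseteq> S"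
    then obtain R where R: "R \<subseteq> T" "card R = Suc c" "{i \<in> R. even (card {j \<in> R. j > i})} \<subseteq> S" by blast
    have finR: "finite R" using R finK by blast
    define P where "P = {i \<in> R. node_deriv R i > 0}"
    have PS: "P \<subseteq> S" using R(3) node_deriv_pos_iff(1)[OF finR] by (auto simp: P_def)
    \<comment> \<open>The entry 1 keeps the minimum defined and positive also for empty
      \<open>P\<close>; the other entries keep all masses nonnegative.\<close>
    define e where "e = Min (insert 1 ((\<lambda>i. b i * node_deriv R i) ` P))"
    have finP: "finite P" using finR by (simp add: P_def)
    have e0: "e > 0"
      unfolding e_def using finP PS by (subst Min_gr_iff) (auto simp: S_def P_def)
    have emin: "e \<le> b i * node_deriv R i" if "i \<in> P" for i
      unfolding e_def using finP that by (intro Min_le) auto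
    define a0 where "a0 t = (if t \<in> K then b t else 0)" for t
    define a where "a t = a0 t - e * (if t \<in> R then 1 / node_deriv R t else 0)" for t
    have a0s: "(\<Sum>t\<in>T. a0 t * of_int t ^ j) = (\<Sum>t\<in>K. b t * of_int t ^ j)" for j
      using fin KT by (intro sum.mono_neutral_cong_right) (auto simp: a0_def)
    have as: "(\<Sum>t\<in>T. a t * of_int t ^ j) = (\<Sum>t\<in>K. b t * of_int t ^ j) - (if j = c then e else 0)"
      if "j \<le> c" for j
      using moments_shift[OF fin R(1,2) that, of a0 e] unfolding a0s by (simp only: a_def)
    have "a t \<ge> 0" if t: "t \<in> T" for t
    proof (cases "t \<in> R")
      case tR: True
      show ?thesis
      proof (cases "node_deriv R t > 0")
        case True
        then have "t \<in> P" using tR by (simp add: P_def)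
        then have "t \<in> K" using PS by (auto simp: S_def)
        then show ?thesis using emin[OF \<open>t \<in> P\<close>] tR True by (simp add: a_def a0_def divide_le_eq)
      next
        case False
        then have "e * (1 / node_deriv R t) \<le> 0" using e0 by (simp add: divide_nonneg_nonpos)
        moreover have "a0 t \<ge> 0" using b(1) by (simp add: a0_def)
        ultimately show ?thesis using tR by (simp add: a_def)
      qed
    qed (use b(1) in \<open>simp add: a_def a0_def\<close>)
    then obtain K' where "K' \<in> KK" "z K' \<le> (\<Sum>t\<in>T. a t * of_int t ^ c)"
      using car[of a] as b(2) by auto
    moreover have "(\<Sum>t\<in>T. a t * of_int t ^ c) = z K - e"
      using as[of c] mom_node_poly_measure_eq_0[OF finK[OF KT(1)] KT(2) b(2)] by (simp add: z_def)
    ultimately show ?thesis using K(2)[of K'] e0 by simp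
  qed
qed

section \<open>Decomposition of the lattice points of a cyclic polytope\<close>

lemma eventually_small: "b > 0 \<Longrightarrow> eventually (\<lambda>e::real. e * x < b) (at_right 0)"
proof -
  assume b: "b > 0"
  have "((\<lambda>e. e * x) \<longlongrightarrow> 0 * x) (at_right (0::real))" by (intro tendsto_intros)
  then show ?thesis using b by (intro order_tendstoD(2)) auto
qed

lemma eventually_perturbation:
  assumes "finite T"
  shows "eventually (\<lambda>e::real. e > 0 \<and> (\<forall>F\<in>Pow T. e * poly (node_poly F) x < 1)) (at_right 0)"
  by (intro eventually_conj eventually_at_right_less eventually_ball_finite ballI eventually_small)
    (use assms in auto)

text \<open>An integer lowered by an amount strictly between 0 and 1 is positive iff it was positive
  before, and it is never zero.\<close>

lemma perturbed_sign:
  assumes "finite F" and "\<And>j. y j \<in> \<int>" and "\<And>k. k \<in> F \<Longrightarrow> of_int k < x"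
    and "e > 0" and "e * poly (node_poly F) x < 1"
  shows "mom (\<lambda>j. y j - e * x ^ j) (node_poly F) > 0 \<longleftrightarrow> mom y (node_poly F) > 0"
    and "mom (\<lambda>j. y j - e * x ^ j) (node_poly F) \<noteq> 0"
proof -
  have "mom y (node_poly F) \<in> \<int>" using mom_node_poly_Ints[of F y] assms(1,2) by simp
  then obtain z where z: "mom y (node_poly F) = of_int z" by (auto elim: Ints_cases)
  have "e * poly (node_poly F) x > 0" using assms by (intro mult_pos_pos poly_node_poly_pos) auto
  moreover have "of_int z \<noteq> e * poly (node_poly F) x"
  proof
    assume "of_int z = e * poly (node_poly F) x"
    then have "0 < real_of_int z" "real_of_int z < 1" using calculation assms(5) by linarith+
    then show False unfolding of_int_0_less_iff of_int_less_1_iff by linarith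
  qed
  ultimately have "of_int z - e * poly (node_poly F) x > 0 \<longleftrightarrow> (z > 0)" "of_int z - e * poly (node_poly F) x \<noteq> 0"
    using assms(5) by (linarith, simp)
  then show "mom (\<lambda>j. y j - e * x ^ j) (node_poly F) > 0 \<longleftrightarrow> mom y (node_poly F) > 0"
    "mom (\<lambda>j. y j - e * x ^ j) (node_poly F) \<noteq> 0"
    by (simp_all add: mom_sub_power z)
qed

text \<open>The formal counterpart of the geometric reading of \<open>half_open\<close>: the
  quotients are the masses on \<open>J\<close> of the displaced point.\<close>

lemma half_open_iff_perturbed:
  assumes fin: "finite J" and int: "\<And>j. y j \<in> \<int>" and x: "\<And>k. k \<in> J \<Longrightarrow> of_int k < x"
    and e: "e > 0" "\<And>F. F \<subseteq> J \<Longrightarrow> e * poly (node_poly F) x < 1"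
  shows "half_open J y \<longleftrightarrow> (\<forall>i\<in>J. mom (\<lambda>j. y j - e * x ^ j) (node_poly (J - {i})) / node_deriv J i > 0)"
proof -
  have "(mom y (node_poly (J - {i})) > 0 \<longleftrightarrow> even (card {j \<in> J. j > i})) \<longleftrightarrow>
      mom (\<lambda>j. y j - e * x ^ j) (node_poly (J - {i})) / node_deriv J i > 0" if "i \<in> J" for i
  proof -
    have "e * poly (node_poly (J - {i})) x < 1" using e by blast
    then have "mom (\<lambda>j. y j - e * x ^ j) (node_poly (J - {i})) > 0 \<longleftrightarrow> mom y (node_poly (J - {i})) > 0"
      "mom (\<lambda>j. y j - e * x ^ j) (node_poly (J - {i})) \<noteq> 0"
      using perturbed_sign[of "J - {i}" y x e] fin int x e by auto
    then show ?thesis using node_deriv_pos_iff[OF fin, of i] node_deriv_nz[OF fin, of i]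
      by (auto simp: zero_less_divide_iff)
  qed
  then show ?thesis by (simp add: half_open_def)
qed

lemma measure_coeff:
  assumes fin: "finite J" and y: "\<And>j. j < card J \<Longrightarrow> y j = (\<Sum>t\<in>J. b t * of_int t ^ j)" and i: "i \<in> J"
  shows "mom y (node_poly (J - {i})) / node_deriv J i = b i"
proof -
  have "card J > 0" using fin i by (auto simp: card_gt_0_iff)
  then have "mom y (node_poly (J - {i})) = (\<Sum>t\<in>J. b t * poly (node_poly (J - {i})) (of_int t))"
    using y fin i degree_node_poly[of "J - {i}"] by (intro mom_of_measure) auto
  also have "\<dots> = (\<Sum>t\<in>J. if t = i then b i * node_deriv J i else 0)"
  proof (rule sum.cong)
    fix t assume "t \<in> J"
    then show "b t * poly (node_poly (J - {i})) (of_int t) = (if t = i then b i * node_deriv J i else 0)"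
      using poly_node_poly_eq_0_iff[of "J - {i}" t] fin by (auto simp: poly_node_poly node_deriv_def)
  qed simp
  also have "\<dots> = b i * node_deriv J i" using fin i by simp
  finally show ?thesis using node_deriv_nz[OF fin] by simp
qed

lemma moments_lagrange_power:
  assumes "finite J" and "j < card J"
  shows "y j = (\<Sum>i\<in>J. mom y (node_poly (J - {i})) / node_deriv J i * of_int i ^ j)"
  using moments_lagrange[OF assms(1), of "monom 1 j" y] assms(2)
  by (simp add: mom_monom degree_monom_eq poly_monom)

lemma in_cone_mono:
  assumes "finite T" and "K \<subseteq> T" and "in_cone K c y"
  shows "in_cone T c y"
proof -
  obtain a where a: "\<And>t. t \<in> K \<Longrightarrow> a t \<ge> 0" "\<And>j. j < c \<Longrightarrow> y j = (\<Sum>t\<in>K. a t * of_int t ^ j)"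
    using assms(3) by (auto simp: in_cone_def)
  define b where "b t = (if t \<in> K then a t else 0)" for t
  have "(\<Sum>t\<in>T. b t * of_int t ^ j) = (\<Sum>t\<in>K. a t * of_int t ^ j)" for j
    using assms(1,2) by (intro sum.mono_neutral_cong_right) (auto simp: b_def)
  moreover have "\<forall>t\<in>T. b t \<ge> 0" using a(1) by (auto simp: b_def)
  ultimately show ?thesis unfolding in_cone_def using a(2) by (intro exI[of _ b]) auto
qed

lemma half_open_in_cone:
  assumes "finite T" and "J \<subseteq> T" and "half_open J y"
  shows "in_cone T (card J) y"
proof -
  have finJ: "finite J" using assms finite_subset by blast
  obtain c where "\<And>i. i \<in> J \<Longrightarrow> c i \<ge> 0" "\<And>j. j < card J \<Longrightarrow> y j = (\<Sum>i\<in>J. c i * of_int i ^ j)"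
    using half_open_measure[OF finJ assms(3)] by blast
  then have "in_cone J (card J) y" by (auto simp: in_cone_def)
  then show ?thesis using in_cone_mono assms by blast
qed

lemma mom_low_nonneg:
  assumes "finite T" and K: "K \<in> low T c" and "in_cone T (Suc c) y"
  shows "mom y (node_poly K) \<ge> 0"
proof -
  obtain a where a: "\<And>t. t \<in> T \<Longrightarrow> a t \<ge> 0" "\<And>j. j < Suc c \<Longrightarrow> y j = (\<Sum>t\<in>T. a t * of_int t ^ j)"
    using assms(3) by (auto simp: in_cone_def)
  have "finite K" using K assms(1) finite_subset by (auto simp: low_def)
  then have "mom y (node_poly K) = (\<Sum>t\<in>T. a t * poly (node_poly K) (of_int t))"
    using a(2) K degree_node_poly[of K] by (intro mom_of_measure) (auto simp: low_def)
  also have "\<dots> \<ge> 0" using a(1) K by (intro sum_nonneg mult_nonneg_nonneg) (auto simp: low_def)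
  finally show ?thesis .
qed

lemma in_cone_bottom:
  assumes "finite K" and "card K = c" and "in_cone K c y" and "mom y (node_poly K) = 0"
  shows "in_cone K (Suc c) y"
proof -
  obtain a where a: "\<And>t. t \<in> K \<Longrightarrow> a t \<ge> 0" "\<And>j. j < c \<Longrightarrow> y j = (\<Sum>t\<in>K. a t * of_int t ^ j)"
    using assms(3) by (auto simp: in_cone_def)
  have "y c = (\<Sum>t\<in>K. a t * of_int t ^ c)"
    using mom_node_poly_measure_eq_0[OF assms(1,2) a(2)] assms(4) by simp
  then show ?thesis unfolding in_cone_def using a by (intro exI[of _ a]) (auto simp: less_Suc_eq)
qed

lemma in_cone_cong: "(\<And>j. j < c \<Longrightarrow> y j = z j) \<Longrightarrow> in_cone T c y \<longleftrightarrow> in_cone T c z"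
  by (simp add: in_cone_def)

text \<open>A nonnegative measure whose support lies in no lower facet can be displaced along - (1,
  x, x^2, ...) and stays nonnegative. By \<open>in_cone_low\<close> the displaced point is in the
  cone of some \<open>J\<close> in \<open>low T (Suc c)\<close>; its masses there are nonzero by
  integrality, hence positive.\<close>

lemma above_bottom_half_open:
  assumes fin: "finite T" and c: "Suc c \<le> card T" and int: "\<And>j. y j \<in> \<int>"
    and K: "K \<in> low T c" "in_cone K c y"
    and y: "in_cone T (Suc c) y" and pos: "mom y (node_poly K) > 0"
  shows "\<exists>J\<in>low T (Suc c). half_open J y"
proof -
  have finF: "finite F" if "F \<subseteq> T" for F using that fin finite_subset by blast
  have KT: "K \<subseteq> T" "card K = c" "finite K" using K finF by (auto simp: low_def)
  obtain a where a: "\<And>t. t \<in> T \<Longrightarrow> a t \<ge> 0" "\<And>j. j < Suc c \<Longrightarrow> y j = (\<Sum>t\<in>T. a t * of_int t ^ j)"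
    using y by (auto simp: in_cone_def)
  define S where "S = {t \<in> T. a t > 0}"
  \<comment> \<open>Otherwise \<open>y\<close> has height zero over \<open>F\<close>. The point
    vertically below \<open>y\<close> on the facet \<open>K\<close> would then be in the cone and
    have negative height over \<open>F\<close>.\<close>
  have "\<not> (\<exists>F\<in>low T c. S \<subseteq> F)"
  proof
    assume "\<exists>F\<in>low T c. S \<subseteq> F"
    then obtain F where F: "F \<in> low T c" "S \<subseteq> F" by blast
    have finFF: "finite F" "card F = c" using F finF by (auto simp: low_def)
    have "mom y (node_poly F) = (\<Sum>t\<in>T. a t * poly (node_poly F) (of_int t))"
      using a(2) finFF degree_node_poly[of F] by (intro mom_of_measure) auto
    also have "\<dots> = 0"
    proof (rule sum.neutral, rule ballI)
      fix t assume t: "t \<in> T"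
      show "a t * poly (node_poly F) (of_int t) = 0"
        using a(1)[OF t] F(2) t poly_node_poly_eq_0_iff[OF finFF(1), of t] by (cases "a t = 0") (auto simp: S_def)
    qed
    finally have F0: "mom y (node_poly F) = 0" .
    define z where "z = y c - mom y (node_poly K)"
    have "in_cone K c (y(c := z))" using K(2) by (subst in_cone_cong[of c _ y]) auto
    then have "in_cone K (Suc c) (y(c := z))"
      using KT by (intro in_cone_bottom) (auto simp: mom_upd_top z_def)
    then have "in_cone T (Suc c) (y(c := z))" using in_cone_mono[OF fin KT(1)] by blast
    then have "mom (y(c := z)) (node_poly F) \<ge> 0" by (rule mom_low_nonneg[OF fin F(1)])
    then show False using F0 pos finFF by (simp add: mom_upd_top z_def)
  qed
  then obtain R where R: "R \<subseteq> T" "card R = Suc c" "{i \<in> R. even (card {j \<in> R. j > i})} \<subseteq> S"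
    using support_alternative[of T S c] fin c by (auto simp: S_def)
  have finR: "finite R" using finF R by blast
  define x where "x = real_of_int (Max T) + 1"
  have x: "of_int k < x" if "k \<in> T" for k
    using Max_ge[OF fin that] by (simp add: x_def)
  \<comment> \<open>Lagrange interpolation at \<open>x\<close> gives the masses on \<open>R\<close>
    of the direction (1, x, x^2, ...). They are positive only at the elements of \<open>R\<close>
    with an even number of larger ones; these lie in \<open>S\<close>, where \<open>a\<close> has
    mass to spare.\<close>
  define g where "g t = (if t \<in> R then poly (node_poly (R - {t})) x / node_deriv R t else 0)" for t
  have ev: "eventually (\<lambda>e. (e > 0 \<and> (\<forall>F\<in>Pow T. e * poly (node_poly F) x < 1)) \<and> (\<forall>t\<in>S. e * g t < a t)) (at_right 0)"
    using fin by (intro eventually_conj eventually_perturbation eventually_ball_finite ballI eventually_small)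
      (auto simp: S_def)
  obtain e where e: "e > 0" "\<And>F. F \<subseteq> T \<Longrightarrow> e * poly (node_poly F) x < 1" "\<And>t. t \<in> S \<Longrightarrow> e * g t < a t"
    using eventually_happens'[OF trivial_limit_at_right_real ev] by blast
  define y' where "y' j = y j - e * x ^ j" for j
  have "in_cone T (Suc c) y'"
    unfolding in_cone_def
  proof (intro exI[of _ "\<lambda>t. a t - e * g t"] conjI ballI allI impI)
    fix t assume t: "t \<in> T"
    show "a t - e * g t \<ge> 0"
    proof (cases "t \<in> S")
      case False
      have "g t \<le> 0"
      proof (cases "t \<in> R")
        case True
        then have "odd (card {j \<in> R. j > t})" using False R(3) by blast
        then have "node_deriv R t < 0" using node_deriv_pos_iff(2)[OF finR] by blast
        moreover have "poly (node_poly (R - {t})) x > 0" using x R(1) by (intro poly_node_poly_pos) auto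
        ultimately show ?thesis using True by (simp add: g_def divide_nonneg_neg)
      qed (simp add: g_def)
      then have "e * g t \<le> 0" using e(1) by (simp add: mult_nonneg_nonpos)
      then show ?thesis using a(1)[OF t] by simp
    qed (use e(3)[of t] in simp)
  next
    fix j assume j: "j < Suc c"
    have "(\<Sum>t\<in>T. g t * of_int t ^ j) = (\<Sum>t\<in>R. poly (node_poly (R - {t})) x / node_deriv R t * of_int t ^ j)"
      using fin R(1) by (intro sum.mono_neutral_cong_right) (auto simp: g_def)
    also have "\<dots> = poly (monom 1 j) x"
    proof -
      have "poly (monom 1 j) x =
          poly (\<Sum>i\<in>R. smult (poly (monom 1 j) (of_int i) / node_deriv R i) (node_poly (R - {i}))) x"
        using lagrange[OF finR, of "monom 1 j"] j R(2) by (simp add: degree_monom_eq)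
      then show ?thesis by (simp add: poly_sum poly_monom mult.commute)
    qed
    finally have "(\<Sum>t\<in>T. g t * of_int t ^ j) = x ^ j" by (simp add: poly_monom)
    then show "y' j = (\<Sum>t\<in>T. (a t - e * g t) * of_int t ^ j)"
      using a(2)[OF j] by (simp add: y'_def left_diff_distrib sum_subtractf mult.assoc flip: sum_distrib_left)
  qed
  then obtain J where J: "J \<in> low T (Suc c)" "in_cone J (Suc c) y'"
    using in_cone_low[OF fin c] by blast
  have JT: "J \<subseteq> T" "card J = Suc c" "finite J" using J finF by (auto simp: low_def)
  obtain b where b: "\<And>t. t \<in> J \<Longrightarrow> b t \<ge> 0" "\<And>j. j < Suc c \<Longrightarrow> y' j = (\<Sum>t\<in>J. b t * of_int t ^ j)"
    using J(2) by (auto simp: in_cone_def)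
  have "mom y' (node_poly (J - {i})) / node_deriv J i > 0" if i: "i \<in> J" for i
  proof -
    have "mom y' (node_poly (J - {i})) / node_deriv J i = b i"
      using b(2) JT i by (intro measure_coeff) auto
    moreover have "mom y' (node_poly (J - {i})) \<noteq> 0"
    proof -
      have "e * poly (node_poly (J - {i})) x < 1" using JT by (intro e(2)) auto
      then show ?thesis unfolding y'_def using JT x e(1) int by (intro perturbed_sign(2)) auto
    qed
    ultimately show ?thesis using b(1)[OF i] node_deriv_nz[OF JT(3), of i]
      by (metis divide_eq_0_iff order_le_less)
  qed
  moreover have "half_open J y \<longleftrightarrow> (\<forall>i\<in>J. mom y' (node_poly (J - {i})) / node_deriv J i > 0)"
    unfolding y'_def using JT int x e by (intro half_open_iff_perturbed) auto
  ultimately show ?thesis using J(1) by blast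
qed

text \<open>One displacement serves all \<open>J\<close> at once. This allows comparing two
  simplices that contain the same \<open>y\<close>, and a simplex with the bottom below it.\<close>

lemma half_open_perturbed_measure:
  assumes fin: "finite T" and T: "T \<noteq> {}" and int: "\<And>j. y j \<in> \<int>"
  shows "\<exists>y'. (\<forall>J\<subseteq>T. half_open J y \<longrightarrow>
        (\<exists>b. (\<forall>t\<in>J. b t > 0) \<and> (\<forall>j<card J. y' j = (\<Sum>t\<in>J. b t * of_int t ^ j))))
    \<and> (\<forall>F\<subseteq>T. mom y' (node_poly F) < mom y (node_poly F))"
proof -
  define x where "x = real_of_int (Max T) + 1"
  have x: "of_int k < x" if "k \<in> T" for k
    using Max_ge[OF fin that] by (simp add: x_def)
  obtain e where e: "e > 0" "\<And>F. F \<subseteq> T \<Longrightarrow> e * poly (node_poly F) x < 1"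
    using eventually_happens'[OF trivial_limit_at_right_real eventually_perturbation[OF fin, of x]] by blast
  define y' where "y' j = y j - e * x ^ j" for j
  show ?thesis
  proof (intro exI[of _ y'] conjI allI impI)
    fix J assume J: "J \<subseteq> T" "half_open J y"
    have finJ: "finite J" using J fin finite_subset by blast
    define b where "b i = mom y' (node_poly (J - {i})) / node_deriv J i" for i
    have "half_open J y \<longleftrightarrow> (\<forall>i\<in>J. b i > 0)"
      unfolding y'_def b_def using J finJ int x e by (intro half_open_iff_perturbed) auto
    moreover have "y' j = (\<Sum>t\<in>J. b t * of_int t ^ j)" if "j < card J" for j
      unfolding b_def by (rule moments_lagrange_power[OF finJ that])
    ultimately show "\<exists>b. (\<forall>t\<in>J. b t > 0) \<and> (\<forall>j<card J. y' j = (\<Sum>t\<in>J. b t * of_int t ^ j))"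
      using J by blast
  next
    fix F assume "F \<subseteq> T"
    then have "e * poly (node_poly F) x > 0" using e(1) x by (intro mult_pos_pos poly_node_poly_pos) auto
    then show "mom y' (node_poly F) < mom y (node_poly F)" by (simp add: y'_def[abs_def] mom_sub_power)
  qed
qed

text \<open>The displaced point is still in the cone, hence not below the facet \<open>K\<close>;
  since the displacement strictly lowered the height over \<open>K\<close>, the point
  \<open>y\<close> itself is strictly above.\<close>

lemma half_open_not_bottom:
  assumes fin: "finite T" and int: "\<And>j. y j \<in> \<int>" and J: "J \<subseteq> T" "card J = Suc c" "half_open J y"
    and K: "K \<in> low T c"
  shows "mom y (node_poly K) > 0"
proof -
  have T: "T \<noteq> {}" using J by auto
  have KT: "K \<subseteq> T" "card K = c" "finite K" using K fin finite_subset by (auto simp: low_def)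
  from half_open_perturbed_measure[OF fin T int] obtain y' where P: "(\<forall>J\<subseteq>T. half_open J y \<longrightarrow>
        (\<exists>b. (\<forall>t\<in>J. b t > 0) \<and> (\<forall>j<card J. y' j = (\<Sum>t\<in>J. b t * of_int t ^ j))))
      \<and> (\<forall>F\<subseteq>T. mom y' (node_poly F) < mom y (node_poly F))" ..
  note y' = P[THEN conjunct1] P[THEN conjunct2]
  obtain b where b: "\<And>t. t \<in> J \<Longrightarrow> b t > 0" "\<And>j. j < Suc c \<Longrightarrow> y' j = (\<Sum>t\<in>J. b t * of_int t ^ j)"
    using y'(1)[rule_format, OF J(1,3)] J(2) by auto
  have "mom y' (node_poly K) = (\<Sum>t\<in>J. b t * poly (node_poly K) (of_int t))"
    using b(2) KT degree_node_poly[of K] by (intro mom_of_measure) auto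
  also have "\<dots> \<ge> 0"
    using b(1) K J(1) by (intro sum_nonneg mult_nonneg_nonneg) (auto simp: low_def less_imp_le)
  finally show ?thesis using y'(2)[rule_format, OF KT(1)] by simp
qed

text \<open>Over the displaced point neither lower facet can be above the other, so their heights
  agree. Then a polynomial that is nonnegative on \<open>T\<close> integrates to zero against
  positive masses on the other facet, and its zeros contain that facet.\<close>

lemma half_open_low_unique:
  assumes fin: "finite T" and int: "\<And>j. y j \<in> \<int>" and c: "c > 0"
    and J: "J \<in> low T c" "half_open J y" and J': "J' \<in> low T c" "half_open J' y"
  shows "J = J'"
proof -
  have JT: "J \<subseteq> T" "card J = c" "finite J" and JT': "J' \<subseteq> T" "card J' = c" "finite J'"
    using J J' fin finite_subset by (auto simp: low_def)
  have T: "T \<noteq> {}" using JT c by auto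
  from half_open_perturbed_measure[OF fin T int] obtain y' where P: "(\<forall>J\<subseteq>T. half_open J y \<longrightarrow>
        (\<exists>b. (\<forall>t\<in>J. b t > 0) \<and> (\<forall>j<card J. y' j = (\<Sum>t\<in>J. b t * of_int t ^ j))))
      \<and> (\<forall>F\<subseteq>T. mom y' (node_poly F) < mom y (node_poly F))" ..
  note y' = P[THEN conjunct1] P[THEN conjunct2]
  obtain b where b: "\<And>t. t \<in> J \<Longrightarrow> b t > 0" "\<And>j. j < c \<Longrightarrow> y' j = (\<Sum>t\<in>J. b t * of_int t ^ j)"
    using y'(1)[rule_format, OF JT(1) J(2)] JT(2) by auto
  obtain b' where b': "\<And>t. t \<in> J' \<Longrightarrow> b' t > 0" "\<And>j. j < c \<Longrightarrow> y' j = (\<Sum>t\<in>J'. b' t * of_int t ^ j)"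
    using y'(1)[rule_format, OF JT'(1) J'(2)] JT'(2) by auto
  have cross: "y' c - mom y' (node_poly J1) \<le> y' c - mom y' (node_poly J2) \<and>
      (mom y' (node_poly J1) = mom y' (node_poly J2) \<longrightarrow> J2 \<subseteq> J1)"
    if J1: "J1 \<in> low T c" and J2: "J2 \<in> low T c" and b2: "\<And>t. t \<in> J2 \<Longrightarrow> b2 t > 0"
      "\<And>j. j < c \<Longrightarrow> y' j = (\<Sum>t\<in>J2. b2 t * of_int t ^ j)" for J1 J2 and b2 :: "int \<Rightarrow> real"
  proof -
    have T1: "J1 \<subseteq> T" "card J1 = c" "finite J1" and T2: "J2 \<subseteq> T" "card J2 = c" "finite J2"
      using J1 J2 fin finite_subset by (auto simp: low_def)
    define z where "z = y' c - mom y' (node_poly J2)"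
    have z: "z = (\<Sum>t\<in>J2. b2 t * of_int t ^ c)"
      using mom_node_poly_measure_eq_0[OF T2(3,2) b2(2)] by (simp add: z_def)
    have "mom (y'(c := z)) (node_poly J1) = (\<Sum>t\<in>J2. b2 t * poly (node_poly J1) (of_int t))"
      using b2(2) z T1 degree_node_poly[of J1] by (intro mom_of_measure) auto
    then have eq: "mom y' (node_poly J1) - mom y' (node_poly J2) = (\<Sum>t\<in>J2. b2 t * poly (node_poly J1) (of_int t))"
      using T1 by (simp add: mom_upd_top z_def)
    have nn: "b2 t * poly (node_poly J1) (of_int t) \<ge> 0" if "t \<in> J2" for t
      using that b2(1)[OF that] J1 T2(1) by (intro mult_nonneg_nonneg) (auto simp: low_def)
    have "(\<Sum>t\<in>J2. b2 t * poly (node_poly J1) (of_int t)) \<ge> 0" using nn by (rule sum_nonneg)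
    moreover have "J2 \<subseteq> J1" if "mom y' (node_poly J1) = mom y' (node_poly J2)"
    proof
      fix t assume t: "t \<in> J2"
      have "(\<Sum>t\<in>J2. b2 t * poly (node_poly J1) (of_int t)) = 0" using eq that by simp
      then have "b2 t * poly (node_poly J1) (of_int t) = 0"
        using sum_nonneg_eq_0_iff[OF T2(3), of "\<lambda>t. b2 t * poly (node_poly J1) (of_int t)"] nn t by simp
      then have "poly (node_poly J1) (of_int t) = 0" using b2(1)[OF t] by simp
      then show "t \<in> J1" using poly_node_poly_eq_0_iff[OF T1(3)] by blast
    qed
    ultimately show ?thesis using eq by auto
  qed
  have "J' \<subseteq> J" using cross[OF J(1) J'(1) b'] cross[OF J'(1) J(1) b] by force
  then show ?thesis using card_subset_eq[OF JT(3)] JT JT' by auto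
qed

section \<open>Counting the lattice points of the dilated cyclic polytope\<close>

definition homogenize :: "nat \<Rightarrow> (nat \<Rightarrow> int) \<Rightarrow> nat \<Rightarrow> real" where
  "homogenize m x j = (if j = 0 then real m else of_int (x j))"

lemma homogenize_Ints: "homogenize m x j \<in> \<int>"
  by (simp add: homogenize_def)

text \<open>Extensional functions give every point one representative. Moments of order above
  \<open>d\<close> come from \<open>undefined\<close>: they are integers like the others, and
  \<open>in_cone T (Suc d)\<close> does not look at them.\<close>

definition closed_points :: "int set \<Rightarrow> nat \<Rightarrow> nat \<Rightarrow> (nat \<Rightarrow> int) set" where
  "closed_points T m d = {x \<in> {1..d} \<rightarrow>\<^sub>E UNIV. in_cone T (Suc d) (homogenize m x)}"

definition half_open_points :: "int set \<Rightarrow> nat \<Rightarrow> nat \<Rightarrow> (nat \<Rightarrow> int) set" where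
  "half_open_points J m d = {x \<in> {1..d} \<rightarrow>\<^sub>E UNIV. half_open J (homogenize m x)}"

lemma finite_closed_points:
  assumes "finite T"
  shows "finite (closed_points T m d)"
proof -
  define M where "M = Max (insert 1 ((\<lambda>t. \<bar>real_of_int t\<bar>) ` T))"
  have M: "\<bar>real_of_int t\<bar> \<le> M" if "t \<in> T" for t
    unfolding M_def using assms that by (intro Max_ge) auto
  define B where "B j = \<lceil>real m * M ^ j\<rceil>" for j
  have "closed_points T m d \<subseteq> (\<Pi>\<^sub>E j\<in>{1..d}. {- B j..B j})"
  proof
    fix x assume x: "x \<in> closed_points T m d"
    then obtain a where a: "\<And>t. t \<in> T \<Longrightarrow> a t \<ge> 0"
      "\<And>j. j < Suc d \<Longrightarrow> homogenize m x j = (\<Sum>t\<in>T. a t * of_int t ^ j)"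
      by (auto simp: closed_points_def in_cone_def)
    have "x j \<in> {- B j..B j}" if j: "j \<in> {1..d}" for j
    proof -
      have "\<bar>\<Sum>t\<in>T. a t * of_int t ^ j\<bar> \<le> (\<Sum>t\<in>T. a t) * M ^ j"
        using a(1) M by (intro measure_bound) auto
      moreover have "(\<Sum>t\<in>T. a t) = real m" using a(2)[of 0] by (simp add: homogenize_def)
      moreover have "(\<Sum>t\<in>T. a t * of_int t ^ j) = of_int (x j)"
        using a(2)[of j] j by (simp add: homogenize_def)
      ultimately have "\<bar>real_of_int (x j)\<bar> \<le> real m * M ^ j" by simp
      then have "\<bar>real_of_int (x j)\<bar> \<le> of_int (B j)" unfolding B_def by linarith
      then show ?thesis by simp linarith
    qed
    then show "x \<in> (\<Pi>\<^sub>E j\<in>{1..d}. {- B j..B j})" using x by (auto simp: closed_points_def PiE_iff)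
  qed
  then show ?thesis by (rule finite_subset) (auto intro: finite_PiE)
qed

lemma half_open_points_subset:
  assumes "finite T" and "J \<subseteq> T" and "card J = Suc d"
  shows "half_open_points J m d \<subseteq> closed_points T m d"
  using half_open_in_cone[OF assms(1,2)] assms(3) by (auto simp: half_open_points_def closed_points_def)

lemma card_closed_points_Suc:
  assumes fin: "finite T" and d: "Suc (Suc d) \<le> card T"
  shows "card (closed_points T m (Suc d)) = card (closed_points T m d)
    + (\<Sum>J\<in>low T (Suc (Suc d)). card (half_open_points J m (Suc d)))"
proof -
  define KK where "KK x = (SOME K. K \<in> low T (Suc d) \<and> in_cone K (Suc d) (homogenize m x))" for x
  have KK: "KK x \<in> low T (Suc d)" "in_cone (KK x) (Suc d) (homogenize m x)"
    if "in_cone T (Suc d) (homogenize m x)" for x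
  proof -
    have "\<exists>K. K \<in> low T (Suc d) \<and> in_cone K (Suc d) (homogenize m x)"
      using in_cone_low[OF fin _ that] d by auto
    then show "KK x \<in> low T (Suc d)" "in_cone (KK x) (Suc d) (homogenize m x)"
      unfolding KK_def by (metis (mono_tags, lifting) someI)+
  qed
  \<comment> \<open>The height of the facet \<open>KK x\<close> over \<open>x\<close>. The last
    coordinate, which is \<open>undefined\<close> for the points to be lifted, cancels because the
    polynomial is monic; the floor is only a change of type.\<close>
  define bot where "bot x = \<lfloor>homogenize m x (Suc d) - mom (homogenize m x) (node_poly (KK x))\<rfloor>" for x
  define lift where "lift x = x(Suc d := bot x)" for x
  have hom_upd: "homogenize m (x(Suc d := z)) = (homogenize m x)(Suc d := of_int z)" for x z
    by (auto simp: homogenize_def fun_eq_iff)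
  have finlow: "finite K" "card K = c" "K \<subseteq> T" if "K \<in> low T c" for K c
    using that fin finite_subset by (auto simp: low_def)
  have bot: "of_int (bot x) = homogenize m x (Suc d) - mom (homogenize m x) (node_poly (KK x))"
    if "in_cone T (Suc d) (homogenize m x)" for x
    unfolding bot_def using finlow[OF KK(1)[OF that]] homogenize_Ints mom_node_poly_Ints
    by (intro of_int_floor Ints_diff) auto
  have prefix: "in_cone T (Suc d) (homogenize m (x(Suc d := z))) \<longleftrightarrow> in_cone T (Suc d) (homogenize m x)" for x z
    unfolding hom_upd by (intro in_cone_cong) auto
  have lift0: "mom (homogenize m (lift x)) (node_poly (KK x)) = 0" if "in_cone T (Suc d) (homogenize m x)" for x
    unfolding lift_def hom_upd using finlow[OF KK(1)[OF that]] bot[OF that] by (simp add: mom_upd_top)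
  have lift_mem: "in_cone T (Suc (Suc d)) (homogenize m (lift x))" if x: "in_cone T (Suc d) (homogenize m x)" for x
  proof -
    have "in_cone (KK x) (Suc d) (homogenize m (lift x))"
      using KK(2)[OF x] unfolding lift_def hom_upd by (subst in_cone_cong[of _ _ "homogenize m x"]) auto
    then have "in_cone (KK x) (Suc (Suc d)) (homogenize m (lift x))"
      using finlow[OF KK(1)[OF x]] lift0[OF x] by (intro in_cone_bottom[of _ "Suc d"])
    then show ?thesis using in_cone_mono[OF fin finlow(3)[OF KK(1)[OF x]]] by blast
  qed
  have ext: "x \<in> {1..d} \<rightarrow>\<^sub>E (UNIV :: int set) \<Longrightarrow> x(Suc d := z) \<in> {1..Suc d} \<rightarrow>\<^sub>E UNIV" for x z
    by (auto simp: PiE_iff extensional_def)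
  define U where "U = (\<Union>J\<in>low T (Suc (Suc d)). half_open_points J m (Suc d))"
  have decomp: "closed_points T m (Suc d) = lift ` closed_points T m d \<union> U"
  proof (intro equalityI subsetI)
    fix w assume w: "w \<in> closed_points T m (Suc d)"
    then have wc: "w \<in> {1..Suc d} \<rightarrow>\<^sub>E UNIV" "in_cone T (Suc (Suc d)) (homogenize m w)"
      by (auto simp: closed_points_def)
    define x where "x = w(Suc d := undefined)"
    have wx: "w = x(Suc d := w (Suc d))" by (simp add: x_def)
    have xE: "x \<in> {1..d} \<rightarrow>\<^sub>E UNIV" using wc(1) by (auto simp: x_def PiE_iff extensional_def)
    have "in_cone T (Suc d) (homogenize m w)" using wc(2) by (auto simp: in_cone_def)
    then have xc: "in_cone T (Suc d) (homogenize m x)" using prefix[of x "w (Suc d)"] wx by simp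
    note K = KK[OF xc]
    have Kw: "in_cone (KK x) (Suc d) (homogenize m w)"
      using K(2) by (subst wx, subst hom_upd, subst in_cone_cong[of _ _ "homogenize m x"]) auto
    have nn: "mom (homogenize m w) (node_poly (KK x)) \<ge> 0" by (rule mom_low_nonneg[OF fin K(1) wc(2)])
    show "w \<in> lift ` closed_points T m d \<union> U"
    proof (cases "mom (homogenize m w) (node_poly (KK x)) = 0")
      case True
      have "mom (homogenize m w) (node_poly (KK x))
          = mom (homogenize m x) (node_poly (KK x)) + of_int (w (Suc d)) - homogenize m x (Suc d)"
        using finlow[OF K(1)] by (subst wx, subst hom_upd) (simp add: mom_upd_top)
      then have "w (Suc d) = bot x" using True bot[OF xc] by linarith
      then have "w = lift x" using wx by (simp add: lift_def)
      then show ?thesis using xE xc by (auto simp: closed_points_def)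
    next
      case False
      then have "\<exists>J\<in>low T (Suc (Suc d)). half_open J (homogenize m w)"
        using nn d by (intro above_bottom_half_open[OF fin _ homogenize_Ints K(1) Kw wc(2)]) auto
      then show ?thesis using wc(1) by (auto simp: U_def half_open_points_def)
    qed
  next
    fix w assume "w \<in> lift ` closed_points T m d \<union> U"
    then show "w \<in> closed_points T m (Suc d)"
    proof
      assume "w \<in> lift ` closed_points T m d"
      then obtain x where x: "x \<in> {1..d} \<rightarrow>\<^sub>E UNIV" "in_cone T (Suc d) (homogenize m x)" "w = lift x"
        by (auto simp: closed_points_def)
      then show ?thesis using lift_mem[OF x(2)] ext[OF x(1)] by (auto simp: closed_points_def lift_def)
    next
      assume "w \<in> U"
      then obtain J where J: "J \<in> low T (Suc (Suc d))" "w \<in> half_open_points J m (Suc d)"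
        by (auto simp: U_def)
      then show ?thesis using half_open_points_subset[OF fin finlow(3,2)[OF J(1)]] by blast
    qed
  qed
  have disj: "lift ` closed_points T m d \<inter> U = {}"
  proof (rule ccontr)
    assume "lift ` closed_points T m d \<inter> U \<noteq> {}"
    then obtain x J where x: "in_cone T (Suc d) (homogenize m x)" and J: "J \<in> low T (Suc (Suc d))"
      "half_open J (homogenize m (lift x))"
      by (auto simp: closed_points_def U_def half_open_points_def)
    have "mom (homogenize m (lift x)) (node_poly (KK x)) > 0"
      using half_open_not_bottom[OF fin homogenize_Ints finlow(3,2)[OF J(1)] J(2) KK(1)[OF x]] .
    then show False using lift0[OF x] by simp
  qed
  have inj: "inj_on lift (closed_points T m d)"
  proof (rule inj_onI)
    fix x x' assume xx: "x \<in> closed_points T m d" "x' \<in> closed_points T m d" "lift x = lift x'"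
    show "x = x'"
    proof (rule PiE_ext[of _ "{1..d}" "\<lambda>_. UNIV"])
      fix i assume "i \<in> {1..d}"
      then show "x i = x' i" using fun_cong[OF xx(3), of i] by (simp add: lift_def)
    qed (use xx in \<open>auto simp: closed_points_def\<close>)
  qed
  have finU: "finite U"
    using finite_subset[of U "closed_points T m (Suc d)"] finite_closed_points[OF fin] decomp by blast
  have "card (closed_points T m (Suc d)) = card (lift ` closed_points T m d) + card U"
    unfolding decomp using finite_closed_points[OF fin] finU disj by (intro card_Un_disjoint) auto
  also have "card (lift ` closed_points T m d) = card (closed_points T m d)"
    by (rule card_image[OF inj])
  also have "card U = (\<Sum>J\<in>low T (Suc (Suc d)). card (half_open_points J m (Suc d)))"
    unfolding U_def
  proof (rule card_UN_disjoint)
    show "finite (low T (Suc (Suc d)))" using finite_low[OF fin] .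
    show "\<forall>J\<in>low T (Suc (Suc d)). finite (half_open_points J m (Suc d))"
    proof
      fix J assume "J \<in> low T (Suc (Suc d))"
      from half_open_points_subset[OF fin finlow(3,2)[OF this]] finite_closed_points[OF fin]
      show "finite (half_open_points J m (Suc d))" by (rule finite_subset)
    qed
    show "\<forall>J\<in>low T (Suc (Suc d)). \<forall>J'\<in>low T (Suc (Suc d)). J \<noteq> J' \<longrightarrow>
        half_open_points J m (Suc d) \<inter> half_open_points J' m (Suc d) = {}"
    proof (intro ballI impI)
      fix J J' assume J: "J \<in> low T (Suc (Suc d))" "J' \<in> low T (Suc (Suc d))" "J \<noteq> J'"
      have "\<not> (half_open J (homogenize m x) \<and> half_open J' (homogenize m x))" for x
        using half_open_low_unique[of T "homogenize m x" "Suc (Suc d)" J J'] fin homogenize_Ints J by blast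
      then show "half_open_points J m (Suc d) \<inter> half_open_points J' m (Suc d) = {}"
        unfolding half_open_points_def by blast
    qed
  qed
  finally show ?thesis .
qed

lemma card_closed_points_0:
  assumes fin: "finite T" and "T \<noteq> {}"
  shows "card (closed_points T m 0) = 1"
proof -
  have "in_cone T (Suc 0) (homogenize m x)" for x
    unfolding in_cone_def
    using assms by (intro exI[of _ "\<lambda>t. real m / card T"]) (auto simp: homogenize_def)
  then have "closed_points T m 0 = {\<lambda>_. undefined}" by (auto simp: closed_points_def)
  then show ?thesis by simp
qed

lemma box_count_card:
  assumes "r \<le> d"
  shows "box_count K d B r y =
    real (card {x \<in> {d - r<..d} \<rightarrow>\<^sub>E {- B..B}. half_open K (\<lambda>j. if j \<in> {d - r<..d} then of_int (x j) else y j)})"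
  using assms
proof (induction r arbitrary: y)
  case 0
  have "{x \<in> {d<..d} \<rightarrow>\<^sub>E {- B..B}. half_open K (\<lambda>j. if j \<in> {d<..d} then of_int (x j) else y j)}
      = (if half_open K y then {\<lambda>_. undefined} else {})" by auto
  then show ?case by simp
next
  case (Suc r)
  define c where "c = d - r"
  have I: "{d - Suc r<..d} = insert c {c<..d}" "c \<notin> {c<..d}" using Suc.prems by (auto simp: c_def)
  define A where "A z = {x \<in> {c<..d} \<rightarrow>\<^sub>E {- B..B}. half_open K (\<lambda>j. if j \<in> {c<..d} then of_int (x j) else (y(c := of_int z)) j)}" for z
  have finA: "finite (A z)" for z
    unfolding A_def by (rule finite_subset[of _ "{c<..d} \<rightarrow>\<^sub>E {- B..B}"]) (auto intro: finite_PiE)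
  have "bij_betw (\<lambda>(z, x). x(c := z)) (Sigma {-B..B} A)
    {x \<in> {d - Suc r<..d} \<rightarrow>\<^sub>E {- B..B}. half_open K (\<lambda>j. if j \<in> {d - Suc r<..d} then of_int (x j) else y j)}"
    (is "bij_betw ?f _ ?R")
  proof (rule bij_betw_imageI)
    show "inj_on ?f (Sigma {-B..B} A)"
    proof (rule inj_on_subset)
      show "inj_on ?f ({-B..B} \<times> ({c<..d} \<rightarrow>\<^sub>E {-B..B}))"
        using inj_combinator[OF I(2), of "\<lambda>_. {-B..B}"] by simp
      show "Sigma {-B..B} A \<subseteq> {-B..B} \<times> ({c<..d} \<rightarrow>\<^sub>E {-B..B})" unfolding A_def by blast
    qed
    have eq: "(\<lambda>j. if j \<in> {d - Suc r<..d} then of_int ((x(c := z)) j) else y j)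
        = (\<lambda>j. if j \<in> {c<..d} then of_int (x j) else (y(c := of_int z)) j)" for x z
      unfolding I(1) by (auto simp: fun_eq_iff)
    have P: "({d - Suc r<..d} \<rightarrow>\<^sub>E {- B..B}) = ?f ` ({-B..B} \<times> ({c<..d} \<rightarrow>\<^sub>E {- B..B}))"
      unfolding I(1) by (subst PiE_insert_eq) simp
    show "?f ` Sigma {-B..B} A = ?R"
    proof (intro equalityI subsetI)
      fix w assume "w \<in> ?f ` Sigma {-B..B} A"
      then obtain z x where "z \<in> {-B..B}" "x \<in> A z" "w = x(c := z)" by auto
      then show "w \<in> ?R" unfolding P mem_Collect_eq by (simp only: eq) (auto simp: A_def)
    next
      fix w assume w: "w \<in> ?R"
      then obtain z x where zx: "z \<in> {-B..B}" "x \<in> {c<..d} \<rightarrow>\<^sub>E {- B..B}" "w = x(c := z)"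
        unfolding P by auto
      then have "x \<in> A z" using w unfolding mem_Collect_eq zx(3) eq by (simp add: A_def)
      then show "w \<in> ?f ` Sigma {-B..B} A" using zx by force
    qed
  qed
  then have "card ?R = card (Sigma {-B..B} A)" by (rule bij_betw_same_card[symmetric])
  also have "\<dots> = (\<Sum>z\<in>{-B..B}. card (A z))" using finA by (intro card_SigmaI) auto
  finally have cardR: "card ?R = (\<Sum>z\<in>{-B..B}. card (A z))" .
  have "box_count K d B (Suc r) y = (\<Sum>z\<in>{-B..B}. real (card (A z)))"
    unfolding box_count.simps A_def c_def using Suc by (intro sum.cong refl) auto
  then show ?case using cardR by simp
qed

lemma card_half_open_points:
  assumes fin: "finite J" and card: "card J = Suc d" and m: "m > 0"
  shows "real (card (half_open_points J m d)) = vandermonde J * real m ^ d / fact d"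
proof -
  define M where "M = Max (insert 1 ((\<lambda>t. \<bar>real_of_int t\<bar>) ` J))"
  have M: "\<bar>real_of_int t\<bar> \<le> M" if "t \<in> J" for t
    unfolding M_def using fin that by (intro Max_ge) auto
  have M1: "M \<ge> 1" unfolding M_def using fin by (intro Max_ge) auto
  define B where "B = \<lceil>real m * M ^ d\<rceil>"
  \<comment> \<open>Coordinates 1 to \<open>d\<close> are all overwritten by the count;
    \<open>y 0\<close> fixes the dilation.\<close>
  define y where "y j = (if j = 0 then real m else 0)" for j :: nat
  have hom: "(\<lambda>j. if j \<in> {0<..d} then of_int (x j) else y j) j = homogenize m x j" if "j \<le> d" for x :: "nat \<Rightarrow> int" and j
    using that by (auto simp: homogenize_def y_def)
  have ho: "half_open J (\<lambda>j. if j \<in> {0<..d} then of_int (x j) else y j) \<longleftrightarrow> half_open J (homogenize m x)"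
    for x :: "nat \<Rightarrow> int"
    using hom card by (intro half_open_cong[OF fin]) auto
  have "x j \<in> {-B..B}"
    if x: "x \<in> {1..d} \<rightarrow>\<^sub>E UNIV" "half_open J (homogenize m x)" and j: "j \<in> {1..d}" for x j
  proof -
    have "\<bar>homogenize m x j\<bar> \<le> homogenize m x 0 * M ^ j"
      using x j card M by (intro half_open_bound[OF fin]) auto
    then have "\<bar>real_of_int (x j)\<bar> \<le> real m * M ^ j" using j by (simp add: homogenize_def)
    also have "\<dots> \<le> real m * M ^ d"
      using M1 j by (intro mult_left_mono power_increasing) auto
    finally have "\<bar>real_of_int (x j)\<bar> \<le> of_int B" unfolding B_def by linarith
    then show ?thesis by simp linarith
  qed
  then have "half_open_points J m d = {x \<in> {1..d} \<rightarrow>\<^sub>E {- B..B}. half_open J (homogenize m x)}"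
    unfolding half_open_points_def PiE_iff by blast
  moreover have "{1..d} = {0<..d}" by auto
  ultimately have "half_open_points J m d = {x \<in> {0<..d} \<rightarrow>\<^sub>E {- B..B}. half_open J (homogenize m x)}"
    by simp
  then have "real (card (half_open_points J m d)) = box_count J d B d y"
    by (simp only: box_count_card[OF le_refl] diff_self_eq_0 ho)
  also have "\<dots> = vandermonde J * y 0 ^ d / fact d"
    using fin card M M1 m by (intro box_count_full) (auto simp: y_def B_def)
  finally show ?thesis by (simp add: y_def)
qed

lemma card_closed_points:
  assumes fin: "finite T" and d: "Suc d \<le> card T" and m: "m > 0"
  shows "real (card (closed_points T m d)) =
    1 + (\<Sum>k\<in>{1..d}. real m ^ k * (\<Sum>J\<in>low T (Suc k). vandermonde J / fact k))"
  using d
proof (induction d)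
  case 0
  then have "T \<noteq> {}" by auto
  then show ?case using card_closed_points_0[OF fin] by simp
next
  case (Suc d)
  have "real (card (half_open_points J m (Suc d))) = real m ^ Suc d * (vandermonde J / fact (Suc d))"
    if "J \<in> low T (Suc (Suc d))" for J
    using that fin finite_subset m by (subst card_half_open_points) (auto simp: low_def)
  then show ?case using Suc card_closed_points_Suc[OF fin Suc.prems, of m]
    by (simp add: sum_distrib_left del: power_Suc fact_Suc)
qed

section \<open>Interlacing sums\<close>

text \<open>For a descending list: the sum of Vandermonde products, with weight \<open>w\<close> on
  each entry, over the integer sequences that interlace the list. Choosing the largest entry
  \<open>x\<close> first puts the factor \<open>x - s\<close> into the weight of every later
  \<open>s\<close>.\<close>

fun interlace :: "int list \<Rightarrow> (int \<Rightarrow> real) \<Rightarrow> real" where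
  "interlace (b # a # js) w = (\<Sum>x\<in>{a..<b}. w x * interlace (a # js) (\<lambda>s. w s * of_int (x - s)))"
| "interlace [a] w = 1"
| "interlace [] w = 1"

text \<open>The same weighted sum over \<open>k\<close> integers from \<open>k\<close> distinct
  intervals among the first \<open>n\<close>. The recursion asks whether the last interval is
  used.\<close>

fun gap_sum :: "(nat \<Rightarrow> int) \<Rightarrow> nat \<Rightarrow> nat \<Rightarrow> (int \<Rightarrow> real) \<Rightarrow> real" where
  "gap_sum t n 0 w = 1"
| "gap_sum t 0 (Suc k) w = 0"
| "gap_sum t (Suc n) (Suc k) w = gap_sum t n (Suc k) w +
    (\<Sum>x\<in>{t n..<t (Suc n)}. w x * gap_sum t n k (\<lambda>s. w s * of_int (x - s)))"

definition desc :: "int set \<Rightarrow> int list" where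
  "desc J = rev (sorted_list_of_set J)"

lemma desc_empty: "desc {} = []"
  by (simp add: desc_def)

lemma desc_singleton: "desc {a} = [a]"
  by (simp add: desc_def)

lemma desc_insert:
  assumes "finite J" and "\<And>x. x \<in> J \<Longrightarrow> x < b"
  shows "desc (insert b J) = b # desc J"
proof -
  define xs where "xs = sorted_list_of_set J @ [b]"
  have "sorted xs" "distinct xs" using assms by (auto simp: xs_def sorted_append less_imp_le)
  moreover have "set xs = insert b J" using assms by (auto simp: xs_def)
  ultimately have "sorted_list_of_set (insert b J) = xs"
    using sorted_list_of_set.idem_if_sorted_distinct by metis
  then show ?thesis by (simp add: desc_def xs_def)
qed

lemma low_0: "low T 0 = {{}}" if "finite T"
proof -
  have "K = {}" if "K \<subseteq> T" "card K = 0" for K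
    using that \<open>finite T\<close> finite_subset card_0_eq by blast
  then show ?thesis by (auto simp: low_def node_poly_def)
qed

lemma low_1:
  assumes "finite T" and "a \<in> T" and "\<And>x. x \<in> T \<Longrightarrow> a \<le> x"
  shows "low T (Suc 0) = {{a}}"
proof (intro equalityI subsetI)
  fix K assume K: "K \<in> low T (Suc 0)"
  then obtain k where k: "K = {k}" "k \<in> T" by (auto simp: low_def card_Suc_eq)
  then have "of_int a - of_int k \<ge> (0::real)" using K assms(2) by (auto simp: low_def poly_node_poly)
  then have "k = a" using assms(3)[OF k(2)] by simp
  then show "K \<in> {{a}}" using k by simp
qed (use assms in \<open>auto simp: low_def poly_node_poly\<close>)

lemma low_card: "finite T \<Longrightarrow> card T < c \<Longrightarrow> low T c = {}"
  unfolding low_def using card_mono[of T] leD by blast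

text \<open>Raising the first entry only lengthens the topmost interval of summation. That interval
  is empty to begin with if \<open>b\<close> is the largest element of \<open>J\<close>.\<close>

lemma interlace_split:
  assumes "finite J" and "J \<noteq> {}" and "\<And>x. x \<in> J \<Longrightarrow> x \<le> b" and "b \<le> b'"
  shows "interlace (b' # desc J) w = interlace (b # desc J) w
    + (\<Sum>x\<in>{b..<b'}. w x * interlace (desc J) (\<lambda>s. w s * of_int (x - s)))"
proof -
  define a where "a = Max J"
  have a: "a \<in> J" "\<And>x. x \<in> J - {a} \<Longrightarrow> x < a"
    using Max_in[OF assms(1,2)] Max_ge[OF assms(1)] by (auto simp: a_def order_less_le)
  have "insert a (J - {a}) = J" using a by auto
  then have d: "desc J = a # desc (J - {a})"
    using desc_insert[of "J - {a}" a] assms(1) a by simp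
  have "a \<le> b" using assms(3) a(1) by blast
  then have "{a..<b'} = {a..<b} \<union> {b..<b'}" using assms(4) by auto
  moreover have "{a..<b} \<inter> {b..<b'} = {}" by auto
  ultimately show ?thesis unfolding d by (simp add: sum.union_disjoint)
qed

text \<open>The recursion for lower facets matches that of \<open>gap_sum\<close>. A facet
  containing the largest point also contains the one before, so its interlacing sum takes
  \<open>x\<close> from the last interval and leaves a list headed by \<open>t n\<close> over a
  facet with two nodes fewer. The second claim evaluates exactly such lists and is carried along in
  the induction.\<close>

lemma low_interlace_sums:
  assumes "\<And>i. i < n \<Longrightarrow> t i < t (Suc i)"
  shows "(\<forall>k w. (\<Sum>J\<in>low (t ` {..n}) (Suc k). interlace (desc J) w) = gap_sum t n k w)
    \<and> (\<forall>k w. (\<Sum>J\<in>low (t ` {..<n}) (Suc k). interlace (t n # desc J) w) = gap_sum t n (Suc k) w)"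
  using assms
proof (induction n)
  case 0
  have "(\<Sum>J\<in>low (t ` {..0}) (Suc k). interlace (desc J) w) = gap_sum t 0 k w" for k w
  proof (cases k)
    case 0
    have "low {t 0} (Suc 0) = {{t 0}}" by (rule low_1) auto
    then show ?thesis using 0 by (simp add: desc_singleton)
  next
    case (Suc k')
    then show ?thesis using low_card[of "{t 0}" "Suc k"] by simp
  qed
  moreover have "low {} (Suc k) = {}" for k by (rule low_card) auto
  ultimately show ?case by simp
next
  case (Suc n)
  have A: "(\<Sum>J\<in>low (t ` {..n}) (Suc k). interlace (desc J) w) = gap_sum t n k w" for k w
    using Suc by simp
  have B: "(\<Sum>J\<in>low (t ` {..<n}) (Suc k). interlace (t n # desc J) w) = gap_sum t n (Suc k) w" for k w
    using Suc by simp
  have mono: "t i < t j" if "i < j" "j \<le> Suc n" for i j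
    using that
  proof (induction j)
    case (Suc j)
    then show ?case using Suc.prems(2) \<open>\<And>i. i < Suc n \<Longrightarrow> t i < t (Suc i)\<close>[of j]
      by (cases "i = j") auto
  qed simp
  define T where "T = t ` {..<n}"
  have T: "finite T" "\<And>x. x \<in> T \<Longrightarrow> x < t n" "t n < t (Suc n)" using mono by (auto simp: T_def)
  have sets: "t ` {..n} = insert (t n) T" "t ` {..<Suc n} = insert (t n) T"
    "t ` {..Suc n} = insert (t (Suc n)) (insert (t n) T)"
    by (simp_all add: T_def atMost_Suc lessThan_Suc flip: lessThan_Suc_atMost)
  have sub: "finite J" "\<And>x. x \<in> J \<Longrightarrow> x < t n" if "J \<in> low T c" for J c
    using that T finite_subset by (auto simp: low_def)
  have "(\<Sum>J\<in>low (t ` {..Suc n}) (Suc k). interlace (desc J) w) = gap_sum t (Suc n) k w" for k w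
  proof (cases k)
    case 0
    have "low (t ` {..Suc n}) (Suc 0) = {{t 0}}"
    proof (rule low_1)
      fix x assume "x \<in> t ` {..Suc n}"
      then obtain i where "x = t i" "i \<le> Suc n" by auto
      then show "t 0 \<le> x" using mono[of 0 i] by (cases "i = 0") auto
    qed auto
    then show ?thesis using 0 by (simp add: desc_singleton)
  next
    case (Suc k')
    have low_eq: "low (t ` {..Suc n}) (Suc (Suc k')) = low (insert (t n) T) (Suc (Suc k'))
        \<union> (\<lambda>K. insert (t (Suc n)) (insert (t n) K)) ` low T k'"
      unfolding sets(3) by (rule low_insert_insert[OF T])
    have "(\<Sum>J\<in>low (t ` {..Suc n}) (Suc (Suc k')). interlace (desc J) w)
      = (\<Sum>J\<in>low (insert (t n) T) (Suc (Suc k')). interlace (desc J) w)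
        + (\<Sum>J\<in>(\<lambda>K. insert (t (Suc n)) (insert (t n) K)) ` low T k'. interlace (desc J) w)"
      unfolding low_eq
    proof (rule sum.union_disjoint)
      show "low (insert (t n) T) (Suc (Suc k')) \<inter> (\<lambda>K. insert (t (Suc n)) (insert (t n) K)) ` low T k' = {}"
        using T by (fastforce simp: low_def)
    qed (use T finite_low in auto)
    also have "(\<Sum>J\<in>(\<lambda>K. insert (t (Suc n)) (insert (t n) K)) ` low T k'. interlace (desc J) w)
      = (\<Sum>J\<in>low T k'. interlace (t (Suc n) # t n # desc J) w)"
    proof (subst sum.reindex)
      show "inj_on (\<lambda>K. insert (t (Suc n)) (insert (t n) K)) (low T k')"
      proof (rule inj_onI)
        fix K L assume KL: "K \<in> low T k'" "L \<in> low T k'"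
          "insert (t (Suc n)) (insert (t n) K) = insert (t (Suc n)) (insert (t n) L)"
        have "t n \<notin> K" "t (Suc n) \<notin> K" "t n \<notin> L" "t (Suc n) \<notin> L"
          using sub[OF KL(1)] sub[OF KL(2)] T(3) by force+
        then have "K = insert (t (Suc n)) (insert (t n) K) - {t n, t (Suc n)}"
          "L = insert (t (Suc n)) (insert (t n) L) - {t n, t (Suc n)}" by auto
        then show "K = L" using KL(3) by simp
      qed
      show "sum ((\<lambda>J. interlace (desc J) w) \<circ> (\<lambda>K. insert (t (Suc n)) (insert (t n) K))) (low T k')
        = (\<Sum>J\<in>low T k'. interlace (t (Suc n) # t n # desc J) w)"
      proof (rule sum.cong)
        fix J assume J: "J \<in> low T k'"
        have "desc (insert (t (Suc n)) (insert (t n) J)) = t (Suc n) # desc (insert (t n) J)"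
          using sub[OF J] T(3) by (intro desc_insert) force+
        also have "desc (insert (t n) J) = t n # desc J" using sub[OF J] by (intro desc_insert) auto
        finally show "((\<lambda>J. interlace (desc J) w) \<circ> (\<lambda>K. insert (t (Suc n)) (insert (t n) K))) J
          = interlace (t (Suc n) # t n # desc J) w" by simp
      qed simp
    qed
    also have "\<dots> = (\<Sum>x\<in>{t n..<t (Suc n)}. w x *
        (\<Sum>J\<in>low T k'. interlace (t n # desc J) (\<lambda>s. w s * of_int (x - s))))"
      unfolding interlace.simps by (subst sum.swap) (simp only: sum_distrib_left)
    also have "\<dots> = (\<Sum>x\<in>{t n..<t (Suc n)}. w x * gap_sum t n k' (\<lambda>s. w s * of_int (x - s)))"
    proof (intro sum.cong refl arg_cong2[of _ _ _ _ "(*)"])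
      fix x
      show "(\<Sum>J\<in>low T k'. interlace (t n # desc J) (\<lambda>s. w s * of_int (x - s)))
        = gap_sum t n k' (\<lambda>s. w s * of_int (x - s))"
      proof (cases k')
        case 0
        then show ?thesis using low_0[OF T(1)] by (simp add: desc_empty)
      qed (simp only: T_def B)
    qed
    also have "(\<Sum>J\<in>low (insert (t n) T) (Suc (Suc k')). interlace (desc J) w) = gap_sum t n (Suc k') w"
      using A[where k = "Suc k'" and w = w] sets(1) by simp
    finally show ?thesis using Suc by simp
  qed
  moreover have "(\<Sum>J\<in>low (t ` {..<Suc n}) (Suc k). interlace (t (Suc n) # desc J) w) = gap_sum t (Suc n) (Suc k) w"
    for k w
  proof -
    have split: "interlace (t (Suc n) # desc J) w = interlace (t n # desc J) w
      + (\<Sum>x\<in>{t n..<t (Suc n)}. w x * interlace (desc J) (\<lambda>s. w s * of_int (x - s)))"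
      if J: "J \<in> low (insert (t n) T) (Suc k)" for J
    proof (rule interlace_split)
      have J': "J \<subseteq> insert (t n) T" "card J = Suc k" using J by (auto simp: low_def)
      show "finite J" "J \<noteq> {}" using J' T(1) by (auto intro: finite_subset card_ge_0_finite)
      show "x \<le> t n" if "x \<in> J" for x using that J'(1) T(2) by fastforce
    qed (use T in auto)
    have fin: "finite (low (insert (t n) T) (Suc k))" using T finite_low by auto
    have "(\<Sum>J\<in>low (insert (t n) T) (Suc k). interlace (t n # desc J) w)
      = (\<Sum>J\<in>low T (Suc k). interlace (t n # desc J) w)"
    proof (rule sum.mono_neutral_right[OF fin])
      show "low T (Suc k) \<subseteq> low (insert (t n) T) (Suc k)"
        using low_insert_notin[OF T(1,2), of "Suc k"] by blast
      \<comment> \<open>If \<open>t n\<close> belongs to \<open>J\<close>, it heads the list twice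
        and the topmost interval is empty.\<close>
      show "\<forall>J\<in>low (insert (t n) T) (Suc k) - low T (Suc k). interlace (t n # desc J) w = 0"
      proof
        fix J assume J: "J \<in> low (insert (t n) T) (Suc k) - low T (Suc k)"
        then have "t n \<in> J" using low_insert_notin[OF T(1,2), of "Suc k"] by blast
        define L where "L = J - {t n}"
        have L: "J = insert (t n) L" "finite L" "\<And>x. x \<in> L \<Longrightarrow> x < t n"
          using J T \<open>t n \<in> J\<close> finite_subset[of J "insert (t n) T"] by (auto simp: L_def low_def)
        then show "interlace (t n # desc J) w = 0" by (simp add: desc_insert)
      qed
    qed
    also have "\<dots> = gap_sum t n (Suc k) w" using B by (simp add: T_def)
    finally have 1: "(\<Sum>J\<in>low (insert (t n) T) (Suc k). interlace (t n # desc J) w) = gap_sum t n (Suc k) w" .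
    have "(\<Sum>J\<in>low (insert (t n) T) (Suc k). \<Sum>x\<in>{t n..<t (Suc n)}. w x * interlace (desc J) (\<lambda>s. w s * of_int (x - s)))
      = (\<Sum>x\<in>{t n..<t (Suc n)}. w x * (\<Sum>J\<in>low (insert (t n) T) (Suc k). interlace (desc J) (\<lambda>s. w s * of_int (x - s))))"
      by (subst sum.swap) (simp only: sum_distrib_left)
    also have "\<dots> = (\<Sum>x\<in>{t n..<t (Suc n)}. w x * gap_sum t n k (\<lambda>s. w s * of_int (x - s)))"
      using A sets(1) by simp
    finally show ?thesis unfolding sets(2) using split 1 by (simp add: sum.distrib)
  qed
  ultimately show ?case by blast
qed

lemma sum_PiE_insert:
  assumes "a \<notin> I"
  shows "(\<Sum>s\<in>PiE (insert a I) X. f s) = (\<Sum>x\<in>X a. \<Sum>s\<in>PiE I X. f (s(a := x)))"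
proof -
  have "(\<Sum>s\<in>PiE (insert a I) X. f s) = (\<Sum>(x, s)\<in>X a \<times> PiE I X. f (s(a := x)))"
    unfolding PiE_insert_eq using inj_combinator[OF assms, of X]
    by (subst sum.reindex) (auto simp: case_prod_unfold)
  then show ?thesis by (simp add: sum.cartesian_product)
qed

section \<open>Vandermonde products summed over interlacing integers\<close>

definition vdm :: "nat \<Rightarrow> (nat \<Rightarrow> int) \<Rightarrow> real" where
  "vdm k s = (\<Prod>i\<in>{1..k}. \<Prod>l\<in>{1..<i}. of_int (s i - s l))"

definition box_sum :: "nat \<Rightarrow> (nat \<Rightarrow> int) \<Rightarrow> (int \<Rightarrow> real) \<Rightarrow> real" where
  "box_sum k j w = (\<Sum>s\<in>(\<Pi>\<^sub>E i\<in>{1..k}. {j (i - 1)..<j i}). (\<Prod>i\<in>{1..k}. w (s i)) * vdm k s)"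

lemma vdm_Suc: "vdm (Suc k) (s(Suc k := x)) = (\<Prod>i\<in>{1..k}. of_int (x - s i)) * vdm k s"
proof -
  have "vdm (Suc k) (s(Suc k := x)) = (\<Prod>l\<in>{1..<Suc k}. of_int (x - s l)) * (\<Prod>i\<in>{1..k}. \<Prod>l\<in>{1..<i}. of_int ((s(Suc k := x)) i - (s(Suc k := x)) l))"
    unfolding vdm_def by (simp add: prod.nat_ivl_Suc' mult.commute)
  also have "(\<Prod>i\<in>{1..k}. \<Prod>l\<in>{1..<i}. of_int ((s(Suc k := x)) i - (s(Suc k := x)) l)) = vdm k s"
    unfolding vdm_def by (intro prod.cong refl) auto
  also have "{1..<Suc k} = {1..k}" by auto
  finally show ?thesis .
qed

lemma box_sum_Suc:
  "box_sum (Suc k) j w = (\<Sum>x\<in>{j k..<j (Suc k)}. w x * box_sum k j (\<lambda>s. w s * of_int (x - s)))"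
proof -
  have I: "{1..Suc k} = insert (Suc k) {1..k}" by auto
  have "box_sum (Suc k) j w = (\<Sum>x\<in>{j k..<j (Suc k)}. \<Sum>s\<in>(\<Pi>\<^sub>E i\<in>{1..k}. {j (i - 1)..<j i}).
      (\<Prod>i\<in>{1..Suc k}. w ((s(Suc k := x)) i)) * vdm (Suc k) (s(Suc k := x)))"
    unfolding box_sum_def I by (subst sum_PiE_insert) auto
  also have "\<dots> = (\<Sum>x\<in>{j k..<j (Suc k)}. w x * box_sum k j (\<lambda>s. w s * of_int (x - s)))"
    unfolding box_sum_def sum_distrib_left
  proof (intro sum.cong refl)
    fix x s
    have "(\<Prod>i\<in>{1..Suc k}. w ((s(Suc k := x)) i)) = w x * (\<Prod>i\<in>{1..k}. w (s i))"
    proof -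
      have "(\<Prod>i\<in>{1..k}. w ((s(Suc k := x)) i)) = (\<Prod>i\<in>{1..k}. w (s i))"
        by (intro prod.cong refl) auto
      then show ?thesis unfolding I by simp
    qed
    then show "(\<Prod>i\<in>{1..Suc k}. w ((s(Suc k := x)) i)) * vdm (Suc k) (s(Suc k := x))
      = w x * ((\<Prod>i\<in>{1..k}. w (s i) * of_int (x - s i)) * vdm k s)"
      by (simp only: vdm_Suc prod.distrib mult.assoc mult.left_commute)
  qed
  finally show ?thesis .
qed

lemma interlace_eq_box_sum: "interlace (rev (map j [0..<Suc k])) w = box_sum k j w"
proof (induction k arbitrary: w)
  case 0
  then show ?case by (simp add: box_sum_def vdm_def)
next
  case (Suc k)
  have "interlace (rev (map j [0..<Suc (Suc k)])) w = interlace (j (Suc k) # j k # rev (map j [0..<k])) w"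
    by simp
  also have "\<dots> = (\<Sum>x\<in>{j k..<j (Suc k)}. w x *
      interlace (j k # rev (map j [0..<k])) (\<lambda>s. w s * of_int (x - s)))"
    by (rule interlace.simps(1))
  also have "j k # rev (map j [0..<k]) = rev (map j [0..<Suc k])" by simp
  finally show ?case by (simp only: Suc box_sum_Suc)
qed

lemma vdm_split:
  assumes q: "q \<in> {1..k}"
  shows "vdm k s = (\<Prod>i\<in>{1..k} - {q}. \<Prod>l\<in>{1..<i} - {q}. of_int (s i - s l))
    * (\<Prod>i\<in>{1..k} - {q}. of_int (if i < q then s q - s i else s i - s q))"
proof -
  have "vdm k s = (\<Prod>l\<in>{1..<q}. of_int (s q - s l)) * (\<Prod>i\<in>{1..k} - {q}. \<Prod>l\<in>{1..<i}. of_int (s i - s l))"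
    unfolding vdm_def using q by (subst prod.remove[of _ q]) auto
  also have "(\<Prod>l\<in>{1..<q}. real_of_int (s q - s l)) = (\<Prod>i\<in>{1..k} - {q}. if i < q then of_int (s q - s i) else 1)"
    using q by (subst prod.inter_filter[symmetric]) (auto intro!: prod.cong)
  also have "(\<Prod>i\<in>{1..k} - {q}. \<Prod>l\<in>{1..<i}. real_of_int (s i - s l))
    = (\<Prod>i\<in>{1..k} - {q}. (if i < q then 1 else of_int (s i - s q)) * (\<Prod>l\<in>{1..<i} - {q}. of_int (s i - s l)))"
  proof (intro prod.cong refl)
    fix i assume "i \<in> {1..k} - {q}"
    then show "(\<Prod>l\<in>{1..<i}. real_of_int (s i - s l))
      = (if i < q then 1 else of_int (s i - s q)) * (\<Prod>l\<in>{1..<i} - {q}. of_int (s i - s l))"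
      using q prod.remove[of "{1..<i}" q "\<lambda>l. real_of_int (s i - s l)"] by (cases "i < q") auto
  qed
  finally have "vdm k s = (\<Prod>i\<in>{1..k} - {q}. if i < q then of_int (s q - s i) else 1) *
    ((\<Prod>i\<in>{1..k} - {q}. if i < q then 1 else of_int (s i - s q)) *
      (\<Prod>i\<in>{1..k} - {q}. \<Prod>l\<in>{1..<i} - {q}. of_int (s i - s l)))"
    by (simp only: prod.distrib)
  moreover have "(\<Prod>i\<in>{1..k} - {q}. if i < q then of_int (s q - s i) else 1) *
    (\<Prod>i\<in>{1..k} - {q}. if i < q then 1 else real_of_int (s i - s q))
    = (\<Prod>i\<in>{1..k} - {q}. of_int (if i < q then s q - s i else s i - s q))"
    unfolding prod.distrib[symmetric] by (intro prod.cong) auto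
  ultimately show ?thesis unfolding mult.assoc[symmetric] by (simp only: mult.commute)
qed

text \<open>Exchanging \<open>x\<close> with the \<open>q\<close>-th coordinate is an involution that flips the sign of every summand.\<close>

lemma box_sum_antisym:
  assumes q: "q \<in> {1..k}"
  shows "(\<Sum>x\<in>{j (q - 1)..<j q}. box_sum k j (\<lambda>s. of_int (x - s))) = 0"
proof -
  define X where "X = (\<Pi>\<^sub>E i\<in>{1..k}. {j (i - 1)..<j i})"
  define f where "f x s = (\<Prod>i\<in>{1..k}. real_of_int (x - s i)) * vdm k s" for x s
  define D where "D = {j (q - 1)..<j q} \<times> X"
  \<comment> \<open>The factors linking \<open>x\<close> and \<open>s q\<close> to the other
    coordinates are symmetric in the two; only \<open>x - s q\<close> changes sign.\<close>
  have flip: "f (s q) (s(q := x)) = - f x s" for x s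
  proof -
    have f: "f x s = of_int (x - s q) * (\<Prod>i\<in>{1..k} - {q}. \<Prod>l\<in>{1..<i} - {q}. of_int (s i - s l))
      * (\<Prod>i\<in>{1..k} - {q}. real_of_int (x - s i) * of_int (if i < q then s q - s i else s i - s q))" for x s
      unfolding f_def vdm_split[OF q] using q
      by (subst prod.remove[of _ q]) (simp_all only: prod.distrib finite_atLeastAtMost mult.assoc mult.left_commute mult.commute)
    have 1: "(\<Prod>i\<in>{1..k} - {q}. \<Prod>l\<in>{1..<i} - {q}. real_of_int ((s(q := x)) i - (s(q := x)) l))
      = (\<Prod>i\<in>{1..k} - {q}. \<Prod>l\<in>{1..<i} - {q}. of_int (s i - s l))"
      by (intro prod.cong refl) auto
    have 2: "(\<Prod>i\<in>{1..k} - {q}. real_of_int (s q - (s(q := x)) i) * of_int (if i < q then (s(q := x)) q - (s(q := x)) i else (s(q := x)) i - (s(q := x)) q))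
      = (\<Prod>i\<in>{1..k} - {q}. real_of_int (x - s i) * of_int (if i < q then s q - s i else s i - s q))"
      by (intro prod.cong refl) (auto simp: algebra_simps)
    show ?thesis unfolding f[of "s q" "s(q := x)"] f[of x s] 1 2 by (simp add: algebra_simps)
  qed
  have upd: "s(q := x) \<in> X" "s q \<in> {j (q - 1)..<j q}" if "s \<in> X" "x \<in> {j (q - 1)..<j q}" for s x
    using that q unfolding X_def by (auto simp: PiE_iff extensional_def)
  have "(\<Sum>(x, s)\<in>D. f x s) = (\<Sum>(x, s)\<in>D. f (s q) (s(q := x)))"
    by (rule sum.reindex_bij_witness[of _ "\<lambda>(x, s). (s q, s(q := x))" "\<lambda>(x, s). (s q, s(q := x))"])
      (use upd in \<open>auto simp: D_def\<close>)
  also have "\<dots> = - (\<Sum>(x, s)\<in>D. f x s)"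
    by (simp add: flip sum_negf case_prod_unfold)
  finally have "(\<Sum>(x, s)\<in>D. f x s) = 0" by simp
  then show ?thesis by (simp add: D_def X_def f_def box_sum_def sum.cartesian_product)
qed

text \<open>Let the upper end of the last interval vary: up to a constant the box sum is a
  polynomial \<open>Q\<close> of degree at most \<open>k + 1\<close> in it. The increments of
  \<open>Q\<close> between consecutive nodes vanish by \<open>box_sum_antisym\<close>, so
  \<open>Q\<close> minus a constant is a multiple of the node polynomial of \<open>j 0\<close> to
  \<open>j k\<close>, and the induction hypothesis supplies the leading coefficient.\<close>

lemma box_sum_eq_vandermonde:
  assumes "\<And>i. i < k \<Longrightarrow> j i < j (Suc i)"
  shows "box_sum k j (\<lambda>_. 1) = (\<Prod>i\<in>{1..k}. \<Prod>l\<in>{0..<i}. of_int (j i - j l)) / fact k"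
  using assms
proof (induction k)
  case 0
  then show ?case by (simp add: box_sum_def vdm_def)
next
  case (Suc k)
  define X where "X = (\<Pi>\<^sub>E i\<in>{1..k}. {j (i - 1)..<j i})"
  define P where "P = (\<Sum>s\<in>X. smult (vdm k s) (\<Prod>i\<in>{1..k}. [:- of_int (s i), 1:]))"
  have P: "poly P (of_int x) = box_sum k j (\<lambda>s. of_int (x - s))" for x
    by (simp add: P_def box_sum_def X_def poly_sum poly_prod mult.commute)
  have monic: "degree (\<Prod>i\<in>{1..k}. [:- of_int (s i), 1 :: real:]) = k"
    "coeff (\<Prod>i\<in>{1..k}. [:- of_int (s i), 1 :: real:]) k = 1" for s :: "nat \<Rightarrow> int"
    using monic_prod_linear[of "{1..k}" "\<lambda>i. of_int (s i)"] by auto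
  have finX: "finite X" unfolding X_def by (intro finite_PiE) auto
  have degP: "degree P \<le> k"
    unfolding P_def using monic finX by (intro degree_sum_le) (auto simp: degree_smult_eq)
  have coeffP: "coeff P k = box_sum k j (\<lambda>_. 1)"
  proof -
    have "coeff P k = (\<Sum>s\<in>X. vdm k s * coeff (\<Prod>i\<in>{1..k}. [:- of_int (s i), 1:]) k)"
      by (simp only: P_def coeff_sum coeff_smult)
    also have "\<dots> = (\<Sum>s\<in>X. vdm k s * 1)" by (simp only: monic(2))
    finally show ?thesis by (simp add: box_sum_def X_def)
  qed
  obtain Q where Q: "degree Q \<le> Suc k" "coeff Q (Suc k) = coeff P k / real (Suc k)"
    "\<And>x. poly Q (x + 1) - poly Q x = poly P x" using antidifference_degree[OF degP] by blast
  have tele: "(\<Sum>x\<in>{a..<b}. box_sum k j (\<lambda>s. of_int (x - s))) = poly Q (of_int b) - poly Q (of_int a)"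
    if "a \<le> b" for a b
    using sum_telescope_int[OF that, of "\<lambda>x. poly Q (of_int x)"] by (simp add: Q(3) P)
  have mono: "j i < j l" if "i < l" "l \<le> Suc k" for i l
    using that
  proof (induction l)
    case (Suc l)
    then show ?case using Suc.prems(2) \<open>\<And>i. i < Suc k \<Longrightarrow> j i < j (Suc i)\<close>[of l]
      by (cases "i = l") auto
  qed simp
  have Qj: "poly Q (of_int (j i)) = poly Q (of_int (j 0))" if "i \<le> k" for i
    using that
  proof (induction i)
    case (Suc i)
    have "0 = poly Q (of_int (j (Suc i))) - poly Q (of_int (j i))"
      using box_sum_antisym[of "Suc i" k j] tele[of "j i" "j (Suc i)"] mono[of i "Suc i"] Suc.prems by simp
    then show ?case using Suc by simp
  qed simp
  define p where "p = Q - [:poly Q (of_int (j 0)):]"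
  have inj: "inj_on j {0..k}"
    by (rule linorder_inj_onI) (use mono in fastforce)+
  then have card: "card (j ` {0..k}) = Suc k" by (simp add: card_image)
  have p: "p = smult (coeff p (Suc k)) (node_poly (j ` {0..k}))"
  proof -
    have "p = smult (coeff p (card (j ` {0..k}))) (node_poly (j ` {0..k}))"
    proof (rule poly_eq_smult_node_poly)
      show "degree p \<le> card (j ` {0..k})"
        unfolding p_def card by (rule degree_diff_le[OF Q(1)]) simp
      show "poly p (of_int x) = 0" if x: "x \<in> j ` {0..k}" for x
      proof -
        obtain i where "i \<le> k" "x = j i" using x by auto
        then show ?thesis unfolding p_def using Qj[of i] by simp
      qed
    qed simp
    then show ?thesis by (simp only: card)
  qed
  have coeffp: "coeff p (Suc k) = (\<Prod>i\<in>{1..k}. \<Prod>l\<in>{0..<i}. of_int (j i - j l)) / fact k / real (Suc k)"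
    using Q(2) coeffP Suc by (simp add: p_def)
  have "box_sum (Suc k) j (\<lambda>_. 1) = poly Q (of_int (j (Suc k))) - poly Q (of_int (j k))"
    using tele[of "j k" "j (Suc k)"] mono[of k "Suc k"] by (simp add: box_sum_Suc)
  also have "\<dots> = poly p (of_int (j (Suc k)))" using Qj[of k] by (simp add: p_def)
  also have "\<dots> = coeff p (Suc k) * (\<Prod>l\<in>{0..k}. of_int (j (Suc k) - j l))"
    using arg_cong[OF p, of "\<lambda>q. poly q (of_int (j (Suc k)))"]
    by (simp only: poly_smult) (simp add: poly_node_poly prod.reindex[OF inj])
  also have "\<dots> = (\<Prod>i\<in>{1..Suc k}. \<Prod>l\<in>{0..<i}. of_int (j i - j l)) / fact (Suc k)"
  proof -
    have I: "{1..Suc k} = insert (Suc k) {1..k}" "{0..<Suc k} = {0..k}" by auto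
    have *: "(\<Prod>i\<in>{1..Suc k}. \<Prod>l\<in>{0..<i}. real_of_int (j i - j l)) =
        (\<Prod>l\<in>{0..k}. of_int (j (Suc k) - j l)) * (\<Prod>i\<in>{1..k}. \<Prod>l\<in>{0..<i}. of_int (j i - j l))"
      unfolding I(1) by (subst prod.insert) (simp_all only: I(2) finite_atLeastAtMost atLeastAtMost_iff not_less_eq_eq, simp)
    show ?thesis unfolding * coeffp fact_Suc of_nat_mult by (simp only: times_divide_eq_left times_divide_eq_right divide_divide_eq_left mult.commute)
  qed
  finally show ?case .
qed

lemma interlace_desc:
  assumes fin: "finite J" and card: "card J = Suc k"
  shows "interlace (desc J) (\<lambda>_. 1) = vandermonde J / fact k"
proof -
  define xs where "xs = sorted_list_of_set J"
  define j where "j i = xs ! i" for i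
  have xs: "length xs = Suc k" "sorted_wrt (<) xs" "set xs = J"
    using fin card by (auto simp: xs_def)
  have mono: "j i < j l" if "i < l" "l \<le> k" for i l
    using sorted_wrt_nth_less[OF xs(2), of i l] that xs(1) by (simp add: j_def)
  have J: "J = j ` {0..k}" using xs by (force simp: j_def set_conv_nth image_iff less_Suc_eq_le)
  have inj: "inj_on j {0..k}" by (rule linorder_inj_onI) (use mono in fastforce)+
  have *: "{l \<in> J. l < j i} = j ` {0..<i}" if i: "i \<in> {0..k}" for i
  proof (intro equalityI subsetI)
    fix l assume "l \<in> {l \<in> J. l < j i}"
    then obtain r where r: "r \<le> k" "l = j r" "j r < j i" by (auto simp: J)
    then have "r < i" using mono[of i r] by (cases "r < i"; cases "r = i") auto
    then show "l \<in> j ` {0..<i}" using r by auto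
  qed (use mono i in \<open>auto simp: J\<close>)
  have "vandermonde J = (\<Prod>i\<in>{0..k}. \<Prod>l\<in>j ` {0..<i}. real_of_int (j i) - of_int l)"
  proof -
    have "vandermonde J = (\<Prod>i\<in>j ` {0..k}. \<Prod>l\<in>{l \<in> J. l < i}. real_of_int i - of_int l)"
      unfolding vandermonde_def by (rule prod.cong[OF J refl])
    also have "\<dots> = (\<Prod>i\<in>{0..k}. \<Prod>l\<in>{l \<in> J. l < j i}. real_of_int (j i) - of_int l)"
      by (subst prod.reindex[OF inj]) (simp only: comp_def)
    also have "\<dots> = (\<Prod>i\<in>{0..k}. \<Prod>l\<in>j ` {0..<i}. real_of_int (j i) - of_int l)"
    proof (rule prod.cong)
      fix i assume "i \<in> {0..k}"
      then show "(\<Prod>l\<in>{l \<in> J. l < j i}. real_of_int (j i) - of_int l)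
          = (\<Prod>l\<in>j ` {0..<i}. real_of_int (j i) - of_int l)"
        by (simp only: *)
    qed simp
    finally show ?thesis .
  qed
  also have "\<dots> = (\<Prod>i\<in>{0..k}. \<Prod>l\<in>{0..<i}. of_int (j i - j l))"
  proof (intro prod.cong refl)
    fix i assume "i \<in> {0..k}"
    then have "{0..<i} \<subseteq> {0..k}" by auto
    then have "inj_on j {0..<i}" by (rule inj_on_subset[OF inj])
    then show "(\<Prod>l\<in>j ` {0..<i}. real_of_int (j i) - of_int l) = (\<Prod>l\<in>{0..<i}. of_int (j i - j l))"
      by (subst prod.reindex) auto
  qed
  also have "\<dots> = (\<Prod>i\<in>{1..k}. \<Prod>l\<in>{0..<i}. of_int (j i - j l))"
    by (rule prod.mono_neutral_right) auto
  finally have "vandermonde J = (\<Prod>i\<in>{1..k}. \<Prod>l\<in>{0..<i}. of_int (j i - j l))" .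
  moreover have "xs = map j [0..<Suc k]" unfolding j_def xs(1)[symmetric] by (rule map_nth[symmetric])
  ultimately show ?thesis
    using box_sum_eq_vandermonde[of k j] mono interlace_eq_box_sum[of j k "\<lambda>_. 1"]
    by (simp add: desc_def xs_def[symmetric])
qed

lemma low_vandermonde_sum:
  assumes "\<And>i. i < n \<Longrightarrow> t i < t (Suc i)"
  shows "(\<Sum>J\<in>low (t ` {..n}) (Suc k). vandermonde J / fact k) = gap_sum t n k (\<lambda>_. 1)"
proof -
  have "(\<Sum>J\<in>low (t ` {..n}) (Suc k). interlace (desc J) (\<lambda>_. 1)) = gap_sum t n k (\<lambda>_. 1)"
    using low_interlace_sums[of n t] assms by blast
  moreover have "interlace (desc J) (\<lambda>_. 1) = vandermonde J / fact k" if "J \<in> low (t ` {..n}) (Suc k)" for J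
    using that finite_subset[of J "t ` {..n}"] by (intro interlace_desc) (auto simp: low_def)
  ultimately show ?thesis by simp
qed

section \<open>Lattice points of zonotopes\<close>

text \<open>If the interval contains an integer, thickening by \<open>A\<close> adds the
  \<open>A\<close> integers after its largest one. If it contains none, exactly the \<open>A\<close>
  integers from the ceiling of any of its points onwards are reached, so fibres without lattice
  points gain just as many.\<close>

lemma card_Ints_thicken:
  fixes I :: "real set"
  assumes ne: "I \<noteq> {}" and bd: "\<And>x. x \<in> I \<Longrightarrow> \<bar>x\<bar> \<le> M"
    and ivl: "\<And>x y z. x \<in> I \<Longrightarrow> y \<in> I \<Longrightarrow> x \<le> z \<Longrightarrow> z \<le> y \<Longrightarrow> z \<in> I"
  shows "card {z :: int. \<exists>c. 0 \<le> c \<and> c \<le> real A \<and> of_int z - c \<in> I} = card {z. of_int z \<in> I} + A"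
proof -
  define Z where "Z = {z. real_of_int z \<in> I}"
  define Y where "Y = {z :: int. \<exists>c. 0 \<le> c \<and> c \<le> real A \<and> of_int z - c \<in> I}"
  have finZ: "finite Z"
  proof (rule finite_subset)
    show "Z \<subseteq> {-\<lceil>M\<rceil>..\<lceil>M\<rceil>}"
    proof
      fix z assume "z \<in> Z"
      then have "\<bar>real_of_int z\<bar> \<le> M" using bd by (simp add: Z_def)
      then have "\<bar>real_of_int z\<bar> \<le> of_int \<lceil>M\<rceil>" by linarith
      then show "z \<in> {-\<lceil>M\<rceil>..\<lceil>M\<rceil>}" by simp linarith
    qed
  qed simp
  have "card Y = card Z + A"
  proof (cases "Z = {}")
    case False
    define q where "q = Max Z"
    have q: "q \<in> Z" "\<And>z. z \<in> Z \<Longrightarrow> z \<le> q" using finZ False by (auto simp: q_def)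
    have "Y = Z \<union> {q + 1..q + int A}"
    proof (intro equalityI subsetI)
      fix z assume "z \<in> Y"
      then obtain c where c: "0 \<le> c" "c \<le> real A" "of_int z - c \<in> I" by (auto simp: Y_def)
      have "z \<in> Z" if "z \<le> q"
        using ivl[of "of_int z - c" "of_int q" "of_int z"] c q(1) that by (simp add: Z_def)
      moreover have "z \<le> q + int A"
      proof (rule ccontr)
        assume "\<not> z \<le> q + int A"
        then have "of_int (q + 1) \<le> of_int z - c" using c(2) by linarith
        then have "q + 1 \<in> Z"
          using ivl[of "of_int q" "of_int z - c" "of_int (q + 1)"] c(3) q(1) by (simp add: Z_def)
        then show False using q(2)[of "q + 1"] by simp
      qed
      ultimately show "z \<in> Z \<union> {q + 1..q + int A}" by force
    next
      fix z assume "z \<in> Z \<union> {q + 1..q + int A}"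
      then show "z \<in> Y"
      proof
        assume "z \<in> Z"
        then show ?thesis by (auto simp: Y_def Z_def intro!: exI[of _ 0])
      next
        assume z: "z \<in> {q + 1..q + int A}"
        then have "q + 1 \<le> z" "z \<le> q + int A" by auto
        then have "0 \<le> real_of_int z - of_int q" "real_of_int z - of_int q \<le> real A" by linarith+
        then show ?thesis using q(1) by (auto simp: Y_def Z_def intro!: exI[of _ "of_int z - of_int q"])
      qed
    qed
    moreover have "Z \<inter> {q + 1..q + int A} = {}" using q(2) by fastforce
    ultimately show ?thesis using finZ by (simp add: card_Un_disjoint)
  next
    case True
    then have none: "real_of_int z \<notin> I" for z by (auto simp: Z_def)
    obtain r where r: "r \<in> I" using ne by blast
    define k where "k = \<lceil>r\<rceil>"
    have k: "r \<le> of_int k" "of_int k < r + 1" unfolding k_def by linarith+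
    have "Y = {k..<k + int A}"
    proof (intro equalityI subsetI)
      fix z assume "z \<in> Y"
      then obtain c where c: "0 \<le> c" "c \<le> real A" "of_int z - c \<in> I" by (auto simp: Y_def)
      have "\<not> z < k"
      proof
        assume "z < k"
        then have "of_int z \<le> r" using k by linarith
        then show False using ivl[of "of_int z - c" r "of_int z"] c r none by auto
      qed
      moreover have "z < k + int A"
      proof (rule ccontr)
        assume "\<not> z < k + int A"
        then have "of_int k \<le> of_int z - c" using c by linarith
        then show False using ivl[of r "of_int z - c" "of_int k"] c r k none by auto
      qed
      ultimately show "z \<in> {k..<k + int A}" by simp
    next
      fix z assume "z \<in> {k..<k + int A}"
      then have "k \<le> z" "z < k + int A" by auto
      then have "0 \<le> of_int z - r" "of_int z - r \<le> real A" using k by linarith+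
      then show "z \<in> Y" using r by (auto simp: Y_def intro!: exI[of _ "of_int z - r"])
    qed
    then show ?thesis using True by simp
  qed
  then show ?thesis by (simp add: Y_def Z_def)
qed

definition zonotope_points :: "nat \<Rightarrow> nat \<Rightarrow> (nat \<Rightarrow> int) \<Rightarrow> (nat \<Rightarrow> int) \<Rightarrow> (nat \<Rightarrow> int) set" where
  "zonotope_points d n A s = {y \<in> {..<d} \<rightarrow>\<^sub>E UNIV. \<exists>a. (\<forall>i\<in>{1..n}. 0 \<le> a i \<and> a i \<le> real_of_int (A i)) \<and>
     (\<forall>j<d. real_of_int (y j) = (\<Sum>i\<in>{1..n}. a i * of_int (s i) ^ j))}"

lemma finite_zonotope_points: "finite (zonotope_points d n A s)"
proof -
  define B where "B j = \<lceil>\<Sum>i\<in>{1..n}. real_of_int \<bar>A i\<bar> * \<bar>of_int (s i)\<bar> ^ j\<rceil>" for j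
  have "zonotope_points d n A s \<subseteq> (\<Pi>\<^sub>E j\<in>{..<d}. {- B j..B j})"
  proof
    fix y assume y: "y \<in> zonotope_points d n A s"
    then obtain a where a: "\<And>i. i \<in> {1..n} \<Longrightarrow> 0 \<le> a i \<and> a i \<le> real_of_int (A i)"
      "\<And>j. j < d \<Longrightarrow> real_of_int (y j) = (\<Sum>i\<in>{1..n}. a i * of_int (s i) ^ j)"
      unfolding zonotope_points_def by blast
    have "y j \<in> {- B j..B j}" if j: "j < d" for j
    proof -
      have "\<bar>real_of_int (y j)\<bar> \<le> (\<Sum>i\<in>{1..n}. \<bar>a i * of_int (s i) ^ j\<bar>)"
        unfolding a(2)[OF j] by (rule sum_abs)
      also have "\<dots> \<le> (\<Sum>i\<in>{1..n}. real_of_int \<bar>A i\<bar> * \<bar>of_int (s i)\<bar> ^ j)"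
      proof (rule sum_mono)
        fix i assume "i \<in> {1..n}"
        then have "\<bar>a i\<bar> \<le> real_of_int \<bar>A i\<bar>" using a(1)[of i] by auto
        then show "\<bar>a i * of_int (s i) ^ j\<bar> \<le> real_of_int \<bar>A i\<bar> * \<bar>of_int (s i)\<bar> ^ j"
          by (simp add: abs_mult power_abs mult_right_mono)
      qed
      finally have "\<bar>real_of_int (y j)\<bar> \<le> of_int (B j)" unfolding B_def by linarith
      then show ?thesis by simp linarith
    qed
    then show "y \<in> (\<Pi>\<^sub>E j\<in>{..<d}. {- B j..B j})" using y by (auto simp: zonotope_points_def PiE_iff)
  qed
  then show ?thesis by (rule finite_subset) (auto intro: finite_PiE)
qed

text \<open>The map \<open>y \<mapsto> (\<sigma> y\<^sub>j - y\<^sub>j\<^sub>+\<^sub>1)\<^sub>j\<close> is the projection along the primitive vector \<open>(1, \<sigma>, \<sigma>\<^sup>2, \<dots>)\<close>;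
  it sends \<open>\<int>\<^sup>d\<^sup>+\<^sup>1\<close> onto \<open>\<int>\<^sup>d\<close>, and the coordinate \<open>y\<^sub>0\<close> identifies its fibres with \<open>\<int>\<close>.\<close>

lemma card_zonotope_points_Suc:
  assumes A: "\<And>i. i \<in> {1..Suc n} \<Longrightarrow> A i \<ge> 0" and s: "\<And>i. i \<in> {1..n} \<Longrightarrow> s i < s (Suc n)"
  shows "card (zonotope_points (Suc d) (Suc n) A s) = card (zonotope_points (Suc d) n A s)
    + nat (A (Suc n)) * card (zonotope_points d n (\<lambda>i. A i * (s (Suc n) - s i)) s)"
proof -
  define sg where "sg = s (Suc n)"
  define W where "W = zonotope_points d n (\<lambda>i. A i * (sg - s i)) s"
  define box where "box a \<longleftrightarrow> (\<forall>i\<in>{1..n}. 0 \<le> a i \<and> a i \<le> real_of_int (A i))" for a :: "nat \<Rightarrow> real"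
  \<comment> \<open>The real fibre over \<open>w\<close> of the old zonotope, parametrized by
    coordinate 0, which is the sum of the coefficients.\<close>
  define I where "I w = {r. \<exists>a. box a \<and> r = (\<Sum>i\<in>{1..n}. a i) \<and>
    (\<forall>j<d. real_of_int (w j) = (\<Sum>i\<in>{1..n}. a i * of_int (sg - s i) * of_int (s i) ^ j))}" for w :: "nat \<Rightarrow> int"
  \<comment> \<open>\<open>Z 0\<close> is the old point set and \<open>Z N\<close> the new one, with
    \<open>N\<close> the length of the added segment. Both fibre over the same \<open>W\<close>, and
    only the thickening of the interval differs.\<close>
  define Z where "Z C = {y \<in> {..<Suc d} \<rightarrow>\<^sub>E (UNIV :: int set). \<exists>a c. box a \<and> 0 \<le> c \<and> c \<le> real C \<and>
    (\<forall>j<Suc d. real_of_int (y j) = (\<Sum>i\<in>{1..n}. a i * of_int (s i) ^ j) + c * of_int sg ^ j)}" for C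
  define D where "D y = restrict (\<lambda>j. sg * y j - y (Suc j)) {..<d}" for y :: "nat \<Rightarrow> int"
  have sp: "real_of_int (sg - s i) > 0" if "i \<in> {1..n}" for i using s[OF that] by (simp add: sg_def)
  have shift: "of_int sg * ((\<Sum>i\<in>{1..n}. a i * of_int (s i) ^ j) + c * of_int sg ^ j)
      - ((\<Sum>i\<in>{1..n}. a i * of_int (s i) ^ Suc j) + c * of_int sg ^ Suc j)
      = (\<Sum>i\<in>{1..n}. a i * of_int (sg - s i) * real_of_int (s i) ^ j)" for a :: "nat \<Rightarrow> real" and c :: real and j
    by (simp add: algebra_simps sum_distrib_left sum_subtractf)
  have bij: "bij_betw (\<lambda>y. (D y, y 0)) (Z C) (Sigma W (\<lambda>w. {z. \<exists>c. 0 \<le> c \<and> c \<le> real C \<and> of_int z - c \<in> I w}))" for C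
  proof (rule bij_betw_imageI)
    show "inj_on (\<lambda>y. (D y, y 0)) (Z C)"
    proof (rule inj_onI)
      fix x y assume xy: "x \<in> Z C" "y \<in> Z C" "(D x, x 0) = (D y, y 0)"
      have eq: "x j = y j" if "j < Suc d" for j
        using that
      proof (induction j)
        case (Suc j)
        have "D x j = D y j" using xy(3) by simp
        then show ?case using Suc by (simp add: D_def)
      qed (use xy in simp)
      show "x = y"
        by (rule PiE_ext[of _ "{..<Suc d}" "\<lambda>_. UNIV"]) (use xy eq in \<open>auto simp: Z_def\<close>)
    qed
    show "(\<lambda>y. (D y, y 0)) ` Z C = Sigma W (\<lambda>w. {z. \<exists>c. 0 \<le> c \<and> c \<le> real C \<and> of_int z - c \<in> I w})"
    proof (intro equalityI subsetI)
      fix p assume "p \<in> (\<lambda>y. (D y, y 0)) ` Z C"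
      then obtain y where y: "p = (D y, y 0)" "y \<in> Z C" by blast
      then obtain a c where ac: "box a" "0 \<le> c" "c \<le> real C"
        "\<And>j. j < Suc d \<Longrightarrow> real_of_int (y j) = (\<Sum>i\<in>{1..n}. a i * of_int (s i) ^ j) + c * of_int sg ^ j"
        by (auto simp: Z_def)
      have Dy: "real_of_int (D y j) = (\<Sum>i\<in>{1..n}. a i * of_int (sg - s i) * of_int (s i) ^ j)" if "j < d" for j
      proof -
        have "real_of_int (D y j) = of_int sg * real_of_int (y j) - real_of_int (y (Suc j))"
          using that by (simp add: D_def)
        then show ?thesis using that shift[of a j c] ac(4)[of j] ac(4)[of "Suc j"] by simp
      qed
      have "D y \<in> W"
        unfolding W_def zonotope_points_def
      proof (intro CollectI conjI exI[of _ "\<lambda>i. a i * of_int (sg - s i)"] ballI allI impI)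
        show "D y \<in> {..<d} \<rightarrow>\<^sub>E UNIV" by (auto simp: D_def)
        fix i assume i: "i \<in> {1..n}"
        show "0 \<le> a i * of_int (sg - s i)" using ac(1) i sp[OF i] by (auto simp: box_def)
        show "a i * of_int (sg - s i) \<le> of_int (A i * (sg - s i))"
          using ac(1) i sp[OF i] unfolding of_int_mult box_def by (intro mult_right_mono) auto
      qed (use Dy in simp)
      moreover have "of_int (y 0) - c \<in> I (D y)"
        unfolding I_def using ac(1) ac(4)[of 0] Dy by (intro CollectI exI[of _ a]) auto
      ultimately show "p \<in> Sigma W (\<lambda>w. {z. \<exists>c. 0 \<le> c \<and> c \<le> real C \<and> of_int z - c \<in> I w})"
        using y ac by auto
    next
      fix p assume "p \<in> Sigma W (\<lambda>w. {z. \<exists>c. 0 \<le> c \<and> c \<le> real C \<and> of_int z - c \<in> I w})"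
      then obtain w z c a where p: "p = (w, z)" "w \<in> W" and ac: "0 \<le> c" "c \<le> real C" "box a"
        "of_int z - c = (\<Sum>i\<in>{1..n}. a i)"
        "\<And>j. j < d \<Longrightarrow> real_of_int (w j) = (\<Sum>i\<in>{1..n}. a i * of_int (sg - s i) * of_int (s i) ^ j)"
        by (auto simp: I_def)
      \<comment> \<open>A preimage under the projection is found by solving
        \<open>y (Suc j) = sg * y j - w j\<close> from \<open>y 0 = z\<close>, which keeps all
        coordinates integral.\<close>
      define g where "g = rec_nat z (\<lambda>j v. sg * v - w j)"
      have g: "g 0 = z" "g (Suc j) = sg * g j - w j" for j by (simp_all add: g_def)
      define y where "y = restrict g {..<Suc d}"
      have gj: "real_of_int (g j) = (\<Sum>i\<in>{1..n}. a i * of_int (s i) ^ j) + c * of_int sg ^ j" if "j < Suc d" for j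
        using that
      proof (induction j)
        case 0
        then show ?case using ac(4) by (simp add: g)
      next
        case (Suc j)
        then show ?case using ac(5)[of j] shift[of a j c] by (simp add: g)
      qed
      have "y \<in> Z C"
        unfolding Z_def using ac gj by (auto simp: y_def intro!: exI[of _ a] exI[of _ c])
      moreover have "D y = w"
      proof (rule PiE_ext[of _ "{..<d}" "\<lambda>_. UNIV"])
        show "w \<in> {..<d} \<rightarrow>\<^sub>E UNIV" using p(2) by (simp add: W_def zonotope_points_def)
      qed (auto simp: D_def y_def g)
      moreover have "y 0 = z" by (simp add: y_def g)
      ultimately show "p \<in> (\<lambda>y. (D y, y 0)) ` Z C" using p by force
    qed
  qed
  have Ibd: "\<bar>r\<bar> \<le> (\<Sum>i\<in>{1..n}. real_of_int (A i))" if r: "r \<in> I w" for r w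
  proof -
    obtain a where "box a" "r = (\<Sum>i\<in>{1..n}. a i)" using r by (auto simp: I_def)
    moreover have "0 \<le> (\<Sum>i\<in>{1..n}. a i)" "(\<Sum>i\<in>{1..n}. a i) \<le> (\<Sum>i\<in>{1..n}. real_of_int (A i))"
      using \<open>box a\<close> by (auto simp: box_def intro!: sum_nonneg sum_mono)
    ultimately show ?thesis by simp
  qed
  have Iivl: "z \<in> I w" if xy: "x \<in> I w" "y \<in> I w" "x \<le> z" "z \<le> y" for x y z w
  proof (cases "x = y")
    case False
    obtain a where a: "box a" "x = (\<Sum>i\<in>{1..n}. a i)"
      "\<And>j. j < d \<Longrightarrow> real_of_int (w j) = (\<Sum>i\<in>{1..n}. a i * of_int (sg - s i) * of_int (s i) ^ j)"
      using xy(1) by (auto simp: I_def)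
    obtain b where b: "box b" "y = (\<Sum>i\<in>{1..n}. b i)"
      "\<And>j. j < d \<Longrightarrow> real_of_int (w j) = (\<Sum>i\<in>{1..n}. b i * of_int (sg - s i) * of_int (s i) ^ j)"
      using xy(2) by (auto simp: I_def)
    define u where "u = (z - x) / (y - x)"
    have u: "0 \<le> u" "u \<le> 1" "z = (1 - u) * x + u * y"
    proof -
      have yx: "y - x > 0" using xy False by linarith
      then show "0 \<le> u" "u \<le> 1" using xy by (auto simp: u_def divide_simps)
      have "u * (y - x) = z - x" using yx by (simp add: u_def)
      then show "z = (1 - u) * x + u * y" by (simp add: algebra_simps)
    qed
    define c where "c i = (1 - u) * a i + u * b i" for i
    have "box c"
      unfolding box_def
    proof
      fix i assume i: "i \<in> {1..n}"
      have "(1 - u) * a i + u * b i \<le> (1 - u) * of_int (A i) + u * of_int (A i)"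
        using a(1) b(1) i u by (intro add_mono mult_left_mono) (auto simp: box_def)
      then have "c i \<le> of_int (A i)" by (simp add: c_def algebra_simps)
      moreover have "0 \<le> c i"
        using a(1) b(1) i u unfolding c_def by (intro add_nonneg_nonneg mult_nonneg_nonneg) (auto simp: box_def)
      ultimately show "0 \<le> c i \<and> c i \<le> of_int (A i)" by blast
    qed
    moreover have "z = (\<Sum>i\<in>{1..n}. c i)"
      using u(3) a(2) b(2) by (simp add: c_def sum.distrib sum_distrib_left)
    moreover have "real_of_int (w j) = (\<Sum>i\<in>{1..n}. c i * of_int (sg - s i) * of_int (s i) ^ j)" if "j < d" for j
    proof -
      have "(\<Sum>i\<in>{1..n}. c i * of_int (sg - s i) * of_int (s i) ^ j)
        = (1 - u) * (\<Sum>i\<in>{1..n}. a i * of_int (sg - s i) * of_int (s i) ^ j)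
          + u * (\<Sum>i\<in>{1..n}. b i * of_int (sg - s i) * of_int (s i) ^ j)"
        unfolding c_def distrib_right sum.distrib sum_distrib_left by (simp only: mult.assoc)
      then show ?thesis unfolding a(3)[OF that, symmetric] b(3)[OF that, symmetric] by (simp add: algebra_simps)
    qed
    ultimately show ?thesis by (auto simp: I_def)
  qed (use xy in auto)
  have Ine: "I w \<noteq> {}" if w: "w \<in> W" for w
  proof -
    obtain a where a: "\<And>i. i \<in> {1..n} \<Longrightarrow> 0 \<le> a i \<and> a i \<le> of_int (A i * (sg - s i))"
      "\<And>j. j < d \<Longrightarrow> real_of_int (w j) = (\<Sum>i\<in>{1..n}. a i * of_int (s i) ^ j)"
      using w unfolding W_def zonotope_points_def by blast
    define b where "b i = a i / of_int (sg - s i)" for i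
    have "box b"
      unfolding box_def
    proof
      fix i assume i: "i \<in> {1..n}"
      have "a i \<le> of_int (A i) * of_int (sg - s i)" using a(1)[OF i] by simp
      then show "0 \<le> b i \<and> b i \<le> of_int (A i)"
        unfolding b_def using a(1)[OF i] sp[OF i] by (simp add: pos_divide_le_eq del: of_int_diff)
    qed
    moreover have "real_of_int (w j) = (\<Sum>i\<in>{1..n}. b i * of_int (sg - s i) * of_int (s i) ^ j)" if "j < d" for j
      unfolding a(2)[OF that] b_def using sp by (intro sum.cong refl) force
    ultimately show ?thesis by (auto simp: I_def)
  qed
  define N where "N = nat (A (Suc n))"
  have finW: "finite W" unfolding W_def by (rule finite_zonotope_points)
  have fib: "card {z. \<exists>c. 0 \<le> c \<and> c \<le> real C \<and> of_int z - c \<in> I w} = card {z. of_int z \<in> I w} + C"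
    if "w \<in> W" for C w
    using Ine[OF that] Ibd Iivl by (rule card_Ints_thicken)
  have finfib: "finite {z. \<exists>c. 0 \<le> c \<and> c \<le> real C \<and> of_int z - c \<in> I w}" for C w
  proof (rule finite_subset)
    define M where "M = \<lceil>(\<Sum>i\<in>{1..n}. real_of_int (A i)) + real C\<rceil>"
    show "{z. \<exists>c. 0 \<le> c \<and> c \<le> real C \<and> of_int z - c \<in> I w} \<subseteq> {-M..M}"
    proof
      fix z assume "z \<in> {z. \<exists>c. 0 \<le> c \<and> c \<le> real C \<and> of_int z - c \<in> I w}"
      then obtain c where c: "0 \<le> c" "c \<le> real C" "of_int z - c \<in> I w" by auto
      have "\<bar>real_of_int z\<bar> \<le> of_int M" using Ibd[OF c(3)] c(1,2) unfolding M_def by linarith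
      then show "z \<in> {-M..M}" by simp linarith
    qed
  qed simp
  have card_Z: "card (Z C) = (\<Sum>w\<in>W. card {z. of_int z \<in> I w}) + C * card W" for C
  proof -
    have "card (Z C) = (\<Sum>w\<in>W. card {z. \<exists>c. 0 \<le> c \<and> c \<le> real C \<and> of_int z - c \<in> I w})"
      unfolding bij_betw_same_card[OF bij] using finW finfib by (intro card_SigmaI) auto
    also have "\<dots> = (\<Sum>w\<in>W. card {z. of_int z \<in> I w} + C)" using fib by (intro sum.cong refl) auto
    finally show ?thesis by (simp add: sum.distrib)
  qed
  have Z0: "Z 0 = zonotope_points (Suc d) n A s"
  proof -
    have "(\<exists>c\<ge>0. c \<le> 0 \<and> R c) \<longleftrightarrow> R 0" for R :: "real \<Rightarrow> bool"
      by (metis order_refl order_antisym)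
    then show ?thesis unfolding Z_def zonotope_points_def box_def by simp
  qed
  have ZN: "Z N = zonotope_points (Suc d) (Suc n) A s"
  proof (intro equalityI subsetI)
    have N: "real N = of_int (A (Suc n))" using A by (simp add: N_def)
    {
      fix y assume "y \<in> Z N"
      then obtain a c where ac: "y \<in> {..<Suc d} \<rightarrow>\<^sub>E UNIV" "box a" "0 \<le> c" "c \<le> real N"
        "\<And>j. j < Suc d \<Longrightarrow> real_of_int (y j) = (\<Sum>i\<in>{1..n}. a i * of_int (s i) ^ j) + c * of_int sg ^ j"
        by (auto simp: Z_def)
      define b where "b = a(Suc n := c)"
      have "(\<Sum>i\<in>{1..Suc n}. b i * of_int (s i) ^ j) = (\<Sum>i\<in>{1..n}. a i * of_int (s i) ^ j) + c * of_int sg ^ j" for j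
      proof -
        have "(\<Sum>i\<in>{1..n}. b i * real_of_int (s i) ^ j) = (\<Sum>i\<in>{1..n}. a i * of_int (s i) ^ j)"
          by (rule sum.cong) (auto simp: b_def)
        then show ?thesis by (simp add: b_def sg_def)
      qed
      moreover have "\<forall>i\<in>{1..Suc n}. 0 \<le> b i \<and> b i \<le> of_int (A i)"
        using ac(2-4) N by (auto simp: b_def box_def le_Suc_eq)
      ultimately show "y \<in> zonotope_points (Suc d) (Suc n) A s"
        unfolding zonotope_points_def using ac(1,5) by (intro CollectI conjI exI[of _ b]) auto
    }
    {
      fix y assume "y \<in> zonotope_points (Suc d) (Suc n) A s"
      then obtain b where b: "y \<in> {..<Suc d} \<rightarrow>\<^sub>E UNIV" "\<forall>i\<in>{1..Suc n}. 0 \<le> b i \<and> b i \<le> of_int (A i)"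
        "\<And>j. j < Suc d \<Longrightarrow> real_of_int (y j) = (\<Sum>i\<in>{1..Suc n}. b i * of_int (s i) ^ j)"
        by (auto simp: zonotope_points_def)
      then show "y \<in> Z N"
        unfolding Z_def box_def using N by (intro CollectI conjI exI[of _ b] exI[of _ "b (Suc n)"]) (auto simp: sg_def)
    }
  qed
  show ?thesis using card_Z[of 0] card_Z[of N] unfolding Z0 ZN
    unfolding N_def W_def sg_def by simp
qed

text \<open>The recursion of \<open>card_zonotope_points_Suc\<close> for lengths
  \<open>m * A i\<close>, read as a polynomial in m: the added segment contributes the factor m, and
  the projected ones keep theirs.\<close>

fun zonotope_poly :: "nat \<Rightarrow> nat \<Rightarrow> (nat \<Rightarrow> int) \<Rightarrow> (nat \<Rightarrow> int) \<Rightarrow> real poly" where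
  "zonotope_poly n 0 A s = 1"
| "zonotope_poly 0 (Suc d) A s = 1"
| "zonotope_poly (Suc n) (Suc d) A s = zonotope_poly n (Suc d) A s
    + smult (of_int (A (Suc n))) ([:0, 1:] * zonotope_poly n d (\<lambda>i. A i * (s (Suc n) - s i)) s)"

lemma zonotope_points_0:
  assumes "\<And>i. i \<in> {1..n} \<Longrightarrow> A i \<ge> 0"
  shows "zonotope_points 0 n A s = {\<lambda>_. undefined}"
  using assms by (auto simp: zonotope_points_def intro!: exI[of _ "\<lambda>_. 0"])

lemma zonotope_points_no_segments: "zonotope_points d 0 A s = {restrict (\<lambda>_. 0) {..<d}}"
proof (intro equalityI subsetI)
  fix y assume y: "y \<in> zonotope_points d 0 A s"
  have "y = restrict (\<lambda>_. 0) {..<d}"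
    by (rule PiE_ext[of _ "{..<d}" "\<lambda>_. UNIV"]) (use y in \<open>auto simp: zonotope_points_def\<close>)
  then show "y \<in> {restrict (\<lambda>_. 0) {..<d}}" by simp
qed (auto simp: zonotope_points_def)

lemma card_zonotope_points:
  assumes "\<And>i. i \<in> {1..n} \<Longrightarrow> A i \<ge> 0" and "\<And>i l. 1 \<le> i \<Longrightarrow> i < l \<Longrightarrow> l \<le> n \<Longrightarrow> s i < s l"
  shows "real (card (zonotope_points d n (\<lambda>i. int m * A i) s)) = poly (zonotope_poly n d A s) (real m)"
  using assms
proof (induction n d A s rule: zonotope_poly.induct)
  case (1 n A s)
  then show ?case by (subst zonotope_points_0) auto
next
  case (2 d A s)
  then show ?case by (simp add: zonotope_points_no_segments)
next
  case (3 n d A s)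
  have IH1: "real (card (zonotope_points (Suc d) n (\<lambda>i. int m * A i) s)) = poly (zonotope_poly n (Suc d) A s) (real m)"
    using 3 by simp
  have "real (card (zonotope_points d n (\<lambda>i. int m * (A i * (s (Suc n) - s i))) s))
      = poly (zonotope_poly n d (\<lambda>i. A i * (s (Suc n) - s i)) s) (real m)"
  proof (intro 3(2))
    fix i assume i: "i \<in> {1..n}"
    then have "A i \<ge> 0" "s i < s (Suc n)" using 3(3,4) by auto
    then show "0 \<le> A i * (s (Suc n) - s i)" by simp
  qed (use 3(4) in auto)
  moreover have "card (zonotope_points (Suc d) (Suc n) (\<lambda>i. int m * A i) s) = card (zonotope_points (Suc d) n (\<lambda>i. int m * A i) s)
    + nat (int m * A (Suc n)) * card (zonotope_points d n (\<lambda>i. int m * A i * (s (Suc n) - s i)) s)"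
    using 3(3,4) by (intro card_zonotope_points_Suc) auto
  moreover have "real (nat (int m * A (Suc n))) = real m * of_int (A (Suc n))" using 3(3) by simp
  ultimately show ?case using IH1 by (simp add: mult.assoc mult.left_commute)
qed

lemma zonotope_poly_cong:
  assumes "\<And>i. i \<in> {1..n} \<Longrightarrow> A i = B i" and "\<And>i. i \<in> {1..n} \<Longrightarrow> s i = r i"
  shows "zonotope_poly n d A s = zonotope_poly n d B r"
  using assms
proof (induction n arbitrary: d A B)
  case 0
  then show ?case by (cases d) auto
next
  case (Suc n)
  show ?case
  proof (cases d)
    case (Suc d')
    have "zonotope_poly n (Suc d') A s = zonotope_poly n (Suc d') B r" using Suc.prems by (intro Suc.IH) auto
    moreover have "zonotope_poly n d' (\<lambda>i. A i * (s (Suc n) - s i)) s = zonotope_poly n d' (\<lambda>i. B i * (r (Suc n) - r i)) r"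
      using Suc.prems by (intro Suc.IH) auto
    ultimately show ?thesis using Suc Suc.prems by simp
  qed simp
qed

section \<open>Averaging the zonotope polynomials over the box\<close>

fun gap_poly :: "(nat \<Rightarrow> int) \<Rightarrow> nat \<Rightarrow> nat \<Rightarrow> (int \<Rightarrow> int) \<Rightarrow> real poly" where
  "gap_poly t n 0 w = 1"
| "gap_poly t 0 (Suc d) w = 1"
| "gap_poly t (Suc n) (Suc d) w = gap_poly t n (Suc d) w
    + (\<Sum>x\<in>{t n..<t (Suc n)}. smult (of_int (w x)) ([:0, 1:] * gap_poly t n d (\<lambda>s. w s * (x - s))))"

lemma poly_gap_poly:
  "poly (gap_poly t n d w) x = (\<Sum>k\<le>d. x ^ k * gap_sum t n k (\<lambda>s. of_int (w s)))"
proof (induction t n d w rule: gap_poly.induct)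
  case (2 t d w)
  have "gap_sum t 0 k (\<lambda>s. of_int (w s)) = (if k = 0 then 1 else 0)" for k by (cases k) auto
  then have "(\<Sum>k\<le>Suc d. x ^ k * gap_sum t 0 k (\<lambda>s. of_int (w s))) = (\<Sum>k\<le>Suc d. if k = 0 then 1 else 0)"
    by (intro sum.cong) auto
  then show ?case by simp
next
  case (3 t n d w)
  have g0: "gap_sum t n 0 w = 1" for n w by simp
  have "(\<Sum>k\<le>Suc d. x ^ k * gap_sum t (Suc n) k (\<lambda>s. of_int (w s)))
    = (\<Sum>k\<le>Suc d. x ^ k * gap_sum t n k (\<lambda>s. of_int (w s)))
     + (\<Sum>k\<le>d. x ^ Suc k * (\<Sum>z\<in>{t n..<t (Suc n)}. of_int (w z) * gap_sum t n k (\<lambda>s. of_int (w s) * of_int (z - s))))"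
    unfolding sum.atMost_Suc_shift[of _ d] g0 gap_sum.simps(3) distrib_left sum.distrib by (simp only: add.assoc)
  also have "(\<Sum>k\<le>d. x ^ Suc k * (\<Sum>z\<in>{t n..<t (Suc n)}. of_int (w z) * gap_sum t n k (\<lambda>s. of_int (w s) * of_int (z - s))))
    = (\<Sum>z\<in>{t n..<t (Suc n)}. of_int (w z) * (x * (\<Sum>k\<le>d. x ^ k * gap_sum t n k (\<lambda>s. of_int (w s) * of_int (z - s)))))"
    unfolding sum_distrib_left by (subst sum.swap) (intro sum.cong refl, simp add: mult.assoc mult.left_commute)
  also have "\<dots> = (\<Sum>z\<in>{t n..<t (Suc n)}. of_int (w z) * (x * poly (gap_poly t n d (\<lambda>s. w s * (z - s))) x))"
    using 3(2) by (intro sum.cong refl) (simp only: of_int_mult)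
  finally show ?case using 3(1) by (simp add: poly_sum mult.left_commute)
qed simp

lemma gap_box_Suc_sum:
  "(\<Sum>s\<in>gap_box t (Suc n). f s) = (\<Sum>x\<in>{t n..<t (Suc n)}. \<Sum>s\<in>gap_box t n. f (s(Suc n := x)))"
proof -
  have "{1..Suc n} = insert (Suc n) {1..n}" "{t n..t (Suc n) - 1} = {t n..<t (Suc n)}" by auto
  then show ?thesis unfolding gap_box_def by (simp add: sum_PiE_insert)
qed

lemma smult_sum_right: "smult c (\<Sum>i\<in>I. f i) = (\<Sum>i\<in>I. smult c (f i))"
  by (induction I rule: infinite_finite_induct) (auto simp: smult_add_right)

text \<open>Every interval contributes one factor \<open>gap t i\<close>, whichever case of the
  recursion applies. If its generator is used, the factor is the length of the segment and the sum
  over \<open>s i\<close> remains; if not, the summand is independent of \<open>s i\<close> and the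
  factor counts the values of \<open>s i\<close>.\<close>

lemma sum_zonotope_poly:
  assumes "\<And>i. i < n \<Longrightarrow> t i < t (Suc i)"
  shows "(\<Sum>s\<in>gap_box t n. zonotope_poly n d (\<lambda>i. gap t i * w (s i)) s)
    = smult (of_int (\<Prod>i\<in>{1..n}. gap t i)) (gap_poly t n d w)"
  using assms
proof (induction t n d w rule: gap_poly.induct)
  case (1 t n w)
  have "real (card (gap_box t n)) = of_int (\<Prod>i\<in>{1..n}. gap t i)"
  proof -
    have "card (gap_box t n) = (\<Prod>i\<in>{1..n}. nat (gap t i))"
      by (simp add: gap_box_def card_PiE gap_def)
    also have "int \<dots> = (\<Prod>i\<in>{1..n}. gap t i)"
      unfolding of_nat_prod
    proof (intro prod.cong refl)
      fix i assume "i \<in> {1..n}"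
      then have "t (i - 1) < t i" using 1[of "i - 1"] by auto
      then show "int (nat (gap t i)) = gap t i" by (simp add: gap_def)
    qed
    finally show ?thesis by (metis of_int_of_nat_eq)
  qed
  then show ?case by (simp add: of_nat_poly)
next
  case (2 t d w)
  then show ?case by (simp add: gap_box_def)
next
  case (3 t n d w)
  define G where "G = (\<Prod>i\<in>{1..n}. gap t i)"
  have g: "gap t (Suc n) = t (Suc n) - t n" "t n < t (Suc n)" using 3(3) by (auto simp: gap_def)
  have 1: "zonotope_poly n (Suc d) (\<lambda>i. gap t i * w ((s(Suc n := x)) i)) (s(Suc n := x))
      = zonotope_poly n (Suc d) (\<lambda>i. gap t i * w (s i)) s" for s x
    by (rule zonotope_poly_cong) auto
  have 2: "zonotope_poly n d (\<lambda>i. gap t i * w ((s(Suc n := x)) i) * ((s(Suc n := x)) (Suc n) - (s(Suc n := x)) i)) (s(Suc n := x))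
      = zonotope_poly n d (\<lambda>i. gap t i * (w (s i) * (x - s i))) s" for s x
    by (rule zonotope_poly_cong) auto
  have IH1: "(\<Sum>s\<in>gap_box t n. zonotope_poly n (Suc d) (\<lambda>i. gap t i * w (s i)) s) = smult (of_int G) (gap_poly t n (Suc d) w)"
    unfolding G_def using 3(1,3) by simp
  have IH2: "(\<Sum>s\<in>gap_box t n. zonotope_poly n d (\<lambda>i. gap t i * (w (s i) * (x - s i))) s)
      = smult (of_int G) (gap_poly t n d (\<lambda>s. w s * (x - s)))" if "x \<in> {t n..<t (Suc n)}" for x
    unfolding G_def using 3(2)[OF that] 3(3) by simp
  have "(\<Sum>s\<in>gap_box t (Suc n). zonotope_poly (Suc n) (Suc d) (\<lambda>i. gap t i * w (s i)) s)
    = (\<Sum>x\<in>{t n..<t (Suc n)}. \<Sum>s\<in>gap_box t n. zonotope_poly n (Suc d) (\<lambda>i. gap t i * w (s i)) s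
       + smult (of_int (gap t (Suc n) * w x)) ([:0, 1:] * zonotope_poly n d (\<lambda>i. gap t i * (w (s i) * (x - s i))) s))"
    unfolding gap_box_Suc_sum zonotope_poly.simps(3) 1 2 by simp
  also have "\<dots> = (\<Sum>x\<in>{t n..<t (Suc n)}. smult (of_int G) (gap_poly t n (Suc d) w)
       + smult (of_int (gap t (Suc n) * w x)) ([:0, 1:] * smult (of_int G) (gap_poly t n d (\<lambda>s. w s * (x - s)))))"
  proof (intro sum.cong refl)
    fix x assume x: "x \<in> {t n..<t (Suc n)}"
    have "(\<Sum>s\<in>gap_box t n. smult (of_int (gap t (Suc n) * w x)) ([:0, 1:] * zonotope_poly n d (\<lambda>i. gap t i * (w (s i) * (x - s i))) s))
      = smult (of_int (gap t (Suc n) * w x)) ([:0, 1:] * (\<Sum>s\<in>gap_box t n. zonotope_poly n d (\<lambda>i. gap t i * (w (s i) * (x - s i))) s))"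
      by (simp only: sum_distrib_left smult_sum_right)
    then show "(\<Sum>s\<in>gap_box t n. zonotope_poly n (Suc d) (\<lambda>i. gap t i * w (s i)) s
       + smult (of_int (gap t (Suc n) * w x)) ([:0, 1:] * zonotope_poly n d (\<lambda>i. gap t i * (w (s i) * (x - s i))) s))
      = smult (of_int G) (gap_poly t n (Suc d) w)
       + smult (of_int (gap t (Suc n) * w x)) ([:0, 1:] * smult (of_int G) (gap_poly t n d (\<lambda>s. w s * (x - s))))"
      by (simp only: sum.distrib IH1 IH2[OF x])
  qed
  also have "\<dots> = smult (of_int (gap t (Suc n)) * of_int G) (gap_poly t n (Suc d) w)
     + smult (of_int (gap t (Suc n)) * of_int G) (\<Sum>x\<in>{t n..<t (Suc n)}. smult (of_int (w x)) ([:0, 1:] * gap_poly t n d (\<lambda>s. w s * (x - s))))"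
  proof -
    have "(\<Sum>x\<in>{t n..<t (Suc n)}. smult (of_int G) (gap_poly t n (Suc d) w))
        = smult (of_int (gap t (Suc n)) * of_int G) (gap_poly t n (Suc d) w)"
      using g by (simp add: of_nat_poly mult.commute)
    moreover have "(\<Sum>x\<in>{t n..<t (Suc n)}. smult (of_int (gap t (Suc n) * w x)) ([:0, 1:] * smult (of_int G) (gap_poly t n d (\<lambda>s. w s * (x - s)))))
      = smult (of_int (gap t (Suc n)) * of_int G) (\<Sum>x\<in>{t n..<t (Suc n)}. smult (of_int (w x)) ([:0, 1:] * gap_poly t n d (\<lambda>s. w s * (x - s))))"
      by (simp add: smult_sum_right mult.assoc mult.left_commute mult.commute)
    ultimately show ?thesis by (simp only: sum.distrib)
  qed
  also have "\<dots> = smult (of_int (gap t (Suc n)) * of_int G) (gap_poly t (Suc n) (Suc d) w)"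
    by (simp only: gap_poly.simps(3) smult_add_right)
  also have "real_of_int (gap t (Suc n)) * of_int G = of_int (\<Prod>i\<in>{1..Suc n}. gap t i)"
    by (simp add: G_def mult.commute)
  finally show ?case .
qed

section \<open>Polytopes in Euclidean space\<close>

lemma cyclic_dilate_count:
  fixes idx :: "'d::finite \<Rightarrow> nat"
  assumes d: "1 \<le> d" and idx: "bij_betw idx UNIV {1..d}" and T: "finite T" and m: "m > 0"
  shows "dilate_count (cyclic_polytope idx T) m = card (closed_points T m d)"
proof -
  define v :: "int \<Rightarrow> real ^ 'd" where "v t = (\<chi> j. of_int t ^ idx j)" for t
  define f :: "(nat \<Rightarrow> int) \<Rightarrow> real ^ 'd" where "f x = (\<chi> j. of_int (x (idx j)))" for x
  have idx_range: "idx j \<in> {1..d}" for j using idx by (auto simp: bij_betw_def)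
  have idx_surj: "\<exists>j. idx j = i" if "i \<in> {1..d}" for i
    using idx that by (metis bij_betw_imp_surj_on imageE)
  \<comment> \<open>The coordinate numbered 1 of a point on the moment curve is its parameter. Hence
    the curve is injective on \<open>T\<close>, and convex combinations can be indexed by
    \<open>T\<close> itself.\<close>
  obtain j1 where j1: "idx j1 = 1" using idx_surj[of 1] d by auto
  have inj_v: "inj_on v T"
  proof (rule inj_onI)
    fix s t assume "v s = v t"
    then have "v s $ j1 = v t $ j1" by simp
    then show "s = t" by (simp add: v_def j1)
  qed
  have hull: "p \<in> convex hull (v ` T) \<longleftrightarrow>
      (\<exists>u. (\<forall>t\<in>T. 0 \<le> u t) \<and> (\<Sum>t\<in>T. u t) = 1 \<and> (\<Sum>t\<in>T. u t *\<^sub>R v t) = p)" for p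
  proof
    assume "p \<in> convex hull (v ` T)"
    then obtain u where u: "\<forall>x\<in>v ` T. 0 \<le> u x" "sum u (v ` T) = 1" "(\<Sum>x\<in>v ` T. u x *\<^sub>R x) = p"
      using convex_hull_finite[of "v ` T"] T by auto
    then show "\<exists>u. (\<forall>t\<in>T. 0 \<le> u t) \<and> (\<Sum>t\<in>T. u t) = 1 \<and> (\<Sum>t\<in>T. u t *\<^sub>R v t) = p"
      using u(1) u(2,3)[unfolded sum.reindex[OF inj_v] comp_def] by (intro exI[of _ "\<lambda>t. u (v t)"]) simp
  next
    assume "\<exists>u. (\<forall>t\<in>T. 0 \<le> u t) \<and> (\<Sum>t\<in>T. u t) = 1 \<and> (\<Sum>t\<in>T. u t *\<^sub>R v t) = p"
    then obtain u where u: "\<And>t. t \<in> T \<Longrightarrow> 0 \<le> u t" "(\<Sum>t\<in>T. u t) = 1" "(\<Sum>t\<in>T. u t *\<^sub>R v t) = p" by blast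
    have "(\<Sum>t\<in>T. u t *\<^sub>R v t) \<in> convex hull (v ` T)"
      using u by (intro convex_sum T convex_convex_hull) (auto intro: hull_inc)
    then show "p \<in> convex hull (v ` T)" using u(3) by simp
  qed
  have "(\<lambda>x. real m *\<^sub>R x) ` (convex hull (v ` T)) \<inter> lattice_points = f ` closed_points T m d"
  proof (intro equalityI subsetI)
    fix q assume "q \<in> (\<lambda>x. real m *\<^sub>R x) ` (convex hull (v ` T)) \<inter> lattice_points"
    then obtain p where p: "q = real m *\<^sub>R p" "p \<in> convex hull (v ` T)" and lat: "\<And>j. q $ j \<in> \<int>"
      unfolding lattice_points_def by blast
    obtain u where u: "\<And>t. t \<in> T \<Longrightarrow> 0 \<le> u t" "(\<Sum>t\<in>T. u t) = 1" "(\<Sum>t\<in>T. u t *\<^sub>R v t) = p"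
      using p(2) hull by blast
    define x where "x = restrict (\<lambda>i. \<lfloor>q $ inv idx i\<rfloor>) {1..d}"
    have inv: "inv idx (idx j) = j" for j
      using idx by (intro inv_f_f) (auto simp: bij_betw_def)
    have xj: "real_of_int (x (idx j)) = q $ j" for j
      using idx_range[of j] lat[of j] by (simp add: x_def inv)
    have "in_cone T (Suc d) (homogenize m x)"
      unfolding in_cone_def
    proof (intro exI[of _ "\<lambda>t. real m * u t"] conjI ballI allI impI)
      fix j assume "j < Suc d"
      show "homogenize m x j = (\<Sum>t\<in>T. real m * u t * of_int t ^ j)"
      proof (cases "j = 0")
        case True
        then show ?thesis using u(2) by (simp add: homogenize_def flip: sum_distrib_left)
      next
        case False
        then obtain l where l: "idx l = j" using idx_surj[of j] \<open>j < Suc d\<close> by auto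
        have "q $ l = real m * (\<Sum>t\<in>T. u t * of_int t ^ j)"
          unfolding p(1) u(3)[symmetric] by (simp add: sum_component v_def l)
        then show ?thesis using False xj[of l] l by (simp add: homogenize_def sum_distrib_left mult.assoc)
      qed
    qed (use u(1) in simp)
    then have "x \<in> closed_points T m d" by (simp add: closed_points_def x_def)
    moreover have "f x = q" by (simp add: f_def vec_eq_iff xj)
    ultimately show "q \<in> f ` closed_points T m d" by blast
  next
    fix q assume "q \<in> f ` closed_points T m d"
    then obtain x where x: "q = f x" "in_cone T (Suc d) (homogenize m x)" by (auto simp: closed_points_def)
    obtain a where a: "\<And>t. t \<in> T \<Longrightarrow> a t \<ge> 0"
      "\<And>j. j < Suc d \<Longrightarrow> homogenize m x j = (\<Sum>t\<in>T. a t * of_int t ^ j)"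
      using x(2) unfolding in_cone_def by blast
    define u where "u t = a t / real m" for t
    define p where "p = (\<Sum>t\<in>T. u t *\<^sub>R v t)"
    have "(\<Sum>t\<in>T. u t) = 1"
      using a(2)[of 0] m by (simp add: u_def homogenize_def flip: sum_divide_distrib)
    then have "p \<in> convex hull (v ` T)"
      unfolding hull using a(1) by (intro exI[of _ u]) (auto simp: u_def p_def)
    moreover have "q = real m *\<^sub>R p"
    proof (rule vec_eq_iff[THEN iffD2], rule allI)
      fix j
      have "q $ j = homogenize m x (idx j)" using idx_range[of j] by (simp add: x(1) f_def homogenize_def)
      also have "\<dots> = (\<Sum>t\<in>T. a t * of_int t ^ idx j)" using idx_range[of j] by (intro a(2)) auto
      also have "\<dots> = (real m *\<^sub>R p) $ j"
        using m by (simp add: p_def sum_component u_def v_def sum_distrib_left)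
      finally show "q $ j = (real m *\<^sub>R p) $ j" .
    qed
    moreover have "q \<in> lattice_points" by (simp add: x(1) f_def lattice_points_def)
    ultimately show "q \<in> (\<lambda>x. real m *\<^sub>R x) ` (convex hull (v ` T)) \<inter> lattice_points" by blast
  qed
  moreover have "inj_on f (closed_points T m d)"
  proof (rule inj_onI)
    fix x y assume xy: "x \<in> closed_points T m d" "y \<in> closed_points T m d" "f x = f y"
    show "x = y"
    proof (rule PiE_ext[of _ "{1..d}" "\<lambda>_. UNIV"])
      fix i assume "i \<in> {1..d}"
      then obtain j where "idx j = i" using idx_surj by blast
      then show "x i = y i" using arg_cong[OF xy(3), of "\<lambda>z. z $ j"] by (simp add: f_def)
    qed (use xy in \<open>auto simp: closed_points_def\<close>)
  qed
  ultimately show ?thesis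
    unfolding dilate_count_def cyclic_polytope_def v_def[symmetric] by (simp add: card_image)
qed

lemma moment_zonotope_mem:
  "p \<in> moment_zonotope idx t n s \<longleftrightarrow>
    (\<exists>u. (\<forall>i\<in>{1..n}. 0 \<le> u i \<and> u i \<le> 1) \<and>
      p = (\<Sum>i=1..n. (u i * of_int (gap t i)) *\<^sub>R moment_vec idx (s i)))"
proof
  assume "p \<in> moment_zonotope idx t n s"
  then obtain q where q: "p = sum q {1..n}"
    "\<forall>i\<in>{1..n}. q i \<in> closed_segment 0 (of_int (gap t i) *\<^sub>R moment_vec idx (s i))"
    unfolding moment_zonotope_def by (subst (asm) set_sum_alt) auto
  then have "\<forall>i\<in>{1..n}. \<exists>u. 0 \<le> u \<and> u \<le> 1 \<and> q i = (u * of_int (gap t i)) *\<^sub>R moment_vec idx (s i)"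
    by (auto simp: in_segment)
  then obtain u where "\<forall>i\<in>{1..n}. 0 \<le> u i \<and> u i \<le> 1 \<and> q i = (u i * of_int (gap t i)) *\<^sub>R moment_vec idx (s i)"
    by metis
  then show "\<exists>u. (\<forall>i\<in>{1..n}. 0 \<le> u i \<and> u i \<le> 1) \<and>
      p = (\<Sum>i=1..n. (u i * of_int (gap t i)) *\<^sub>R moment_vec idx (s i))"
    using q(1) by (intro exI[of _ u]) auto
next
  assume "\<exists>u. (\<forall>i\<in>{1..n}. 0 \<le> u i \<and> u i \<le> 1) \<and>
      p = (\<Sum>i=1..n. (u i * of_int (gap t i)) *\<^sub>R moment_vec idx (s i))"
  then obtain u where u: "\<forall>i\<in>{1..n}. 0 \<le> u i \<and> u i \<le> 1"
    "p = (\<Sum>i=1..n. (u i * of_int (gap t i)) *\<^sub>R moment_vec idx (s i))" by blast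
  have "\<forall>i\<in>{1..n}. (u i * of_int (gap t i)) *\<^sub>R moment_vec idx (s i)
      \<in> closed_segment 0 (of_int (gap t i) *\<^sub>R moment_vec idx (s i))"
    using u(1) by (auto simp: in_segment)
  then show "p \<in> moment_zonotope idx t n s"
    unfolding moment_zonotope_def u(2) by (subst set_sum_alt) auto
qed

lemma zonotope_dilate_count:
  fixes idx :: "'d::finite \<Rightarrow> nat"
  assumes idx: "bij_betw idx UNIV {1..d}" and m: "m > 0" and g: "\<And>i. i \<in> {1..n} \<Longrightarrow> gap t i > 0"
  shows "dilate_count (moment_zonotope idx t n s) m = card (zonotope_points d n (\<lambda>i. int m * gap t i) s)"
proof -
  define f :: "(nat \<Rightarrow> int) \<Rightarrow> real ^ 'd" where "f y = (\<chi> j. of_int (y (idx j - 1)))" for y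
  have idx_range: "idx j - 1 < d" "idx j \<ge> 1" for j
  proof -
    have "idx j \<in> {1..d}" using idx by (auto simp: bij_betw_def)
    then show "idx j - 1 < d" "idx j \<ge> 1" by auto
  qed
  have idx_surj: "\<exists>j. idx j = Suc i" if "i < d" for i
  proof -
    have "Suc i \<in> range idx" using idx that by (simp add: bij_betw_def)
    then show ?thesis by auto
  qed
  have "(\<lambda>x. real m *\<^sub>R x) ` moment_zonotope idx t n s \<inter> lattice_points
      = f ` zonotope_points d n (\<lambda>i. int m * gap t i) s"
  proof (intro equalityI subsetI)
    fix q assume "q \<in> (\<lambda>x. real m *\<^sub>R x) ` moment_zonotope idx t n s \<inter> lattice_points"
    then obtain p where p: "q = real m *\<^sub>R p" "p \<in> moment_zonotope idx t n s" and lat: "\<And>j. q $ j \<in> \<int>"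
      unfolding lattice_points_def by blast
    obtain u where u: "\<forall>i\<in>{1..n}. 0 \<le> u i \<and> u i \<le> 1"
      "p = (\<Sum>i=1..n. (u i * of_int (gap t i)) *\<^sub>R moment_vec idx (s i))"
      using p(2) moment_zonotope_mem by blast
    define y where "y = restrict (\<lambda>i. \<lfloor>q $ inv idx (Suc i)\<rfloor>) {..<d}"
    have inv: "inv idx (idx j) = j" for j
      using idx by (intro inv_f_f) (auto simp: bij_betw_def)
    have yj: "real_of_int (y (idx j - 1)) = q $ j" for j
      using idx_range[of j] lat[of j] by (simp add: y_def inv)
    have "y \<in> zonotope_points d n (\<lambda>i. int m * gap t i) s"
      unfolding zonotope_points_def
    proof (intro CollectI conjI exI[of _ "\<lambda>i. real m * (u i * of_int (gap t i))"] ballI allI impI)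
      show "y \<in> {..<d} \<rightarrow>\<^sub>E UNIV" by (simp add: y_def)
      fix i assume i: "i \<in> {1..n}"
      have "u i * real_of_int (gap t i) \<ge> 0" "u i * real_of_int (gap t i) \<le> of_int (gap t i)"
        using u(1) g[OF i] i by (auto intro: mult_left_le_one_le)
      then show "0 \<le> real m * (u i * of_int (gap t i))"
        "real m * (u i * of_int (gap t i)) \<le> real_of_int (int m * gap t i)"
        by (auto intro!: mult_left_mono)
    next
      fix j assume "j < d"
      then obtain l where l: "idx l = Suc j" using idx_surj by blast
      then have "real_of_int (y j) = q $ l" using yj[of l] by simp
      also have "\<dots> = (\<Sum>i=1..n. real m * (u i * of_int (gap t i)) * of_int (s i) ^ j)"
        unfolding p(1) u(2) by (simp add: sum_component moment_vec_def l sum_distrib_left mult.assoc)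
      finally show "real_of_int (y j) = (\<Sum>i=1..n. real m * (u i * of_int (gap t i)) * of_int (s i) ^ j)" .
    qed
    moreover have "f y = q" unfolding f_def yj by simp
    ultimately show "q \<in> f ` zonotope_points d n (\<lambda>i. int m * gap t i) s" by blast
  next
    fix q assume "q \<in> f ` zonotope_points d n (\<lambda>i. int m * gap t i) s"
    then obtain y where y: "q = f y" "y \<in> zonotope_points d n (\<lambda>i. int m * gap t i) s" by blast
    obtain a where a: "\<And>i. i \<in> {1..n} \<Longrightarrow> 0 \<le> a i \<and> a i \<le> real_of_int (int m * gap t i)"
      "\<And>j. j < d \<Longrightarrow> real_of_int (y j) = (\<Sum>i\<in>{1..n}. a i * of_int (s i) ^ j)"
      using y(2) unfolding zonotope_points_def by blast
    define u where "u i = a i / (real m * of_int (gap t i))" for i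
    define p where "p = (\<Sum>i=1..n. (u i * of_int (gap t i)) *\<^sub>R moment_vec idx (s i))"
    have "\<forall>i\<in>{1..n}. 0 \<le> u i \<and> u i \<le> 1"
    proof
      fix i assume i: "i \<in> {1..n}"
      have pos: "real m * of_int (gap t i) > 0" using g[OF i] m by simp
      have "0 \<le> a i" "a i \<le> real m * of_int (gap t i)" using a(1)[OF i] by simp_all
      then show "0 \<le> u i \<and> u i \<le> 1"
        unfolding u_def using pos by (metis divide_le_eq_1_pos divide_nonneg_pos)
    qed
    then have "p \<in> moment_zonotope idx t n s" unfolding moment_zonotope_mem p_def by blast
    moreover have "q = real m *\<^sub>R p"
    proof (rule vec_eq_iff[THEN iffD2], rule allI)
      fix j
      have ua: "real m * (u i * of_int (gap t i)) = a i" if "i \<in> {1..n}" for i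
        using g[OF that] m by (simp add: u_def)
      have "q $ j = (\<Sum>i\<in>{1..n}. a i * of_int (s i) ^ (idx j - 1))"
        using a(2)[OF idx_range(1)] by (simp add: y(1) f_def)
      also have "\<dots> = (\<Sum>i\<in>{1..n}. real m * (u i * of_int (gap t i)) * of_int (s i) ^ (idx j - 1))"
        by (intro sum.cong refl) (simp only: ua)
      also have "\<dots> = (real m *\<^sub>R p) $ j"
        by (simp add: p_def sum_component moment_vec_def sum_distrib_left mult.assoc)
      finally show "q $ j = (real m *\<^sub>R p) $ j" .
    qed
    moreover have "q \<in> lattice_points" by (simp add: y(1) f_def lattice_points_def)
    ultimately show "q \<in> (\<lambda>x. real m *\<^sub>R x) ` moment_zonotope idx t n s \<inter> lattice_points" by blast
  qed
  moreover have "inj_on f (zonotope_points d n (\<lambda>i. int m * gap t i) s)"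
  proof (rule inj_onI)
    fix x y assume xy: "x \<in> zonotope_points d n (\<lambda>i. int m * gap t i) s"
      "y \<in> zonotope_points d n (\<lambda>i. int m * gap t i) s" "f x = f y"
    show "x = y"
    proof (rule PiE_ext[of _ "{..<d}" "\<lambda>_. UNIV"])
      fix i assume "i \<in> {..<d}"
      then obtain j where "idx j = Suc i" using idx_surj by blast
      then show "x i = y i" using arg_cong[OF xy(3), of "\<lambda>z. z $ j"] by (simp add: f_def)
    qed (use xy in \<open>auto simp: zonotope_points_def\<close>)
  qed
  ultimately show ?thesis unfolding dilate_count_def by (simp add: card_image)
qed

theorem theorem1p1:
  fixes idx :: "'d::finite \<Rightarrow> nat"
    and t :: "nat \<Rightarrow> int"
    and n d :: nat
  assumes "1 \<le> d" and "d \<le> n"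
    and "bij_betw idx UNIV {1..d}"
    and "strict_mono_on {0..n} t"
  shows "ehrhart_poly (cyclic_polytope idx (t ` {0..n})) =
    smult (1 / real (card (gap_box t n)))
      (\<Sum>s\<in>gap_box t n. ehrhart_poly (moment_zonotope idx t n s))"
proof -
  have mono: "t i < t j" if "i < j" "j \<le> n" for i j
    using strict_mono_onD[OF assms(4), of i j] that by auto
  then have step: "t i < t (Suc i)" if "i < n" for i using that by simp
  have gap: "gap t i > 0" if "i \<in> {1..n}" for i
    using mono[of "i - 1" i] that by (simp add: gap_def)
  have "card (t ` {0..n}) = Suc n"
    using strict_mono_on_imp_inj_on[OF assms(4)] by (simp add: card_image)
  then have T: "finite (t ` {0..n})" "Suc d \<le> card (t ` {0..n})" using assms(2) by auto
  have cyclic: "ehrhart_poly (cyclic_polytope idx (t ` {0..n})) = gap_poly t n d (\<lambda>_. 1)"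
  proof (rule ehrhart_poly_eqI)
    fix m :: nat assume m: "m > 0"
    have "poly (gap_poly t n d (\<lambda>_. 1)) (real m) = (\<Sum>k\<le>d. real m ^ k * gap_sum t n k (\<lambda>_. 1))"
      by (simp add: poly_gap_poly)
    also have "{..d} = insert 0 {1..d}" by auto
    also have "(\<Sum>k\<in>insert 0 {1..d}. real m ^ k * gap_sum t n k (\<lambda>_. 1))
        = 1 + (\<Sum>k\<in>{1..d}. real m ^ k * gap_sum t n k (\<lambda>_. 1))" by simp
    also have "\<dots> = real (card (closed_points (t ` {0..n}) m d))"
      using card_closed_points[OF T m] low_vandermonde_sum[of n t] step by (simp add: atLeast0AtMost)
    also have "\<dots> = real (dilate_count (cyclic_polytope idx (t ` {0..n})) m)"
      using cyclic_dilate_count[OF assms(1,3) T(1) m] by simp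
    finally show "poly (gap_poly t n d (\<lambda>_. 1)) (real m) = real (dilate_count (cyclic_polytope idx (t ` {0..n})) m)" .
  qed
  have zono: "ehrhart_poly (moment_zonotope idx t n s) = zonotope_poly n d (gap t) s" if s: "s \<in> gap_box t n" for s
  proof (rule ehrhart_poly_eqI)
    fix m :: nat assume m: "m > 0"
    \<comment> \<open>The entries come from successive disjoint intervals. Their increase keeps all
      projected lengths nonnegative in the zonotope count.\<close>
    have "s i < s l" if il: "1 \<le> i" "i < l" "l \<le> n" for i l
    proof -
      have "s i \<in> {t (i - 1)..t i - 1}" "s l \<in> {t (l - 1)..t l - 1}"
        using s il by (auto simp: gap_box_def PiE_iff)
      moreover have "t i \<le> t (l - 1)"
      proof (cases "i = l - 1")
        case False
        then have "i < l - 1" "l - 1 \<le> n" using il by auto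
        then show ?thesis using mono[of i "l - 1"] by simp
      qed simp
      ultimately show ?thesis by auto
    qed
    then have "real (card (zonotope_points d n (\<lambda>i. int m * gap t i) s)) = poly (zonotope_poly n d (gap t) s) (real m)"
      using gap by (intro card_zonotope_points) (auto simp: less_imp_le)
    then show "poly (zonotope_poly n d (gap t) s) (real m) = real (dilate_count (moment_zonotope idx t n s) m)"
      using zonotope_dilate_count[OF assms(3) m gap] by simp
  qed
  have "(\<Sum>s\<in>gap_box t n. ehrhart_poly (moment_zonotope idx t n s))
      = smult (of_int (\<Prod>i=1..n. gap t i)) (gap_poly t n d (\<lambda>_. 1))"
    using sum_zonotope_poly[of n t d "\<lambda>_. 1"] step by (simp add: zono)
  moreover have "real (card (gap_box t n)) = of_int (\<Prod>i=1..n. gap t i)"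
    using card_gap_box[OF assms(4)] by (metis of_int_of_nat_eq)
  moreover have "(\<Prod>i=1..n. gap t i) \<noteq> 0"
    using prod_pos[of "{1..n}" "gap t"] gap by force
  then have "1 / real_of_int (\<Prod>i=1..n. gap t i) * of_int (\<Prod>i=1..n. gap t i) = 1"
    unfolding of_int_eq_0_iff[where 'a = real, symmetric] by (simp del: of_int_prod)
  ultimately show ?thesis unfolding cyclic by (simp only: smult_smult smult_1_left)
qed

end
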